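(* For $P$-almost all $\omega\in\Omega$ and for $\nu_\omega$-almost all $x\in K_\omega$, we have $$0<\underline\kappa(K_\omega,x,\alpha)\le\overline\kappa(K_\omega,x,\alpha)<1\quad\text{for all }\alpha\in(0,1),$$ $\kappa(K_\omega,x,0)=1$ and $\kappa(K_\omega,x,1)=0$.
   Context: Mandelbrot percolation. $\mathbb N=\{1,2,\dots\}$. Fix integers $m\ge 1$, $k\ge 2$ and a probability $p$ with $k^{-m}<p\le 1$ (the range in which the limit set below is non-empty with positive probability). Let $I=\{1,\dots,k^m\}$ and $I^*=\bigcup_{i\ge 0}I^i$ (finite words, $I^0$ consisting of the empty word $\emptyset$), let $|\sigma|$ be the length of a word, $\eta|_i$ the prefix of length $i$ of $\eta\in I^*\cup I^{\mathbb N}$, $\sigma*\tau$ concatenation, and write $\sigma\prec\tau$ (or $\tau\succ\sigma$) if $\tau$ starts with $\sigma$. Let $J_\emptyset=[0,1]^m$; each closed cube $J_\sigma$ of side length $k^{-|\sigma|}$ is divided into $k^m$ closed $k$-adic subcubes $J_{\sigma*1},\dots,J_{\sigma*k^m}$ of side length $k^{-|\sigma|-1}$ (in a fixed enumeration). For $\eta\in I^{\mathbb N}$, $x(\eta)$ is the unique point of $\bigcap_{i\ge0}J_{\eta|_i}$. $\Omega$ is the set of functions $\omega:I^*\to\{c,n\}$ ($c$ = chosen, $n$ = neglected) with the product topology. $P$ is the Borel probability measure on $\Omega$ such that $\omega(\emptyset)=c$ almost surely and, going from each level to the next, if $\omega(\sigma)=c$ then each $\sigma*j$, $j\in I$, is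 chosen independently with probability $p$, while if $\omega(\sigma)=n$ then $\omega(\sigma*j)=n$ for all $j$. The limit set is $K_\omega=\bigcap_{i\ge0}\bigcup_{\sigma\in I^i,\ \omega(\sigma)=c}J_\sigma$. Natural measure. Let $d=\log(k^mp)/\log k$. For $\sigma\in I^*$ let $N_{j,\sigma}=\operatorname{card}\{\tau\in I^*: |\tau|=|\sigma|+j,\ \tau\succ\sigma,\ \omega(\tau)=c\}$ and let $X_\sigma(\omega)=\lim_{j\to\infty}N_{j,\sigma}k^{-jd}$ (a $P$-almost sure finite martingale limit). For $P$-almost every $\omega$, $\mu_\omega$ is the Borel measure on $I^{\mathbb N}$ with $\mu_\omega(\{\eta:\eta|_{|\sigma|}=\sigma\})=(\operatorname{diam}J_\emptyset)^dk^{-|\sigma|d}X_\sigma(\omega)$ for all $\sigma\in I^*$; the natural measure $\nu_\omega$ on $K_\omega$ is the image of $\mu_\omega$ under $\eta\mapsto x(\eta)$. Holes and mean porosity. $B_\varrho(z,r)$ is the open ball of the maximum metric $\varrho(x,y)=\max_i|x_i-y_i|$ in $\mathbb R^m$ (empty if $r=0$). For $j\in\mathbb N$, $Q_j^k(x)$ is the half-open $k$-adic cube $\prod_i[a_ik^{-j},(a_i+1)k^{-j})$, $a_i\in\mathbb Z$, containing $x$. For $\alpha\in[0,1]$, a set $A\subset\mathbb R^m$ has an $\alpha$-hole at scale $j$ near $x$ if there is $z\in Q_j^k(x)$ with $B_\varrho(z,\tfrac12\alpha k^{-j})\subset Q_j^k(x)\setminus A$. Let $N_i(A,x,\alpha)$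 be the number of $j\in\{1,\dots,i\}$ such that $A$ has an $\alpha$-hole at scale $j$ near $x$. Set $\underline\kappa(A,x,\alpha)=\liminf_{i\to\infty}N_i(A,x,\alpha)/i$ and $\overline\kappa(A,x,\alpha)=\limsup_{i\to\infty}N_i(A,x,\alpha)/i$; when the limit exists it is denoted by $\kappa(A,x,\alpha)$.
   Formalization: The inequality 0 < lower mean porosity is claimed only for p < 1; at p = 1 it is false, since almost surely K_ω = [0,1]^m and ν_ω-almost every x sees no α-holes for α > 0. All other assertions are kept for k^{-m} < p ≤ 1. *)

theory Defs
  imports "HOL-Probability.Probability" "HOL-Library.Sublist"
begin

section \<open>Words and cubes\<close>

definition alphabet :: "nat \<Rightarrow> nat \<Rightarrow> nat set" where
  "alphabet k m = {1..k ^ m}"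

definition words :: "nat \<Rightarrow> nat \<Rightarrow> nat list set" where
  "words k m = lists (alphabet k m)"

text \<open>The integer vectors in \<open>{0..<k}\<close> to the power \<open>m = CARD('m)\<close>: the possible positions of a
  \<open>k\<close>-adic subcube inside its parent, in units of the side length of the subcube.\<close>

definition digits :: "nat \<Rightarrow> (real ^ 'm) set" where
  "digits k = {a. \<forall>i. a $ i \<in> real ` {..<k}}"

text \<open>\<open>e \<sigma> j\<close> is the position of the subcube \<open>J\<^bsub>\<sigma>*j\<^esub>\<close> in \<open>J\<^bsub>\<sigma>\<^esub>\<close>.  The enumeration of the subcubes
  is arbitrary but fixed; it may differ from one parent cube to another.\<close>

definition subcube_enumeration :: "nat \<Rightarrow> (nat list \<Rightarrow> nat \<Rightarrow> real ^ 'm) \<Rightarrow> bool" where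
  "subcube_enumeration k e \<longleftrightarrow>
     (\<forall>\<sigma>\<in>words k CARD('m). bij_betw (e \<sigma>) (alphabet k CARD('m)) (digits k))"

definition corner :: "nat \<Rightarrow> (nat list \<Rightarrow> nat \<Rightarrow> real ^ 'm) \<Rightarrow> nat list \<Rightarrow> real ^ 'm" where
  "corner k e \<sigma> = (\<Sum>i<length \<sigma>. (1 / real k ^ Suc i) *\<^sub>R e (take i \<sigma>) (\<sigma> ! i))"

definition cube :: "nat \<Rightarrow> (nat list \<Rightarrow> nat \<Rightarrow> real ^ 'm) \<Rightarrow> nat list \<Rightarrow> (real ^ 'm) set" where
  "cube k e \<sigma> = cbox (corner k e \<sigma>) (corner k e \<sigma> + (\<chi> i. 1 / real k ^ length \<sigma>))"

text \<open>Infinite words are indexed from \<open>0\<close>, so the prefix of length \<open>i\<close> consists of the letters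
  \<open>\<eta> 0, \<dots>, \<eta> (i - 1)\<close>.\<close>

definition initial_word :: "(nat \<Rightarrow> nat) \<Rightarrow> nat \<Rightarrow> nat list" where
  "initial_word \<eta> i = map \<eta> [0..<i]"

definition coded_point :: "nat \<Rightarrow> (nat list \<Rightarrow> nat \<Rightarrow> real ^ 'm) \<Rightarrow> (nat \<Rightarrow> nat) \<Rightarrow> real ^ 'm" where
  "coded_point k e \<eta> = (THE x. x \<in> (\<Inter>i. cube k e (initial_word \<eta> i)))"


section \<open>Mandelbrot percolation\<close>

text \<open>A realisation \<open>\<omega>\<close> maps finite words to \<open>bool\<close>, where \<open>True\<close> means chosen and \<open>False\<close> means
  neglected.  The index set of words is countable, so the Borel sets of the product topology are
  those of the product \<open>\<sigma>\<close>-algebra.\<close>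

definition config_space :: "nat \<Rightarrow> nat \<Rightarrow> (nat list \<Rightarrow> bool) measure" where
  "config_space k m = (\<Pi>\<^sub>M \<sigma>\<in>words k m. count_space UNIV)"

definition agree_upto :: "nat \<Rightarrow> nat \<Rightarrow> nat \<Rightarrow> (nat list \<Rightarrow> bool) \<Rightarrow> (nat list \<Rightarrow> bool) set" where
  "agree_upto k m n s =
     {\<omega> \<in> space (config_space k m). \<forall>\<sigma>\<in>words k m. length \<sigma> \<le> n \<longrightarrow> \<omega> \<sigma> = s \<sigma>}"

definition child_pmf :: "real \<Rightarrow> bool \<Rightarrow> bool pmf" where
  "child_pmf p parent = (if parent then bernoulli_pmf p else return_pmf False)"

text \<open>The last clause is the transition rule from level \<open>n\<close> to level \<open>n + 1\<close>: given the
  configuration up to level \<open>n\<close>, the states of all words \<open>\<sigma>*j\<close> with \<open>|\<sigma>| = n\<close> are independent, and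
  the state of \<open>\<sigma>*j\<close> has law \<open>child_pmf p\<close> applied to the state of \<open>\<sigma>\<close>.\<close>

definition percolation_measure :: "nat \<Rightarrow> nat \<Rightarrow> real \<Rightarrow> (nat list \<Rightarrow> bool) measure \<Rightarrow> bool" where
  "percolation_measure k m p P \<longleftrightarrow>
     prob_space P \<and> sets P = sets (config_space k m) \<and>
     (AE \<omega> in P. \<omega> []) \<and>
     (\<forall>n s. measure P (agree_upto k m (Suc n) s) =
        measure P (agree_upto k m n s) *
        (\<Prod>\<sigma>\<in>{\<sigma>\<in>words k m. length \<sigma> = n}. \<Prod>j\<in>alphabet k m.
           pmf (child_pmf p (s \<sigma>)) (s (\<sigma> @ [j]))))"

text \<open>Percolation measures exist: push forward a product of Bernoulli measures.\<close>

lemma percolation_measure_exists: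
  assumes p: "0 \<le> p" "p \<le> 1"
  shows "\<exists>P. percolation_measure k m p P"
proof -
  let ?W = "words k m" and ?I = "alphabet k m"
  define L where "L n = {\<sigma>\<in>?W. length \<sigma> = n}" for n
  define C where "C = (\<Pi>\<^sub>M \<sigma>\<in>?W. measure_pmf (bernoulli_pmf p))"
  define T where "T c = (\<lambda>\<sigma>\<in>?W. \<forall>i\<in>{1..length \<sigma>}. c (take i \<sigma>))" for c :: "nat list \<Rightarrow> bool"
  define P where "P = distr C (config_space k m) T"
  define J where "J n s = {\<tau>\<in>?W. 1 \<le> length \<tau> \<and> length \<tau> \<le> n \<and> s (butlast \<tau>)}" for n and s :: "nat list \<Rightarrow> bool"
  define cons where "cons n s \<longleftrightarrow> s [] \<and> (\<forall>\<tau>\<in>?W. 1 \<le> length \<tau> \<and> length \<tau> \<le> n \<and> s \<tau> \<longrightarrow> s (butlast \<tau>))"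
    for n and s :: "nat list \<Rightarrow> bool"
  interpret C: product_prob_space "\<lambda>_. measure_pmf (bernoulli_pmf p)" ?W
    by unfold_locales
  have CP: "prob_space C" unfolding C_def by (rule C.prob_space_axioms)
  have spC: "space C = ?W \<rightarrow>\<^sub>E UNIV" by (simp add: C_def space_PiM)
  have spO: "space (config_space k m) = ?W \<rightarrow>\<^sub>E UNIV" by (simp add: config_space_def space_PiM)
  have wtake: "take i \<sigma> \<in> ?W" if "\<sigma> \<in> ?W" for i \<sigma>
    using that by (auto simp: words_def in_lists_conv_set dest: in_set_takeD)
  have finI: "finite ?I" by (simp add: alphabet_def)
  have finLe: "finite {\<sigma>\<in>?W. length \<sigma> \<le> n}" for n
    using finite_lists_length_le[OF finI, of n]
    by (rule rev_finite_subset) (auto simp: words_def)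
  have finL: "finite (L n)" for n
    by (rule finite_subset[OF _ finLe[of n]]) (auto simp: L_def)
  have finJ: "finite (J n s)" for n s
    by (rule finite_subset[OF _ finLe[of n]]) (auto simp: J_def)
  have Tm: "T \<in> measurable C (config_space k m)"
    unfolding config_space_def T_def
  proof (rule measurable_restrict)
    fix \<sigma> assume s: "\<sigma> \<in> ?W"
    have [measurable]: "(\<lambda>c. c (take i \<sigma>)) \<in> measurable C (count_space UNIV)" for i
      using measurable_component_singleton[OF wtake[OF s, of i], of "\<lambda>_. measure_pmf (bernoulli_pmf p)"]
      unfolding C_def measurable_cong_sets[OF refl sets_measure_pmf_count_space] .
    show "(\<lambda>c. \<forall>i\<in>{1..length \<sigma>}. c (take i \<sigma>)) \<in> measurable C (count_space UNIV)"
      by measurable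
  qed
  have T_snoc: "T c \<tau> \<longleftrightarrow> T c (butlast \<tau>) \<and> c \<tau>" if "\<tau> \<in> ?W" "1 \<le> length \<tau>" for c \<tau>
  proof -
    have b: "butlast \<tau> \<in> ?W" using wtake[OF that(1)] by (simp add: butlast_conv_take)
    have e: "{1..length \<tau>} = insert (length \<tau>) {1..length \<tau> - 1}" using that(2) by auto
    have t: "take i (butlast \<tau>) = take i \<tau>" if "i \<in> {1..length \<tau> - 1}" for i
      using that by (simp add: butlast_conv_take min_def)
    have "(\<forall>i\<in>{1..length \<tau>}. c (take i \<tau>)) \<longleftrightarrow>
        (\<forall>i\<in>{1..length \<tau> - 1}. c (take i (butlast \<tau>))) \<and> c \<tau>"
      unfolding e using t by auto
    then show ?thesis unfolding T_def using that b by simp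
  qed
  have T_nil: "T c []" for c by (simp add: T_def words_def)
  have pre: "T -` agree_upto k m n s \<inter> space C =
      (if cons n s then prod_emb ?W (\<lambda>_. measure_pmf (bernoulli_pmf p)) (J n s) (\<Pi>\<^sub>E \<tau>\<in>J n s. {s \<tau>}) else {})" for n s
  proof -
    have 1: "c \<in> T -` agree_upto k m n s \<longleftrightarrow> cons n s \<and> (\<forall>\<tau>\<in>J n s. c \<tau> = s \<tau>)"
      if "c \<in> space C" for c
    proof -
      have "c \<in> T -` agree_upto k m n s \<longleftrightarrow> (\<forall>\<sigma>\<in>?W. length \<sigma> \<le> n \<longrightarrow> T c \<sigma> = s \<sigma>)"
        by (auto simp: agree_upto_def spO T_def)
      also have "\<dots> \<longleftrightarrow> cons n s \<and> (\<forall>\<tau>\<in>J n s. c \<tau> = s \<tau>)" (is "?l \<longleftrightarrow> ?r")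
      proof
        assume l: ?l
        have nil: "[] \<in> ?W" by (simp add: words_def)
        have "s []" using l nil T_nil by fastforce
        moreover have "(s \<tau> \<longrightarrow> s (butlast \<tau>)) \<and> (s (butlast \<tau>) \<longrightarrow> c \<tau> = s \<tau>)"
          if "\<tau>\<in>?W" "1 \<le> length \<tau>" "length \<tau> \<le> n" for \<tau>
        proof -
          have b: "butlast \<tau> \<in> ?W" using wtake[OF that(1)] by (simp add: butlast_conv_take)
          have "T c \<tau> = s \<tau>" "T c (butlast \<tau>) = s (butlast \<tau>)" using l that b by auto
          then show ?thesis using T_snoc[OF that(1,2), of c] by auto
        qed
        ultimately show ?r by (auto simp: cons_def J_def)
      next
        assume r: ?r
        have "T c \<sigma> = s \<sigma>" if "\<sigma>\<in>?W" "length \<sigma> \<le> n" for \<sigma>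
          using that
        proof (induction \<sigma> rule: rev_induct)
          case Nil then show ?case using T_nil r by (auto simp: cons_def)
        next
          case (snoc j \<sigma>)
          have "\<sigma> \<in> ?W" using snoc.prems by (simp add: words_def)
          then have "T c \<sigma> = s \<sigma>" using snoc by simp
          then show ?case using T_snoc[OF snoc.prems(1), of c] r snoc.prems
            by (auto simp: cons_def J_def)
        qed
        then show ?l by blast
      qed
      finally show ?thesis .
    qed
    have 2: "prod_emb ?W (\<lambda>_. measure_pmf (bernoulli_pmf p)) (J n s) (\<Pi>\<^sub>E \<tau>\<in>J n s. {s \<tau>}) =
       {c\<in>space C. \<forall>\<tau>\<in>J n s. c \<tau> = s \<tau>}"
      by (auto simp: prod_emb_def spC PiE_iff restrict_def extensional_def)
    show ?thesis unfolding 2 using 1 by auto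
  qed
  have agree_sets: "agree_upto k m n s \<in> sets (config_space k m)" for n s
  proof -
    have "agree_upto k m n s = space (config_space k m) \<inter>
       (\<Inter>\<sigma>\<in>{\<sigma>\<in>?W. length \<sigma> \<le> n}. {\<omega>\<in>space (config_space k m). \<omega> \<sigma> = s \<sigma>})"
      by (auto simp: agree_upto_def)
    also have "\<dots> \<in> sets (config_space k m)"
    proof -
      have "[] \<in> {\<sigma>\<in>?W. length \<sigma> \<le> n}" by (simp add: words_def)
      then have "{\<sigma>\<in>?W. length \<sigma> \<le> n} \<noteq> {}" by blast
      then show ?thesis
        by (intro sets.Int sets.top sets.finite_INT finLe)
           (auto simp: config_space_def)
    qed
    finally show ?thesis .
  qed
  have mP: "measure P (agree_upto k m n s) =
      (if cons n s then \<Prod>\<tau>\<in>J n s. pmf (bernoulli_pmf p) (s \<tau>) else 0)" for n s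
  proof -
    have "measure P (agree_upto k m n s) = measure C (T -` agree_upto k m n s \<inter> space C)"
      unfolding P_def by (rule measure_distr[OF Tm agree_sets])
    also have "\<dots> = (if cons n s then \<Prod>\<tau>\<in>J n s. pmf (bernoulli_pmf p) (s \<tau>) else 0)"
      unfolding pre using C.measure_PiM_emb[of "J n s" "\<lambda>\<tau>. {s \<tau>}"] finJ
      by (auto simp: C_def J_def measure_pmf_single)
    finally show ?thesis .
  qed
  have trans: "measure P (agree_upto k m (Suc n) s) =
        measure P (agree_upto k m n s) *
        (\<Prod>\<sigma>\<in>L n. \<Prod>j\<in>?I. pmf (child_pmf p (s \<sigma>)) (s (\<sigma> @ [j])))" (is "_ = _ * ?R") for n s
  proof -
    have step: "\<tau> \<in> ?W \<and> length \<tau> = Suc n \<longleftrightarrow> (\<exists>\<sigma>\<in>L n. \<exists>j\<in>?I. \<tau> = \<sigma> @ [j])" for \<tau>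
      by (cases \<tau> rule: rev_cases) (auto simp: L_def words_def)
    have cS: "cons (Suc n) s \<longleftrightarrow> cons n s \<and> (\<forall>\<sigma>\<in>L n. \<forall>j\<in>?I. s (\<sigma> @ [j]) \<longrightarrow> s \<sigma>)"
    proof -
      have "cons (Suc n) s \<longleftrightarrow> cons n s \<and> (\<forall>\<tau>. \<tau> \<in> ?W \<and> length \<tau> = Suc n \<longrightarrow> s \<tau> \<longrightarrow> s (butlast \<tau>))"
      proof -
        have l: "1 \<le> length \<tau> \<and> length \<tau> \<le> Suc n \<and> Q \<longleftrightarrow>
            (1 \<le> length \<tau> \<and> length \<tau> \<le> n \<and> Q) \<or> (length \<tau> = Suc n \<and> Q)" for \<tau> :: "nat list" and Q
          by auto
        show ?thesis unfolding cons_def l by blast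
      qed
      also have "\<dots> \<longleftrightarrow> cons n s \<and> (\<forall>\<sigma>\<in>L n. \<forall>j\<in>?I. s (\<sigma> @ [j]) \<longrightarrow> s \<sigma>)"
        unfolding step by (metis butlast_snoc)
      finally show ?thesis .
    qed
    consider "\<not> cons n s" | \<sigma> j where "cons n s" "\<sigma> \<in> L n" "j \<in> ?I" "s (\<sigma> @ [j])" "\<not> s \<sigma>"
      | "cons n s" "\<forall>\<sigma>\<in>L n. \<forall>j\<in>?I. s (\<sigma> @ [j]) \<longrightarrow> s \<sigma>" by blast
    then show ?thesis
    proof cases
      case 1 then show ?thesis by (simp add: mP cS)
    next
      case 2
      have "(\<Prod>j\<in>?I. pmf (child_pmf p (s \<sigma>)) (s (\<sigma> @ [j]))) = 0"
        using 2 finI by (intro prod_zero bexI[of _ j]) (auto simp: child_pmf_def)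
      then have "?R = 0" using 2(2) by (intro prod_zero[OF finL] bexI[of _ \<sigma>])
      then show ?thesis using 2 by (auto simp: mP cS)
    next
      case 3
      let ?D = "(\<lambda>(\<sigma>, j). \<sigma> @ [j]) ` ({\<sigma>\<in>L n. s \<sigma>} \<times> ?I)"
      have JS: "J (Suc n) s = J n s \<union> ?D"
      proof -
        have "J (Suc n) s = J n s \<union> {\<tau>. (\<tau> \<in> ?W \<and> length \<tau> = Suc n) \<and> s (butlast \<tau>)}"
          by (auto simp: J_def le_Suc_eq)
        also have "{\<tau>. (\<tau> \<in> ?W \<and> length \<tau> = Suc n) \<and> s (butlast \<tau>)} = ?D"
          unfolding step by force
        finally show ?thesis .
      qed
      have disj: "J n s \<inter> ?D = {}" by (auto simp: J_def L_def)
      have "?R = (\<Prod>\<sigma>\<in>L n. if s \<sigma> then \<Prod>j\<in>?I. pmf (bernoulli_pmf p) (s (\<sigma> @ [j])) else 1)"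
        using 3(2) by (intro prod.cong refl) (auto simp: child_pmf_def intro!: prod.neutral)
      also have "\<dots> = (\<Prod>\<sigma>\<in>{\<sigma>\<in>L n. s \<sigma>}. \<Prod>j\<in>?I. pmf (bernoulli_pmf p) (s (\<sigma> @ [j])))"
        using finL by (simp add: prod.inter_filter)
      also have "\<dots> = (\<Prod>\<tau>\<in>?D. pmf (bernoulli_pmf p) (s \<tau>))"
        by (subst prod.reindex) (auto simp: inj_on_def prod.cartesian_product intro!: prod.cong)
      finally show ?thesis using 3 finJ[of n s] finL finI disj
        by (simp add: mP cS JS prod.union_disjoint)
    qed
  qed
  have rt: "AE \<omega> in P. \<omega> []"
  proof -
    have "{x \<in> space (config_space k m). x []} = {\<omega>\<in>space (config_space k m). \<omega> [] = True}" by simp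
    also have "\<dots> \<in> sets (config_space k m)"
      unfolding config_space_def by (auto simp: words_def)
    finally show ?thesis
      unfolding P_def by (subst AE_distr_iff[OF Tm]) (auto simp: T_nil)
  qed
  have "prob_space P" unfolding P_def by (rule prob_space.prob_space_distr[OF CP Tm])
  then show ?thesis using rt trans
    by (auto simp: percolation_measure_def L_def P_def intro!: exI[of _ P])
qed

definition limit_set ::
    "nat \<Rightarrow> (nat list \<Rightarrow> nat \<Rightarrow> real ^ 'm) \<Rightarrow> (nat list \<Rightarrow> bool) \<Rightarrow> (real ^ 'm) set" where
  "limit_set k e \<omega> =
     (\<Inter>i. \<Union>\<sigma>\<in>{\<sigma>\<in>words k CARD('m). length \<sigma> = i \<and> \<omega> \<sigma>}. cube k e \<sigma>)"


section \<open>Natural measure\<close>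

definition perc_dim :: "nat \<Rightarrow> nat \<Rightarrow> real \<Rightarrow> real" where
  "perc_dim k m p = ln (real k ^ m * p) / ln (real k)"

definition num_chosen :: "nat \<Rightarrow> nat \<Rightarrow> (nat list \<Rightarrow> bool) \<Rightarrow> nat \<Rightarrow> nat list \<Rightarrow> nat" where
  "num_chosen k m \<omega> j \<sigma> =
     card {\<tau>\<in>words k m. length \<tau> = length \<sigma> + j \<and> prefix \<sigma> \<tau> \<and> \<omega> \<tau>}"

text \<open>The limit exists for almost every \<open>\<omega>\<close>; elsewhere \<open>lim\<close> is an unspecified real.\<close>

definition mart_limit :: "nat \<Rightarrow> nat \<Rightarrow> real \<Rightarrow> (nat list \<Rightarrow> bool) \<Rightarrow> nat list \<Rightarrow> real" where
  "mart_limit k m p \<omega> \<sigma> =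
     lim (\<lambda>j. real (num_chosen k m \<omega> j \<sigma>) * real k powr (- real j * perc_dim k m p))"

definition code_space :: "nat \<Rightarrow> nat \<Rightarrow> (nat \<Rightarrow> nat) measure" where
  "code_space k m = (\<Pi>\<^sub>M i\<in>UNIV. count_space (alphabet k m))"

definition code_cylinder :: "nat \<Rightarrow> nat \<Rightarrow> nat list \<Rightarrow> (nat \<Rightarrow> nat) set" where
  "code_cylinder k m \<sigma> = {\<eta> \<in> space (code_space k m). initial_word \<eta> (length \<sigma>) = \<sigma>}"

definition is_code_measure ::
    "nat \<Rightarrow> (nat list \<Rightarrow> nat \<Rightarrow> real ^ 'm) \<Rightarrow> real \<Rightarrow> (nat list \<Rightarrow> bool) \<Rightarrow> (nat \<Rightarrow> nat) measure \<Rightarrow> bool" where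
  "is_code_measure k e p \<omega> \<mu> \<longleftrightarrow>
     sets \<mu> = sets (code_space k CARD('m)) \<and>
     (\<forall>\<sigma>\<in>words k CARD('m). emeasure \<mu> (code_cylinder k CARD('m) \<sigma>) =
        ennreal (diameter (cube k e []) powr perc_dim k CARD('m) p *
                 real k powr (- real (length \<sigma>) * perc_dim k CARD('m) p) *
                 mart_limit k CARD('m) p \<omega> \<sigma>))"

text \<open>For almost every \<open>\<omega>\<close> there is exactly one such measure; elsewhere \<open>THE\<close> yields an
  unspecified measure.\<close>

definition code_measure ::
    "nat \<Rightarrow> (nat list \<Rightarrow> nat \<Rightarrow> real ^ 'm) \<Rightarrow> real \<Rightarrow> (nat list \<Rightarrow> bool) \<Rightarrow> (nat \<Rightarrow> nat) measure" where
  "code_measure k e p \<omega> = (THE \<mu>. is_code_measure k e p \<omega> \<mu>)"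

definition natural_measure ::
    "nat \<Rightarrow> (nat list \<Rightarrow> nat \<Rightarrow> real ^ 'm) \<Rightarrow> real \<Rightarrow> (nat list \<Rightarrow> bool) \<Rightarrow> (real ^ 'm) measure" where
  "natural_measure k e p \<omega> = distr (code_measure k e p \<omega>) borel (coded_point k e)"


section \<open>Holes and mean porosity\<close>

text \<open>On \<open>real ^ 'm\<close> the library's \<open>infnorm\<close> is the maximum norm.\<close>

definition max_ball :: "real ^ 'm \<Rightarrow> real \<Rightarrow> (real ^ 'm) set" where
  "max_ball z r = {y. infnorm (z - y) < r}"

definition kadic_cube :: "nat \<Rightarrow> nat \<Rightarrow> int ^ 'm \<Rightarrow> (real ^ 'm) set" where
  "kadic_cube k j a =
     {y. \<forall>i. of_int (a $ i) / real k ^ j \<le> y $ i \<and> y $ i < (of_int (a $ i) + 1) / real k ^ j}"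

definition kadic_cube_at :: "nat \<Rightarrow> nat \<Rightarrow> real ^ 'm \<Rightarrow> (real ^ 'm) set" where
  "kadic_cube_at k j x = kadic_cube k j (\<chi> i. \<lfloor>real k ^ j * x $ i\<rfloor>)"

lemma mem_kadic_cube_at: "k > 0 \<Longrightarrow> x \<in> kadic_cube_at k j x"
  by (auto simp: kadic_cube_at_def kadic_cube_def field_simps) linarith

definition has_hole :: "nat \<Rightarrow> (real ^ 'm) set \<Rightarrow> real ^ 'm \<Rightarrow> real \<Rightarrow> nat \<Rightarrow> bool" where
  "has_hole k A x \<alpha> j \<longleftrightarrow>
     (\<exists>z\<in>kadic_cube_at k j x.
        max_ball z (\<alpha> / (2 * real k ^ j)) \<subseteq> kadic_cube_at k j x - A)"

definition num_holes :: "nat \<Rightarrow> (real ^ 'm) set \<Rightarrow> real ^ 'm \<Rightarrow> real \<Rightarrow> nat \<Rightarrow> nat" where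
  "num_holes k A x \<alpha> i = card {j\<in>{1..i}. has_hole k A x \<alpha> j}"

definition lower_mean_porosity :: "nat \<Rightarrow> (real ^ 'm) set \<Rightarrow> real ^ 'm \<Rightarrow> real \<Rightarrow> ereal" where
  "lower_mean_porosity k A x \<alpha> = liminf (\<lambda>i. ereal (real (num_holes k A x \<alpha> i) / real i))"

definition upper_mean_porosity :: "nat \<Rightarrow> (real ^ 'm) set \<Rightarrow> real ^ 'm \<Rightarrow> real \<Rightarrow> ereal" where
  "upper_mean_porosity k A x \<alpha> = limsup (\<lambda>i. ereal (real (num_holes k A x \<alpha> i) / real i))"

text \<open>The limit exists and equals \<open>c\<close>.\<close>

definition has_mean_porosity :: "nat \<Rightarrow> (real ^ 'm) set \<Rightarrow> real ^ 'm \<Rightarrow> real \<Rightarrow> real \<Rightarrow> bool" where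
  "has_mean_porosity k A x \<alpha> c \<longleftrightarrow>
     (\<lambda>i. real (num_holes k A x \<alpha> i) / real i) \<longlonglongrightarrow> c"

end

theory Submission
  imports Defs
begin

text \<open>A percolation configuration is a pruned field of independent marks: give every word an independent Bernoulli mark and
choose a word when all its non-empty prefixes are marked. In this picture the configuration below a chosen word is a
copy of the whole configuration, and it is independent of everything that does not lie below that word. All
probabilistic steps use these two facts.

\<^emph>\<open>Frequency of block events.\<close> Cut a code into blocks of \<open>l\<close> letters. A block event is
a condition on a block \<open>\<tau>\<close> that follows a word \<open>\<sigma>\<close> and on the configuration
below \<open>\<sigma>\<close>, as far as it does not lie strictly below \<open>\<sigma> @ \<tau>\<close>. Suppose
that, whatever \<open>\<sigma>\<close> is, it has probability at least \<open>\<delta> > 0\<close> for some block.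
Multiply the mass of each word of \<open>n\<close> blocks by \<open>1/2\<close> for every occurrence along the word.
The mass below \<open>\<sigma> @ \<tau>\<close> is independent of the event at \<open>\<tau>\<close>, so each level of
blocks contributes a factor at most \<open>r < 1\<close> to the expected total damped mass
(\<open>nn_integral_damped_mass_le\<close>). Hence the words with fewer than \<open>\<epsilon> n\<close> occurrences
carry summable mass when \<open>2 powr \<epsilon>\<close> is smaller than \<open>1 / r\<close>, and by Borel-Cantelli
almost every code has at least \<open>\<epsilon> n\<close> occurrences among its first \<open>n\<close> blocks, for
all large \<open>n\<close> (\<open>AE_occurrences_frequent\<close>).

\<^emph>\<open>Three block events.\<close> If the block leads into the lower corner of
\<open>J\<^bsub>\<sigma>\<^esub>\<close> and no other descendant of its length is chosen, then the limit set inside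
the interior of \<open>J\<^bsub>\<sigma>\<^esub>\<close> lies in a corner cube of relative side \<open>k\<close> to
the power \<open>-l\<close>, and the rest of \<open>J\<^bsub>\<sigma>\<^esub>\<close> holds every
\<open>\<alpha>\<close>-hole with \<open>\<alpha> \<le> 1 - side l\<close> (\<open>has_hole_of_corner\<close>). This
has positive probability for \<open>p < 1\<close>, and it makes the lower mean porosity positive. If all descendants
at distance \<open>l\<close> are chosen and have infinite lines of descent, then every subcube of that generation
meets the limit set and there is no \<open>\<alpha>\<close>-hole with \<open>\<alpha> > 2 * side l\<close>
(\<open>no_hole_of_full\<close>); this makes the upper mean porosity smaller than one. Finally, the single letters
with all digits \<open>0\<close> and with all digits \<open>k - 1\<close> recur along almost every code, so the coded
point is interior to all its cubes (\<open>coded_point_in_open_cube\<close>): the half-open cube of a scale then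
agrees with the cube of the code, and holes inside it depend only on the configuration below one word.

\<^emph>\<open>Mass and survival.\<close> The increments of the normalised generation sizes have geometrically
decaying second moments (\<open>variance_increment\<close>). The sizes therefore converge almost surely, dominated by
an integrable function. Their limits define the measure on codes, and since their means stay one, a line of descent is
infinite with positive probability (\<open>prob_survives_pos\<close>).\<close>


section \<open>Measures on products of finite sets\<close>

text \<open>Every cylinder with finite base is a finite disjoint union of patterns on a larger finite set of coordinates. It is
therefore enough to compare patterns on a cofinal family of finite sets: the words up to a given length for
configurations, the first \<open>n\<close> letters for codes.\<close>

lemma measure_eqI_finite_patterns:
  fixes B :: "'i \<Rightarrow> 'a set"
  assumes fin: "\<And>i. i \<in> I \<Longrightarrow> finite (B i)"
    and sets: "sets M = sets (\<Pi>\<^sub>M i\<in>I. count_space (B i))" "sets N = sets (\<Pi>\<^sub>M i\<in>I. count_space (B i))"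
    and M: "finite_measure M"
    and cof: "\<And>J. finite J \<Longrightarrow> J \<subseteq> I \<Longrightarrow> \<exists>K. J \<subseteq> K \<and> K \<subseteq> I \<and> finite K \<and>
      (\<forall>s\<in>Pi\<^sub>E K B. emeasure M {x \<in> Pi\<^sub>E I B. \<forall>i\<in>K. x i = s i} = emeasure N {x \<in> Pi\<^sub>E I B. \<forall>i\<in>K. x i = s i})"
  shows "M = N"
proof (rule measure_eqI_PiM_infinite[OF sets _ M])
  fix A J assume J: "finite J" "J \<subseteq> I" and A: "\<And>i. i \<in> J \<Longrightarrow> A i \<in> sets (count_space (B i))"
  obtain K where K: "J \<subseteq> K" "K \<subseteq> I" "finite K"
    and eq: "\<And>s. s \<in> Pi\<^sub>E K B \<Longrightarrow>
      emeasure M {x \<in> Pi\<^sub>E I B. \<forall>i\<in>K. x i = s i} = emeasure N {x \<in> Pi\<^sub>E I B. \<forall>i\<in>K. x i = s i}"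
    using cof[OF J] by blast
  define S where "S = {s\<in>Pi\<^sub>E K B. \<forall>j\<in>J. s j \<in> A j}"
  define Z where "Z s = {x \<in> Pi\<^sub>E I B. \<forall>i\<in>K. x i = s i}" for s
  have finS: "finite S"
    unfolding S_def by (intro finite_Collect_conjI disjI1) 
      (use K fin in \<open>simp add: finite_PiE subset_iff\<close>)
  have U: "prod_emb I (\<lambda>i. count_space (B i)) J (Pi\<^sub>E J A) = (\<Union>s\<in>S. Z s)"
  proof (intro set_eqI iffI)
    fix x assume "x \<in> prod_emb I (\<lambda>i. count_space (B i)) J (Pi\<^sub>E J A)"
    then have x: "x \<in> Pi\<^sub>E I B" "\<And>j. j \<in> J \<Longrightarrow> x j \<in> A j"
      by (auto simp: prod_emb_def restrict_PiE_iff)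
    then have "restrict x K \<in> S" "x \<in> Z (restrict x K)"
      using K by (auto simp: S_def Z_def)
    then show "x \<in> (\<Union>s\<in>S. Z s)" by blast
  next
    fix x assume "x \<in> (\<Union>s\<in>S. Z s)"
    then obtain s where "s \<in> S" "x \<in> Z s" by blast
    moreover have "x j \<in> A j" if "j \<in> J" for j
      using that K(1) calculation by (simp add: S_def Z_def subset_iff)
    ultimately show "x \<in> prod_emb I (\<lambda>i. count_space (B i)) J (Pi\<^sub>E J A)"
      by (simp add: prod_emb_def Z_def restrict_PiE_iff)
  qed
  have disj: "disjoint_family_on Z S"
  proof (unfold disjoint_family_on_def, safe)
    fix s t x assume "s \<in> S" "t \<in> S" "s \<noteq> t" "x \<in> Z s" "x \<in> Z t"
    moreover have "s = t" by (rule PiE_ext[of s K B t]) (use calculation in \<open>auto simp: S_def Z_def\<close>)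
    ultimately show "x \<in> {}" by simp
  qed
  have Zm: "Z s \<in> sets (\<Pi>\<^sub>M i\<in>I. count_space (B i))" if "s \<in> S" for s
  proof -
    have "Z s = prod_emb I (\<lambda>i. count_space (B i)) K (\<Pi>\<^sub>E i\<in>K. {s i})"
      using K by (auto simp: Z_def prod_emb_def restrict_PiE_iff)
    also have "\<dots> \<in> sets (\<Pi>\<^sub>M i\<in>I. count_space (B i))"
      using K that by (intro sets_PiM_I) (auto simp: S_def)
    finally show ?thesis .
  qed
  have "emeasure M' (\<Union>s\<in>S. Z s) = (\<Sum>s\<in>S. emeasure M' (Z s))"
    if "sets M' = sets (\<Pi>\<^sub>M i\<in>I. count_space (B i))" for M'
    using that Zm by (intro sum_emeasure[symmetric] disj finS) auto
  moreover have "(\<Sum>s\<in>S. emeasure M (Z s)) = (\<Sum>s\<in>S. emeasure N (Z s))"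
    using eq by (intro sum.cong) (auto simp: S_def Z_def)
  ultimately show "emeasure M (prod_emb I (\<lambda>i. count_space (B i)) J (Pi\<^sub>E J A)) =
      emeasure N (prod_emb I (\<lambda>i. count_space (B i)) J (Pi\<^sub>E J A))"
    using sets unfolding U by simp
qed


section \<open>Coordinates and subtrees\<close>

text \<open>Extensional form of measurability with respect to a family of coordinates; functions that depend on disjoint families
are independent under a product measure.\<close>

definition depends_on :: "'i set \<Rightarrow> (('i \<Rightarrow> 'a) \<Rightarrow> 'b) \<Rightarrow> bool" where
  "depends_on J f \<longleftrightarrow> (\<forall>c c'. (\<forall>i\<in>J. c i = c' i) \<longrightarrow> f c = f c')"

lemma depends_onI: "(\<And>c c'. (\<And>i. i \<in> J \<Longrightarrow> c i = c' i) \<Longrightarrow> f c = f c') \<Longrightarrow> depends_on J f"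
  unfolding depends_on_def by blast

lemma depends_onD: "depends_on J f \<Longrightarrow> (\<And>i. i \<in> J \<Longrightarrow> c i = c' i) \<Longrightarrow> f c = f c'"
  unfolding depends_on_def by blast

lemma depends_on_indicator:
  assumes "depends_on J f"
  shows "depends_on J (indicator {c. f c} :: _ \<Rightarrow> 'c :: zero_neq_one)"
proof (rule depends_onI)
  fix c c' :: "'a \<Rightarrow> 'b" assume "\<And>i. i \<in> J \<Longrightarrow> c i = c' i"
  then have "f c = f c'" by (rule depends_onD[OF assms])
  then show "(indicator {c. f c} c :: 'c) = indicator {c. f c} c'" by (simp add: indicator_def)
qed

lemma depends_on_mono: "depends_on J f \<Longrightarrow> J \<subseteq> K \<Longrightarrow> depends_on K f"
  unfolding depends_on_def by blast

lemma depends_on_compose2: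
  assumes "depends_on J f" "depends_on J g"
  shows "depends_on J (\<lambda>c. h (f c) (g c))"
proof (rule depends_onI)
  fix c c' :: "'a \<Rightarrow> 'b" assume "\<And>i. i \<in> J \<Longrightarrow> c i = c' i"
  then have "f c = f c'" "g c = g c'" by (auto intro: depends_onD[OF assms(1)] depends_onD[OF assms(2)])
  then show "h (f c) (g c) = h (f c') (g c')" by simp
qed

lemma depends_on_compose: "depends_on J f \<Longrightarrow> depends_on J (\<lambda>c. h (f c))"
  by (rule depends_on_compose2[of J f f "\<lambda>x _. h x"])

definition subtree :: "'a list \<Rightarrow> ('a list \<Rightarrow> 'b) \<Rightarrow> 'a list \<Rightarrow> 'b" where
  "subtree \<sigma> c = (\<lambda>\<tau>. c (\<sigma> @ \<tau>))"

lemma subtree_apply: "subtree \<sigma> c \<tau> = c (\<sigma> @ \<tau>)" by (simp add: subtree_def)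
lemma subtree_Nil [simp]: "subtree [] c = c" by (simp add: subtree_def)
lemma subtree_subtree [simp]: "subtree \<tau> (subtree \<sigma> c) = subtree (\<sigma> @ \<tau>) c" by (simp add: subtree_def)

lemma depends_on_subtree:
  assumes "depends_on J f"
  shows "depends_on ((@) \<sigma> ` J) (\<lambda>c. f (subtree \<sigma> c))"
proof (rule depends_onI)
  fix c c' :: "'a list \<Rightarrow> 'b" assume "\<And>i. i \<in> (@) \<sigma> ` J \<Longrightarrow> c i = c' i"
  then show "f (subtree \<sigma> c) = f (subtree \<sigma> c')"
    by (intro depends_onD[OF assms]) (simp add: subtree_apply)
qed


section \<open>Words and the field of independent marks\<close>

definition words_of_length:: "nat \<Rightarrow> nat \<Rightarrow> nat \<Rightarrow> nat list set" where
  "words_of_length k m n = {\<sigma>\<in>words k m. length \<sigma> = n}"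

definition survives :: "nat \<Rightarrow> nat \<Rightarrow> (nat list \<Rightarrow> bool) \<Rightarrow> bool" where
  "survives k m \<omega> \<longleftrightarrow> (\<forall>n. \<exists>\<tau>\<in>words_of_length k m n. \<omega> \<tau>)"

text \<open>The lower bound on \<open>p\<close> says that the mean number \<open>k ^ m * p\<close> of chosen children exceeds one.\<close>

locale supercritical =
  fixes k m :: nat and p :: real
  assumes k_ge_2: "2 \<le> k" and p_gt: "1 / real k ^ m < p" and p_le_1: "p \<le> 1"
begin

abbreviation "W \<equiv> words k m"
abbreviation "I \<equiv> alphabet k m"
abbreviation "L n \<equiv> words_of_length k m n"
abbreviation "\<Omega> \<equiv> config_space k m"

lemma p_pos: "0 < p"
proof -
  have "0 < 1 / real k ^ m" using k_ge_2 by simp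
  then show ?thesis using p_gt by linarith
qed

lemma finite_alphabet [simp, intro]: "finite I" by (simp add: alphabet_def)
lemma card_alphabet: "card I = k ^ m" by (simp add: alphabet_def)
lemma Nil_in_words [simp, intro]: "[] \<in> W" by (simp add: words_def)
lemma append_in_words [simp]: "\<sigma> @ \<tau> \<in> W \<longleftrightarrow> \<sigma> \<in> W \<and> \<tau> \<in> W" by (simp add: words_def)
lemma Cons_in_words [simp]: "j # \<tau> \<in> W \<longleftrightarrow> j \<in> I \<and> \<tau> \<in> W" by (simp add: words_def)
lemma take_in_words [simp, intro]: "\<sigma> \<in> W \<Longrightarrow> take i \<sigma> \<in> W"
  by (auto simp: words_def in_lists_conv_set dest: in_set_takeD)
lemma drop_in_words [simp, intro]: "\<sigma> \<in> W \<Longrightarrow> drop i \<sigma> \<in> W"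
  by (auto simp: words_def in_lists_conv_set dest: in_set_dropD)

lemma finite_words_le [simp, intro]: "finite {\<sigma>\<in>W. length \<sigma> \<le> n}"
  using finite_lists_length_le[OF finite_alphabet, of n]
  by (rule rev_finite_subset) (auto simp: words_def)

lemma finite_words_of_length [simp, intro]: "finite (L n)"
  by (rule finite_subset[OF _ finite_words_le[of n]]) (auto simp: words_of_length_def)

lemma card_words_of_length: "card (L n) = (k ^ m) ^ n"
  using card_lists_length_eq[OF finite_alphabet, of n]
  by (simp add: words_of_length_def words_def card_alphabet lists_eq_set)

lemma words_of_length_0: "L 0 = {[]}" by (auto simp: words_of_length_def)

lemma words_of_length_add: "L (a + b) = (\<lambda>(\<sigma>, \<tau>). \<sigma> @ \<tau>) ` (L a \<times> L b)"
proof
  show "L (a + b) \<subseteq> (\<lambda>(\<sigma>, \<tau>). \<sigma> @ \<tau>) ` (L a \<times> L b)"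
  proof
    fix \<sigma> assume "\<sigma> \<in> L (a + b)"
    then show "\<sigma> \<in> (\<lambda>(\<sigma>, \<tau>). \<sigma> @ \<tau>) ` (L a \<times> L b)"
      by (intro image_eqI[of _ _ "(take a \<sigma>, drop a \<sigma>)"]) (auto simp: words_of_length_def)
  qed
qed (auto simp: words_of_length_def)

lemma sum_words_of_length_add:
  "(\<Sum>\<sigma>\<in>L (a + b). f \<sigma>) = (\<Sum>\<sigma>\<in>L a. \<Sum>\<tau>\<in>L b. f (\<sigma> @ \<tau>))"
proof -
  have "inj_on (\<lambda>(\<sigma>, \<tau>). \<sigma> @ \<tau>) (L a \<times> L b)"
    by (auto simp: inj_on_def words_of_length_def)
  then show ?thesis
    unfolding words_of_length_add by (subst sum.reindex) (auto simp: sum.cartesian_product case_prod_unfold)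
qed

lemma words_of_length_1: "L (Suc 0) = (\<lambda>j. [j]) ` I"
  by (auto simp: words_of_length_def length_Suc_conv)

lemma sum_words_of_length_1: "(\<Sum>\<sigma>\<in>L (Suc 0). f \<sigma>) = (\<Sum>j\<in>I. f [j])"
  unfolding words_of_length_1 by (subst sum.reindex) (auto simp: inj_on_def)

definition field :: "(nat list \<Rightarrow> bool) measure" where
  "field = (\<Pi>\<^sub>M \<sigma>\<in>UNIV. measure_pmf (bernoulli_pmf p))"

text \<open>Undefined outside the words, so that the values lie in the space of configurations; \<open>subtree\<close> at a chosen
word then maps configurations to configurations.\<close>

definition percolate :: "(nat list \<Rightarrow> bool) \<Rightarrow> nat list \<Rightarrow> bool" where
  "percolate c = (\<lambda>\<sigma>\<in>W. \<forall>i\<in>{1..length \<sigma>}. c (take i \<sigma>))"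

sublocale field: product_prob_space "\<lambda>_. measure_pmf (bernoulli_pmf p)" "UNIV :: nat list set"
  by unfold_locales

sublocale F: prob_space field
  unfolding field_def by (rule field.prob_space_axioms)

lemma space_field [simp]: "space field = UNIV" by (simp add: field_def space_PiM)

lemma space_config: "space \<Omega> = W \<rightarrow>\<^sub>E UNIV" by (simp add: config_space_def space_PiM)

lemma measurable_coordinate [measurable]: "(\<lambda>c. c \<sigma>) \<in> measurable field (count_space UNIV)"
  using measurable_component_singleton[of \<sigma> UNIV "\<lambda>_. measure_pmf (bernoulli_pmf p)"]
  unfolding field_def measurable_cong_sets[OF refl sets_measure_pmf_count_space] by simp

lemma measurable_config_coordinate [measurable (raw)]:
  "\<sigma> \<in> W \<Longrightarrow> (\<lambda>\<omega>. \<omega> \<sigma>) \<in> measurable \<Omega> (count_space UNIV)"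
  by (simp add: config_space_def)

lemma measurable_percolate [measurable]: "percolate \<in> measurable field \<Omega>"
  unfolding config_space_def percolate_def by (rule measurable_restrict) measurable

lemma measurable_into_field:
  assumes "\<And>\<sigma>. (\<lambda>x. f x \<sigma>) \<in> measurable M (count_space UNIV)"
  shows "f \<in> measurable M field"
proof -
  have "(\<lambda>x. \<lambda>\<sigma>\<in>UNIV. f x \<sigma>) \<in> measurable M field"
    unfolding field_def using assms by (intro measurable_restrict) simp
  then show ?thesis by (simp add: restrict_UNIV)
qed

lemma measurable_subtree [measurable]: "subtree \<sigma> \<in> measurable field field"
  by (rule measurable_into_field) (simp add: subtree_def)

lemma distr_subtree: "distr field field (subtree \<sigma>) = field"
  using distr_PiM_reindex[of UNIV "\<lambda>_. measure_pmf (bernoulli_pmf p)" "\<lambda>\<tau>. \<sigma> @ \<tau>" UNIV]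
  by (simp add: field_def subtree_def[abs_def] prob_space_measure_pmf inj_on_def restrict_UNIV)

lemma nn_integral_subtree:
  "f \<in> borel_measurable field \<Longrightarrow> (\<integral>\<^sup>+c. f (subtree \<sigma> c) \<partial>field) = (\<integral>\<^sup>+c. f c \<partial>field)"
  by (subst (2) distr_subtree[of \<sigma>, symmetric]) (simp add: nn_integral_distr)

lemma integral_subtree:
  fixes f :: "_ \<Rightarrow> real"
  shows "f \<in> borel_measurable field \<Longrightarrow> (\<integral>c. f (subtree \<sigma> c) \<partial>field) = (\<integral>c. f c \<partial>field)"
  by (subst (2) distr_subtree[of \<sigma>, symmetric]) (simp add: integral_distr)

lemma AE_subtree: "AE c in field. Q c \<Longrightarrow> AE c in field. Q (subtree \<sigma> c)"
  by (rule AE_distrD[OF measurable_subtree]) (simp only: distr_subtree)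

text \<open>A function that depends on the coordinates in \<open>J\<close> factors through the restriction to \<open>J\<close>,
and restrictions to disjoint sets are independent.\<close>

lemma indep_var_of_depends_on:
  assumes f: "f \<in> measurable field M" "depends_on J f" and g: "g \<in> measurable field N" "depends_on K g"
    and disj: "J \<inter> K = {}"
  shows "F.indep_var M f N g"
proof -
  have coord: "(\<lambda>c. c i) \<in> measurable field (measure_pmf (bernoulli_pmf p))" for i
    using measurable_coordinate by simp
  have ind: "F.indep_vars (\<lambda>_. measure_pmf (bernoulli_pmf p)) (\<lambda>i c. c i) UNIV"
  proof (subst F.indep_vars_iff_distr_eq_PiM')
    have "distr field (\<Pi>\<^sub>M i\<in>UNIV. measure_pmf (bernoulli_pmf p)) (\<lambda>x. \<lambda>i\<in>UNIV. x i) = field"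
      by (simp add: field_def distr_id[unfolded id_def] restrict_UNIV)
    also have "\<dots> = (\<Pi>\<^sub>M i\<in>UNIV. distr field (measure_pmf (bernoulli_pmf p)) (\<lambda>x. x i))"
      unfolding field_def by (intro PiM_cong refl distr_PiM_component[symmetric])
        (auto simp: prob_space_measure_pmf)
    finally show "distr field (\<Pi>\<^sub>M i\<in>UNIV. measure_pmf (bernoulli_pmf p)) (\<lambda>x. \<lambda>i\<in>UNIV. x i) =
      (\<Pi>\<^sub>M i\<in>UNIV. distr field (measure_pmf (bernoulli_pmf p)) (\<lambda>x. x i))" .
  qed (use coord in auto)
  define extend where "extend J x = (\<lambda>i. if i \<in> J then x i else False)"
    for J :: "nat list set" and x :: "nat list \<Rightarrow> bool"
  have extend: "extend J \<in> measurable (\<Pi>\<^sub>M i\<in>J. measure_pmf (bernoulli_pmf p)) field" for J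
  proof (rule measurable_into_field)
    fix \<sigma>
    show "(\<lambda>x. extend J x \<sigma>) \<in> measurable (\<Pi>\<^sub>M i\<in>J. measure_pmf (bernoulli_pmf p)) (count_space UNIV)"
      using measurable_component_singleton[of \<sigma> J "\<lambda>_. measure_pmf (bernoulli_pmf p)"]
      by (cases "\<sigma> \<in> J") (auto simp: extend_def)
  qed
  have "F.indep_var (\<Pi>\<^sub>M i\<in>J. measure_pmf (bernoulli_pmf p)) (\<lambda>c. restrict (\<lambda>i. c i) J)
      (\<Pi>\<^sub>M i\<in>K. measure_pmf (bernoulli_pmf p)) (\<lambda>c. restrict (\<lambda>i. c i) K)"
    by (rule F.indep_var_restrict[OF ind disj]) auto
  then have "F.indep_var M ((f \<circ> extend J) \<circ> (\<lambda>c. restrict (\<lambda>i. c i) J))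
      N ((g \<circ> extend K) \<circ> (\<lambda>c. restrict (\<lambda>i. c i) K))"
    by (rule F.indep_var_compose) (auto intro!: measurable_comp[OF extend] f g)
  also have "(f \<circ> extend J) \<circ> (\<lambda>c. restrict (\<lambda>i. c i) J) = f"
    unfolding comp_def by (intro HOL.ext depends_onD[OF f(2)]) (simp add: extend_def)
  also have "(g \<circ> extend K) \<circ> (\<lambda>c. restrict (\<lambda>i. c i) K) = g"
    unfolding comp_def by (intro HOL.ext depends_onD[OF g(2)]) (simp add: extend_def)
  finally show ?thesis .
qed

lemma integral_mult_of_depends_on:
  fixes f g :: "_ \<Rightarrow> real"
  assumes f: "integrable field f" "depends_on J f" and g: "integrable field g" "depends_on K g"
    and disj: "J \<inter> K = {}"
  shows "(\<integral>c. f c * g c \<partial>field) = (\<integral>c. f c \<partial>field) * (\<integral>c. g c \<partial>field)"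
  using assms by (intro F.indep_var_lebesgue_integral indep_var_of_depends_on[of _ _ J _ _ K]) auto

lemma nn_integral_mult_of_depends_on:
  fixes f g :: "_ \<Rightarrow> ennreal"
  assumes f: "f \<in> borel_measurable field" "depends_on J f"
    and g: "g \<in> borel_measurable field" "depends_on K g"
    and disj: "J \<inter> K = {}"
  shows "(\<integral>\<^sup>+c. f c * g c \<partial>field) = (\<integral>\<^sup>+c. f c \<partial>field) * (\<integral>\<^sup>+c. g c \<partial>field)"
proof -
  have *: "(\<lambda>_. borel) = case_bool borel borel" by (auto simp: fun_eq_iff split: bool.split)
  have "F.indep_vars (\<lambda>_. borel) (case_bool f g) UNIV"
    using indep_var_of_depends_on[OF assms] unfolding F.indep_var_def * .
  then have "(\<integral>\<^sup>+c. (\<Prod>i\<in>UNIV. case_bool f g i c) \<partial>field) = (\<Prod>i\<in>UNIV. \<integral>\<^sup>+c. case_bool f g i c \<partial>field)"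
    by (intro F.indep_vars_nn_integral) auto
  then show ?thesis by (simp add: UNIV_bool mult.commute)
qed

lemma prob_conj_of_depends_on:
  assumes f: "Measurable.pred field f" "depends_on J f"
    and g: "Measurable.pred field g" "depends_on K g"
    and disj: "J \<inter> K = {}"
  shows "F.prob {c. f c \<and> g c} = F.prob {c. f c} * F.prob {c. g c}"
proof -
  have [measurable]: "{c. f c} \<in> sets field" "{c. g c} \<in> sets field" 
    using f(1) g(1) by (simp_all add: pred_def)
  have "(\<integral>c. indicator {c. f c} c * indicator {c. g c} c \<partial>field) = F.prob {c. f c} * F.prob {c. g c}"
    using disj depends_on_indicator[OF f(2)] depends_on_indicator[OF g(2)]
    by (subst integral_mult_of_depends_on[of _ J _ K])
      (auto intro!: integrable_real_indicator simp: F.emeasure_eq_measure)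
  also have "(\<lambda>c. indicator {c. f c} c * indicator {c. g c} c) = (indicator {c. f c \<and> g c} :: _ \<Rightarrow> real)"
    by (auto simp: indicator_def)
  finally show ?thesis by simp
qed

lemma prob_finite_box:
  assumes "finite D"
  shows "F.prob {c. \<forall>\<tau>\<in>D. c \<tau> \<in> A \<tau>} = (\<Prod>\<tau>\<in>D. measure (bernoulli_pmf p) (A \<tau>))"
proof -
  have "{c. \<forall>\<tau>\<in>D. c \<tau> \<in> A \<tau>} = prod_emb UNIV (\<lambda>_. measure_pmf (bernoulli_pmf p)) D (Pi\<^sub>E D A)"
    by (auto simp: prod_emb_def restrict_PiE_iff)
  then show ?thesis
    using field.measure_PiM_emb[of D A] assms by (simp add: field_def)
qed

lemma percolate_Nil [simp]: "percolate c []" by (simp add: percolate_def)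

lemma percolate_snoc:
  assumes "\<sigma> \<in> W" "j \<in> I"
  shows "percolate c (\<sigma> @ [j]) \<longleftrightarrow> percolate c \<sigma> \<and> c (\<sigma> @ [j])"
proof -
  have "(\<forall>i\<in>{1..Suc n}. Q i) \<longleftrightarrow> (\<forall>i\<in>{1..n}. Q i) \<and> Q (Suc n)" for n and Q :: "nat \<Rightarrow> bool"
    by (simp add: atLeastAtMostSuc_conv conj_commute)
  from this[of "length \<sigma>" "\<lambda>i. c (take i (\<sigma> @ [j]))"] show ?thesis
    using assms by (simp add: percolate_def)
qed

lemma percolate_append:
  assumes "\<sigma> \<in> W" "\<tau> \<in> W"
  shows "percolate c (\<sigma> @ \<tau>) \<longleftrightarrow> percolate c \<sigma> \<and> percolate (subtree \<sigma> c) \<tau>"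
  using assms(2)
proof (induction \<tau> rule: rev_induct)
  case (snoc j \<tau>)
  then have "percolate c ((\<sigma> @ \<tau>) @ [j]) \<longleftrightarrow> percolate c (\<sigma> @ \<tau>) \<and> subtree \<sigma> c (\<tau> @ [j])"
    using assms(1) snoc.prems by (subst percolate_snoc) (auto simp: subtree_apply)
  also have "\<dots> \<longleftrightarrow> percolate c \<sigma> \<and> percolate (subtree \<sigma> c) (\<tau> @ [j])"
    using snoc percolate_snoc[of \<tau> j "subtree \<sigma> c"] by auto
  finally show ?case by simp
qed simp

text \<open>Self-similarity of the percolation: below a chosen word the configuration is the percolation of the shifted field,
whose law is again that of the field.\<close>

lemma subtree_percolate:
  assumes "\<sigma> \<in> W" "percolate c \<sigma>"
  shows "subtree \<sigma> (percolate c) = percolate (subtree \<sigma> c)"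
proof
  fix \<tau>
  show "subtree \<sigma> (percolate c) \<tau> = percolate (subtree \<sigma> c) \<tau>"
    using percolate_append[of \<sigma> \<tau> c] assms by (cases "\<tau> \<in> W") (auto simp: subtree_apply percolate_def)
qed

lemma percolate_in_space: "percolate c \<in> space \<Omega>"
  by (auto simp: space_config percolate_def)

lemma agree_upto_sets [measurable]: "agree_upto k m n s \<in> sets \<Omega>"
proof -
  have "[] \<in> {\<sigma>\<in>W. length \<sigma> \<le> n}" by simp
  then have ne: "{\<sigma>\<in>W. length \<sigma> \<le> n} \<noteq> {}" by blast
  have "{\<omega> \<in> space \<Omega>. \<omega> \<sigma> = s \<sigma>} \<in> sets \<Omega>" if "\<sigma> \<in> W" for \<sigma>
    using measurable_sets[OF measurable_config_coordinate[OF that], of "{s \<sigma>}"]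
    by (simp add: vimage_def Int_def conj_commute)
  then have "(\<Inter>\<sigma>\<in>{\<sigma>\<in>W. length \<sigma> \<le> n}. {\<omega> \<in> space \<Omega>. \<omega> \<sigma> = s \<sigma>}) \<in> sets \<Omega>"
    by (intro sets.finite_INT finite_words_le ne) blast
  also have "(\<Inter>\<sigma>\<in>{\<sigma>\<in>W. length \<sigma> \<le> n}. {\<omega> \<in> space \<Omega>. \<omega> \<sigma> = s \<sigma>}) = agree_upto k m n s"
    using ne unfolding agree_upto_def by blast
  finally show ?thesis .
qed


section \<open>Percolation as a pruned field\<close>

text \<open>The transition rule determines the probability of each pattern up to level \<open>n\<close> by induction on
\<open>n\<close>.\<close>

lemma percolation_measure_unique:
  assumes P: "percolation_measure k m p P" and Q: "percolation_measure k m p Q"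
  shows "P = Q"
proof -
  have base: "measure M (agree_upto k m 0 s) = of_bool (s [])" if "percolation_measure k m p M" for M s
  proof -
    interpret M: prob_space M using that by (simp add: percolation_measure_def)
    have sets: "sets M = sets \<Omega>" and AE: "AE \<omega> in M. \<omega> []"
      using that by (auto simp: percolation_measure_def)
    have meas: "(\<lambda>\<omega>. \<omega> []) \<in> measurable M (count_space UNIV)"
      using measurable_config_coordinate[OF Nil_in_words] by (simp add: measurable_cong_sets[OF sets refl])
    have eq: "agree_upto k m 0 s = {\<omega>\<in>space M. \<omega> [] = s []}"
      using sets_eq_imp_space_eq[OF sets] by (auto simp: agree_upto_def)
    have "{\<omega>\<in>space M. \<omega> [] = s []} \<in> sets M"
      using measurable_sets[OF meas, of "{s []}"] by (simp add: vimage_def Int_def conj_commute)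
    then show ?thesis
      using AE unfolding eq
      by (cases "s []") (simp_all add: M.prob_Collect_eq_1 M.prob_Collect_eq_0)
  qed
  have eq: "measure P (agree_upto k m n s) = measure Q (agree_upto k m n s)" for n s
  proof (induction n)
    case 0 show ?case by (simp add: base[OF P] base[OF Q])
  next
    case (Suc n)
    then show ?case using P Q by (simp add: percolation_measure_def)
  qed
  interpret P: prob_space P using P by (simp add: percolation_measure_def)
  interpret Q: prob_space Q using Q by (simp add: percolation_measure_def)
  show ?thesis
  proof (rule measure_eqI_finite_patterns)
    show "sets P = sets (\<Pi>\<^sub>M \<sigma>\<in>W. count_space UNIV)" "sets Q = sets (\<Pi>\<^sub>M \<sigma>\<in>W. count_space UNIV)"
      using P Q by (auto simp: percolation_measure_def config_space_def)
    show "finite_measure P" by unfold_locales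
    fix J assume J: "finite J" "J \<subseteq> W"
    have "agree_upto k m n s = {\<omega> \<in> W \<rightarrow>\<^sub>E UNIV. \<forall>\<sigma>\<in>{\<sigma>\<in>W. length \<sigma> \<le> n}. \<omega> \<sigma> = s \<sigma>}" for n s
      unfolding agree_upto_def space_config by blast
    moreover have "emeasure P (agree_upto k m n s) = emeasure Q (agree_upto k m n s)" for n s
      by (simp add: P.emeasure_eq_measure Q.emeasure_eq_measure eq)
    moreover have "J \<subseteq> {\<sigma>\<in>W. length \<sigma> \<le> Max (insert 0 (length ` J))}"
      using J by (auto intro!: Max_ge)
    ultimately show "\<exists>K. J \<subseteq> K \<and> K \<subseteq> W \<and> finite K \<and> (\<forall>s\<in>K \<rightarrow>\<^sub>E UNIV.
        emeasure P {x \<in> W \<rightarrow>\<^sub>E UNIV. \<forall>i\<in>K. x i = s i} = emeasure Q {x \<in> W \<rightarrow>\<^sub>E UNIV. \<forall>i\<in>K. x i = s i})"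
      by (intro exI[of _ "{\<sigma>\<in>W. length \<sigma> \<le> Max (insert 0 (length ` J))}"]) auto
  qed simp
qed

text \<open>The mark of the empty word is never inspected. Hence the percolation below \<open>\<tau>\<close> involves only marks
of strict extensions of \<open>\<tau>\<close>, and is independent of whether \<open>\<tau>\<close> itself is chosen.\<close>

lemma depends_on_percolate: "depends_on (- {[]}) percolate"
proof (rule depends_onI, rule ext)
  fix c c' :: "nat list \<Rightarrow> bool" and \<sigma>
  assume eq: "\<And>i. i \<in> - {[]} \<Longrightarrow> c i = c' i"
  have "c (take i \<sigma>) = c' (take i \<sigma>)" if "i \<in> {1..length \<sigma>}" for i
    using that by (intro eq) auto
  then show "percolate c \<sigma> = percolate c' \<sigma>" by (auto simp: percolate_def)
qed

text \<open>Given the marks up to level \<open>n\<close>, a pattern on level \<open>n + 1\<close> prescribes the marks of the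
children of chosen words and is compatible with all marks, or with none, below the other words. These marks are
independent of the earlier ones.\<close>

lemma percolation_measure_distr: "percolation_measure k m p (distr field \<Omega> percolate)"
proof -
  let ?P = "distr field \<Omega> percolate"
  define Agr where "Agr n s = (\<lambda>c. \<forall>\<sigma>\<in>{\<sigma>\<in>W. length \<sigma> \<le> n}. percolate c \<sigma> = s \<sigma>)" for n s
  have Agr: "measure ?P (agree_upto k m n s) = F.prob {c. Agr n s c}" for n s
    using percolate_in_space
    by (subst measure_distr) (auto simp: Agr_def agree_upto_def intro!: arg_cong[where f=F.prob])
  have root: "AE \<omega> in ?P. \<omega> []"
  proof -
    have "{\<omega> \<in> space \<Omega>. \<omega> []} \<in> sets \<Omega>"
      using measurable_config_coordinate[OF Nil_in_words] by (simp add: pred_def)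
    then show ?thesis by (subst AE_distr_iff) simp_all
  qed
  have "F.prob {c. Agr (Suc n) s c} = F.prob {c. Agr n s c} *
      (\<Prod>\<sigma>\<in>L n. \<Prod>j\<in>I. pmf (child_pmf p (s \<sigma>)) (s (\<sigma> @ [j])))" for n s
  proof -
    define D where "D = (\<lambda>(\<sigma>, j). \<sigma> @ [j]) ` (L n \<times> I)"
    define A where "A \<tau> = {b. (s (butlast \<tau>) \<and> b) = s \<tau>}" for \<tau>
    have inj: "inj_on (\<lambda>(\<sigma>, j). \<sigma> @ [j]) (L n \<times> I)" by (auto simp: inj_on_def)
    have finD: "finite D" by (auto simp: D_def)
    have "Agr (Suc n) s c \<longleftrightarrow> Agr n s c \<and> (\<forall>\<tau>\<in>D. c \<tau> \<in> A \<tau>)" for c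
    proof -
      have eD: "{\<tau>\<in>W. length \<tau> = Suc n} = D"
      proof -
        have "D = L (n + 1)"
          unfolding D_def words_of_length_add by (auto simp: words_of_length_1)
        then show ?thesis by (simp add: words_of_length_def)
      qed
      have "Agr (Suc n) s c \<longleftrightarrow> Agr n s c \<and> (\<forall>\<tau>\<in>{\<tau>\<in>W. length \<tau> = Suc n}. percolate c \<tau> = s \<tau>)"
        unfolding Agr_def by (auto simp: le_Suc_eq)
      also have "\<dots> \<longleftrightarrow> Agr n s c \<and> (\<forall>\<tau>\<in>D. c \<tau> \<in> A \<tau>)"
      proof (unfold eD, rule conj_cong[OF refl], rule ball_cong[OF refl])
        fix \<tau> assume "Agr n s c" "\<tau> \<in> D"
        then show "percolate c \<tau> = s \<tau> \<longleftrightarrow> c \<tau> \<in> A \<tau>"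
          by (auto simp: D_def A_def Agr_def words_of_length_def percolate_snoc)
      qed
      finally show ?thesis .
    qed
    then have "F.prob {c. Agr (Suc n) s c} = F.prob {c. Agr n s c \<and> (\<forall>\<tau>\<in>D. c \<tau> \<in> A \<tau>)}"
      by simp
    also have "\<dots> = F.prob {c. Agr n s c} * F.prob {c. \<forall>\<tau>\<in>D. c \<tau> \<in> A \<tau>}"
    proof (rule prob_conj_of_depends_on[of _ "{\<tau>. length \<tau> \<le> n}" _ D])
      show "depends_on {\<tau>. length \<tau> \<le> n} (Agr n s)"
      proof (rule depends_onI)
        fix c c' :: "nat list \<Rightarrow> bool" assume eq: "\<And>\<tau>. \<tau> \<in> {\<tau>. length \<tau> \<le> n} \<Longrightarrow> c \<tau> = c' \<tau>"
        have "percolate c \<sigma> = percolate c' \<sigma>" if "\<sigma> \<in> W" "length \<sigma> \<le> n" for \<sigma>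
        proof -
          have "c (take i \<sigma>) = c' (take i \<sigma>)" for i using that by (intro eq) auto
          then show ?thesis by (simp add: percolate_def)
        qed
        then show "Agr n s c = Agr n s c'" by (simp add: Agr_def)
      qed
      show "depends_on D (\<lambda>c. \<forall>\<tau>\<in>D. c \<tau> \<in> A \<tau>)" by (rule depends_onI) simp
      have pm: "(\<lambda>c. percolate c \<sigma>) \<in> measurable field (count_space UNIV)" if "\<sigma> \<in> W" for \<sigma>
        using measurable_compose[OF measurable_percolate measurable_config_coordinate[OF that]] .
      show "Measurable.pred field (Agr n s)"
        unfolding Agr_def using pm by (intro pred_intros_finite) (auto intro!: measurable_compose[OF pm])
      show "Measurable.pred field (\<lambda>c. \<forall>\<tau>\<in>D. c \<tau> \<in> A \<tau>)"
        using finD by (intro pred_intros_finite) (auto intro!: measurable_compose[OF measurable_coordinate])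
    qed (auto simp: D_def words_of_length_def)
    also have "F.prob {c. \<forall>\<tau>\<in>D. c \<tau> \<in> A \<tau>} = (\<Prod>\<tau>\<in>D. measure (bernoulli_pmf p) (A \<tau>))"
      by (rule prob_finite_box[OF finD])
    also have "\<dots> = (\<Prod>x\<in>L n \<times> I. measure (bernoulli_pmf p) (A (fst x @ [snd x])))"
      unfolding D_def by (subst prod.reindex[OF inj]) (simp add: case_prod_unfold)
    also have "\<dots> = (\<Prod>\<sigma>\<in>L n. \<Prod>j\<in>I. measure (bernoulli_pmf p) (A (\<sigma> @ [j])))"
      by (simp add: prod.cartesian_product case_prod_unfold)
    also have "\<dots> = (\<Prod>\<sigma>\<in>L n. \<Prod>j\<in>I. pmf (child_pmf p (s \<sigma>)) (s (\<sigma> @ [j])))"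
    proof (intro prod.cong refl)
      fix \<sigma> j
      have "A (\<sigma> @ [j]) = (if s \<sigma> then {s (\<sigma> @ [j])} else if s (\<sigma> @ [j]) then {} else UNIV)"
        by (auto simp: A_def)
      then show "measure (bernoulli_pmf p) (A (\<sigma> @ [j])) = pmf (child_pmf p (s \<sigma>)) (s (\<sigma> @ [j]))"
        by (simp add: child_pmf_def measure_pmf_single)
    qed
    finally show ?thesis .
  qed
  moreover have "prob_space ?P" by (rule F.prob_space_distr) simp
  ultimately show ?thesis
    using root by (simp add: percolation_measure_def Agr words_of_length_def)
qed

lemma percolation_measure_eq_distr:
  "percolation_measure k m p P \<Longrightarrow> P = distr field \<Omega> percolate"
  using percolation_measure_unique percolation_measure_distr by blast


section \<open>Growth of the generations\<close>

text \<open>This is \<open>k\<close> to the power \<open>-d\<close> for the dimension \<open>d\<close> of the limit set, see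
\<open>decay_powr\<close>.\<close>

definition decay :: real where "decay = 1 / (real k ^ m * p)"

definition gen_size :: "nat \<Rightarrow> (nat list \<Rightarrow> bool) \<Rightarrow> real" where
  "gen_size j \<omega> = (\<Sum>\<tau>\<in>L j. of_bool (\<omega> \<tau>))"

lemma decay_pos: "0 < decay" and decay_less_1: "decay < 1" and decay_mult: "decay * (real k ^ m * p) = 1"
proof -
  have "0 < real k ^ m" using k_ge_2 by simp
  then have "1 < real k ^ m * p" using p_gt by (simp add: field_simps)
  then show "0 < decay" "decay < 1" "decay * (real k ^ m * p) = 1" using k_ge_2 by (auto simp: decay_def)
qed

lemma decay_powr: "real k powr (- real j * perc_dim k m p) = decay ^ j"
proof -
  have k: "real k > 1" using k_ge_2 by simp
  have pos: "0 < real k ^ m * p" using k p_pos by simp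
  have "real k powr perc_dim k m p = real k ^ m * p"
    using k pos by (simp add: perc_dim_def powr_def)
  then have "real k powr (- perc_dim k m p) = decay"
    by (simp add: powr_minus decay_def inverse_eq_divide)
  moreover have "real k powr (- real j * perc_dim k m p) = (real k powr (- perc_dim k m p)) powr real j"
    by (simp add: powr_powr mult.commute)
  ultimately show ?thesis using decay_pos by (simp add: powr_realpow)
qed

lemma num_chosen_eq: "\<sigma> \<in> W \<Longrightarrow> real (num_chosen k m \<omega> j \<sigma>) = gen_size j (subtree \<sigma> \<omega>)"
proof -
  assume \<sigma>: "\<sigma> \<in> W"
  have "{\<tau>\<in>W. length \<tau> = length \<sigma> + j \<and> prefix \<sigma> \<tau> \<and> \<omega> \<tau>} = (@) \<sigma> ` {\<tau>\<in>L j. \<omega> (\<sigma> @ \<tau>)}"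
    using \<sigma> by (auto simp: prefix_def words_of_length_def)
  then have "num_chosen k m \<omega> j \<sigma> = card {\<tau>\<in>L j. \<omega> (\<sigma> @ \<tau>)}"
    by (simp add: num_chosen_def card_image inj_on_def)
  also have "{\<tau>\<in>L j. \<omega> (\<sigma> @ \<tau>)} = L j \<inter> {\<tau>. \<omega> (\<sigma> @ \<tau>)}" by blast
  also have "real (card \<dots>) = gen_size j (subtree \<sigma> \<omega>)"
    by (simp add: gen_size_def subtree_apply)
  finally show ?thesis .
qed

lemma gen_size_nonneg: "0 \<le> gen_size j \<omega>"
  by (simp add: gen_size_def sum_nonneg)

lemma gen_size_le: "gen_size j \<omega> \<le> (real k ^ m) ^ j"
proof -
  have "gen_size j \<omega> \<le> (\<Sum>\<tau>\<in>L j. 1)" unfolding gen_size_def by (rule sum_mono) simp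
  then show ?thesis by (simp add: card_words_of_length)
qed

lemma gen_size_eq_0_iff: "gen_size j \<omega> = 0 \<longleftrightarrow> (\<forall>\<tau>\<in>L j. \<not> \<omega> \<tau>)"
  unfolding gen_size_def by (subst sum_nonneg_eq_0_iff) auto

lemma measurable_gen_size [measurable]: "gen_size j \<in> borel_measurable \<Omega>"
proof -
  have "(\<lambda>\<omega>. of_bool (\<omega> \<tau>) :: real) \<in> borel_measurable \<Omega>" if "\<tau> \<in> L j" for \<tau>
    using measurable_compose[OF measurable_config_coordinate, of \<tau> of_bool borel] that
    by (simp add: words_of_length_def)
  then show ?thesis unfolding gen_size_def by (rule borel_measurable_sum)
qed

lemma measurable_subtree_config:
  assumes "\<sigma> \<in> W" shows "subtree \<sigma> \<in> measurable \<Omega> \<Omega>"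
proof -
  have eq: "subtree \<sigma> = (\<lambda>\<omega> \<tau>. \<omega> (\<sigma> @ \<tau>))" by (simp add: fun_eq_iff subtree_apply)
  show ?thesis
    unfolding config_space_def eq
  proof (rule measurable_PiM_single')
    show "(\<lambda>\<omega>. \<omega> (\<sigma> @ \<tau>)) \<in> measurable (\<Pi>\<^sub>M \<sigma>\<in>W. count_space UNIV) (count_space UNIV)" if "\<tau> \<in> W" for \<tau>
      using assms that by simp
    show "(\<lambda>\<omega> \<tau>. \<omega> (\<sigma> @ \<tau>)) \<in> space (\<Pi>\<^sub>M \<sigma>\<in>W. count_space UNIV) \<rightarrow> (\<Pi>\<^sub>E \<sigma>\<in>W. space (count_space UNIV))"
      by (auto simp: space_PiM PiE_iff extensional_def)
  qed
qed

lemma percolate_singleton: "i \<in> I \<Longrightarrow> percolate c [i] \<longleftrightarrow> c [i]"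
  using percolate_snoc[of "[]" i c] by simp

lemma gen_size_Suc_percolate:
  "gen_size (Suc j) (percolate c) = (\<Sum>i\<in>I. of_bool (c [i]) * gen_size j (percolate (subtree [i] c)))"
proof -
  have "gen_size (Suc 0 + j) (percolate c) = (\<Sum>i\<in>I. \<Sum>\<tau>\<in>L j. of_bool (percolate c ([i] @ \<tau>)))"
    unfolding gen_size_def by (simp only: sum_words_of_length_add sum_words_of_length_1)
  also have "\<dots> = (\<Sum>i\<in>I. \<Sum>\<tau>\<in>L j. of_bool (c [i]) * of_bool (percolate (subtree [i] c) \<tau>))"
    by (intro sum.cong refl, subst percolate_append)
       (auto simp: words_of_length_def percolate_singleton)
  finally show ?thesis by (simp only: gen_size_def sum_distrib_left plus_nat.simps)
qed

definition normalised_size :: "nat \<Rightarrow> (nat list \<Rightarrow> bool) \<Rightarrow> real" where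
  "normalised_size j c = decay ^ j * gen_size j (percolate c)"

text \<open>One step of the branching recursion, normalised so that it preserves expectations; it maps the generation sizes of
order \<open>j\<close> to those of order \<open>j + 1\<close>.\<close>

definition branching_sum :: "((nat list \<Rightarrow> bool) \<Rightarrow> real) \<Rightarrow> (nat list \<Rightarrow> bool) \<Rightarrow> real" where
  "branching_sum f c = decay * (\<Sum>i\<in>I. of_bool (c [i]) * f (subtree [i] c))"

lemma normalised_size_Suc: "normalised_size (Suc j) = branching_sum (normalised_size j)"
  by (rule ext) (simp add: normalised_size_def branching_sum_def gen_size_Suc_percolate sum_distrib_left algebra_simps)

lemma normalised_size_0: "normalised_size 0 c = 1"
  by (simp add: normalised_size_def gen_size_def words_of_length_0)

lemma measurable_normalised_size [measurable]: "normalised_size j \<in> borel_measurable field"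
  unfolding normalised_size_def by measurable

lemma depends_on_normalised_size: "depends_on (- {[]}) (normalised_size j)"
  unfolding normalised_size_def by (rule depends_on_compose[OF depends_on_percolate, where h="\<lambda>\<omega>. decay ^ j * gen_size j \<omega>"])

lemma normalised_size_bounds: "0 \<le> normalised_size j c" "normalised_size j c \<le> (decay * real k ^ m) ^ j"
  using gen_size_nonneg[of j] gen_size_le[of j] decay_pos
  by (auto simp: normalised_size_def power_mult_distrib)

text \<open>The children carry independent copies. In the square of the sum the mixed terms have expectation
zero if \<open>f\<close> has, and only the diagonal terms remain.\<close>

lemma
  fixes f :: "(nat list \<Rightarrow> bool) \<Rightarrow> real"
  assumes f: "f \<in> borel_measurable field" and dep: "depends_on (- {[]}) f" and bd: "\<And>c. \<bar>f c\<bar> \<le> B"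
  shows expectation_branching_sum: "F.expectation (branching_sum f) = F.expectation f"
    and variance_branching_sum: "F.expectation f = 0 \<Longrightarrow>
      F.expectation (\<lambda>c. (branching_sum f c)\<^sup>2) = decay * F.expectation (\<lambda>c. (f c)\<^sup>2)"
proof -
  define Y where "Y i c = of_bool (c [i]) * f (subtree [i] c)" for i :: nat and c
  have fm: "(\<lambda>c. f (subtree \<sigma> c)) \<in> borel_measurable field" for \<sigma>
    using measurable_compose[OF measurable_subtree f] .
  have bm: "(\<lambda>c. of_bool (c \<sigma>) :: real) \<in> borel_measurable field" for \<sigma>
    using measurable_compose[OF measurable_coordinate, of of_bool borel \<sigma>] by simp
  have Ym: "Y i \<in> borel_measurable field" for i
    unfolding Y_def using fm bm by measurable
  have bounded_int: "integrable field g" if "g \<in> borel_measurable field" "\<And>c. \<bar>g c\<bar> \<le> D" for g :: "_ \<Rightarrow> real" and D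
    using that by (intro F.integrable_const_bound[of _ D]) auto
  have B0: "0 \<le> B" using bd[of "\<lambda>_. True"] by linarith
  have Ybd: "\<bar>Y i c\<bar> \<le> B" for i c using bd B0 by (auto simp: Y_def)
  have prod_bd: "\<bar>g c * h c\<bar> \<le> B * D" if "\<bar>g c\<bar> \<le> B" "\<bar>h c\<bar> \<le> D" for g h :: "_ \<Rightarrow> real" and c D
    unfolding abs_mult using that B0 by (intro mult_mono) auto
  have Eopen: "F.expectation (\<lambda>c. of_bool (c [i])) = p" for i
  proof -
    have "F.prob {c. c [i]} = p"
      using prob_finite_box[of "{[i]}" "\<lambda>_. {True}"] p_pos p_le_1 by (simp add: measure_pmf_single)
    moreover have "(\<lambda>c. of_bool (c [i]) :: real) = indicator {c. c [i]}" by (auto simp: indicator_def)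
    ultimately show ?thesis by simp
  qed
  have ind: "F.expectation (\<lambda>c. of_bool (c [i]) * g (subtree [i] c)) = p * F.expectation g"
    if g: "g \<in> borel_measurable field" "depends_on (- {[]}) g" "\<And>c. \<bar>g c\<bar> \<le> D" for g :: "_ \<Rightarrow> real" and D i
  proof -
    have gm: "(\<lambda>c. g (subtree [i] c)) \<in> borel_measurable field"
      using measurable_compose[OF measurable_subtree g(1)] .
    have "F.expectation (\<lambda>c. of_bool (c [i]) * g (subtree [i] c)) =
        F.expectation (\<lambda>c. of_bool (c [i])) * F.expectation (\<lambda>c. g (subtree [i] c))"
    proof (rule integral_mult_of_depends_on)
      show "depends_on {[i]} (\<lambda>c. of_bool (c [i]) :: real)" by (rule depends_onI) simp
      show "depends_on ((@) [i] ` (- {[]})) (\<lambda>c. g (subtree [i] c))" by (rule depends_on_subtree[OF g(2)])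
      show "integrable field (\<lambda>c. of_bool (c [i]) :: real)" by (rule bounded_int[OF bm, of _ 1]) simp
      show "integrable field (\<lambda>c. g (subtree [i] c))" by (rule bounded_int[OF gm g(3)])
    qed auto
    then show ?thesis by (simp add: Eopen integral_subtree[OF g(1)])
  qed
  have EY: "F.expectation (Y i) = p * F.expectation f" for i
    unfolding Y_def by (rule ind[OF f dep bd])
  have intY: "integrable field (Y i)" for i by (rule bounded_int[OF Ym Ybd])
  show "F.expectation (branching_sum f) = F.expectation f"
  proof -
    have "F.expectation (branching_sum f) = decay * (\<Sum>i\<in>I. F.expectation (Y i))"
      unfolding branching_sum_def Y_def[symmetric] using intY by simp
    then show ?thesis using decay_mult by (simp add: EY card_alphabet algebra_simps)
  qed
  assume f0: "F.expectation f = 0"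
  have EYY: "F.expectation (\<lambda>c. Y i c * Y j c) = (if i = j then p * F.expectation (\<lambda>c. (f c)\<^sup>2) else 0)" for i j
  proof (cases "i = j")
    case True
    have "\<bar>(f c)\<^sup>2\<bar> \<le> B * B" for c
      using prod_bd[of f c f B] bd by (simp add: power2_eq_square)
    then have "F.expectation (\<lambda>c. of_bool (c [i]) * (f (subtree [i] c))\<^sup>2) = p * F.expectation (\<lambda>c. (f c)\<^sup>2)"
      using f by (intro ind[of "\<lambda>c. (f c)\<^sup>2" "B * B"] depends_on_compose[OF dep]) auto
    moreover have "(\<lambda>c. Y i c * Y j c) = (\<lambda>c. of_bool (c [i]) * (f (subtree [i] c))\<^sup>2)"
      using True by (auto simp: Y_def power2_eq_square)
    ultimately show ?thesis using True by simp
  next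
    case False
    have depY: "depends_on (range ((@) [i])) (Y i)" for i
    proof -
      have "depends_on (range ((@) [i])) (\<lambda>c. of_bool (c [i]) :: real)"
        by (rule depends_onI) (auto intro!: arg_cong[where f=of_bool])
      moreover have "depends_on (range ((@) [i])) (\<lambda>c. f (subtree [i] c))"
        by (rule depends_on_mono[OF depends_on_subtree[OF dep]]) auto
      ultimately show ?thesis unfolding Y_def by (rule depends_on_compose2)
    qed
    have "F.expectation (\<lambda>c. Y i c * Y j c) = F.expectation (Y i) * F.expectation (Y j)"
      by (rule integral_mult_of_depends_on[OF intY depY intY depY]) (use False in auto)
    then show ?thesis using False f0 by (simp add: EY)
  qed
  have "(branching_sum f c)\<^sup>2 = decay\<^sup>2 * (\<Sum>i\<in>I. \<Sum>j\<in>I. Y i c * Y j c)" for c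
    unfolding branching_sum_def Y_def[symmetric] by (simp add: power2_eq_square sum_product algebra_simps)
  moreover have "integrable field (\<lambda>c. Y i c * Y j c)" for i j
    by (intro bounded_int[of _ "B * B"] borel_measurable_times Ym prod_bd[of "Y i" _ "Y j" B] Ybd)
  ultimately have "F.expectation (\<lambda>c. (branching_sum f c)\<^sup>2) = decay\<^sup>2 * (\<Sum>i\<in>I. \<Sum>j\<in>I. F.expectation (\<lambda>c. Y i c * Y j c))"
    by simp
  also have "\<dots> = decay\<^sup>2 * (real k ^ m * (p * F.expectation (\<lambda>c. (f c)\<^sup>2)))"
    by (simp add: EYY card_alphabet)
  also have "\<dots> = decay * (decay * (real k ^ m * p)) * F.expectation (\<lambda>c. (f c)\<^sup>2)"
    by (simp add: power2_eq_square)
  finally show "F.expectation (\<lambda>c. (branching_sum f c)\<^sup>2) = decay * F.expectation (\<lambda>c. (f c)\<^sup>2)"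
    by (simp add: decay_mult)
qed

definition increment :: "nat \<Rightarrow> (nat list \<Rightarrow> bool) \<Rightarrow> real" where
  "increment j c = normalised_size (Suc j) c - normalised_size j c"

lemma integrable_normalised_size: "integrable field (normalised_size j)"
  using normalised_size_bounds by (intro F.integrable_const_bound[of _ "(decay * real k ^ m) ^ j"]) auto

lemma expectation_normalised_size: "F.expectation (normalised_size j) = 1"
proof (induction j)
  case 0 show ?case using F.prob_space by (simp add: normalised_size_0[abs_def])
next
  case (Suc j)
  then show ?case unfolding normalised_size_Suc
    using normalised_size_bounds
    by (subst expectation_branching_sum[OF _ depends_on_normalised_size, where B="(decay * real k ^ m) ^ j"]) auto
qed

lemma measurable_increment [measurable]: "increment j \<in> borel_measurable field"
  unfolding increment_def by measurable

lemma abs_increment_le: "\<exists>B. \<forall>c. \<bar>increment j c\<bar> \<le> B"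
proof (intro exI allI)
  fix c show "\<bar>increment j c\<bar> \<le> (decay * real k ^ m) ^ j + (decay * real k ^ m) ^ Suc j"
    using normalised_size_bounds[of j c] normalised_size_bounds[of "Suc j" c]
    unfolding increment_def by linarith
qed

lemma integrable_increment: "integrable field (increment j)"
  unfolding increment_def by (intro Bochner_Integration.integrable_diff integrable_normalised_size)

text \<open>The branching step commutes with differences, so each increment arises from the preceding one. Increments have mean
zero and the children are independent, so each step multiplies the second moment by \<open>decay\<close>.\<close>

lemma variance_increment:
  "F.expectation (\<lambda>c. (increment j c)\<^sup>2) = decay ^ j * F.expectation (\<lambda>c. (increment 0 c)\<^sup>2)"
proof (induction j)
  case (Suc j)
  from abs_increment_le[of j] obtain B where B: "\<And>c. \<bar>increment j c\<bar> \<le> B" by auto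
  have eq: "increment (Suc j) = branching_sum (increment j)"
  proof
    fix c
    have "increment (Suc j) c = branching_sum (normalised_size (Suc j)) c - branching_sum (normalised_size j) c"
      by (simp only: increment_def flip: normalised_size_Suc)
    also have "\<dots> = branching_sum (increment j) c"
      unfolding branching_sum_def increment_def by (simp only: sum_subtractf right_diff_distrib)
    finally show "increment (Suc j) c = branching_sum (increment j) c" .
  qed
  have mean: "F.expectation (increment j) = 0"
    unfolding increment_def using integrable_normalised_size by (simp add: expectation_normalised_size)
  have dep: "depends_on (- {[]}) (increment j)"
    unfolding increment_def
    by (rule depends_on_compose2[where h="(-)"]) (rule depends_on_normalised_size)+
  have "F.expectation (\<lambda>c. (increment (Suc j) c)\<^sup>2) = decay * F.expectation (\<lambda>c. (increment j c)\<^sup>2)"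
    unfolding eq by (rule variance_branching_sum[OF measurable_increment dep B mean])
  then show ?case using Suc.IH by simp
qed simp

lemma summable_abs_increments: "summable (\<lambda>j. F.expectation (\<lambda>c. \<bar>increment j c\<bar>))"
proof (rule summable_comparison_test')
  define C where "C = F.expectation (\<lambda>c. (increment 0 c)\<^sup>2)"
  define b where "b = sqrt decay"
  have b: "0 < b" "b < 1" "b\<^sup>2 = decay" using decay_pos decay_less_1 by (auto simp: b_def)
  show "summable (\<lambda>j. (1 + C) / 2 * b ^ j)" using b by (intro summable_mult summable_geometric) simp
  show "norm (F.expectation (\<lambda>c. \<bar>increment j c\<bar>)) \<le> (1 + C) / 2 * b ^ j" for j
  proof -
    from abs_increment_le[of j] obtain B where B: "\<And>c. \<bar>increment j c\<bar> \<le> B" by auto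
    have int2: "integrable field (\<lambda>c. (increment j c)\<^sup>2)"
      using power_mono[OF B abs_ge_zero, of _ 2]
      by (intro F.integrable_const_bound[of _ "B\<^sup>2"]) auto
    \<comment> \<open>Weighted inequality of arithmetic and geometric means, balanced for second moments of order \<open>b ^ (2 * j)\<close>.\<close>
    have "\<bar>x\<bar> \<le> (b ^ j + x\<^sup>2 / b ^ j) / 2" for x :: real
    proof -
      have "0 \<le> (b ^ j - \<bar>x\<bar>)\<^sup>2" by simp
      then have "2 * (b ^ j * \<bar>x\<bar>) \<le> b ^ j * b ^ j + x\<^sup>2" by (simp add: power2_eq_square algebra_simps)
      then show ?thesis using b by (simp add: field_simps)
    qed
    then have "F.expectation (\<lambda>c. \<bar>increment j c\<bar>) \<le> F.expectation (\<lambda>c. (b ^ j + (increment j c)\<^sup>2 / b ^ j) / 2)"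
      using int2 integrable_increment[of j] by (intro integral_mono) auto
    also have "\<dots> = (b ^ j + F.expectation (\<lambda>c. (increment j c)\<^sup>2) / b ^ j) / 2"
      using int2 F.prob_space by simp
    also have "\<dots> = (b ^ j + C * (b\<^sup>2) ^ j / b ^ j) / 2"
      by (simp add: variance_increment[of j] C_def b(3))
    also have "C * (b\<^sup>2) ^ j / b ^ j = C * b ^ j"
      using b(1) by (simp add: power2_eq_square power_mult_distrib)
    also have "(b ^ j + C * b ^ j) / 2 = (1 + C) / 2 * b ^ j" by (simp add: field_simps)
    finally show ?thesis by simp
  qed
qed

lemma AE_summable_increments: "AE c in field. summable (\<lambda>j. \<bar>increment j c\<bar>)"
proof -
  have "(\<integral>\<^sup>+c. (\<Sum>j. ennreal \<bar>increment j c\<bar>) \<partial>field) = (\<Sum>j. \<integral>\<^sup>+c. ennreal \<bar>increment j c\<bar> \<partial>field)"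
    by (intro nn_integral_suminf) measurable
  also have "\<dots> = (\<Sum>j. ennreal (F.expectation (\<lambda>c. \<bar>increment j c\<bar>)))"
    using integrable_increment by (subst nn_integral_eq_integral) auto
  also have "\<dots> = ennreal (\<Sum>j. F.expectation (\<lambda>c. \<bar>increment j c\<bar>))"
    using summable_abs_increments by (intro suminf_ennreal2) auto
  finally have "(\<integral>\<^sup>+c. (\<Sum>j. ennreal \<bar>increment j c\<bar>) \<partial>field) \<noteq> \<infinity>" by simp
  then have "AE c in field. (\<Sum>j. ennreal \<bar>increment j c\<bar>) \<noteq> \<infinity>"
    by (intro nn_integral_noteq_infinite) measurable
  then show ?thesis
    by eventually_elim (auto intro!: summable_suminf_not_top)
qed

lemma normalised_size_eq_sum: "normalised_size n c = 1 + (\<Sum>j<n. increment j c)"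
  by (induction n) (auto simp: normalised_size_0 increment_def)

lemma AE_convergent_normalised_size: "AE c in field. convergent (\<lambda>j. normalised_size j c)"
  using AE_summable_increments
proof eventually_elim
  case (elim c)
  then have "summable (\<lambda>j. increment j c)" by (rule summable_rabs_cancel)
  then have "convergent (\<lambda>n. \<Sum>j<n. increment j c)" by (simp add: summable_iff_convergent)
  then show ?case unfolding normalised_size_eq_sum by (intro convergent_add convergent_const)
qed

lemma percolate_take: "\<sigma> \<in> W \<Longrightarrow> percolate c \<sigma> \<Longrightarrow> percolate c (take n \<sigma>)"
  using percolate_append[of "take n \<sigma>" "drop n \<sigma>" c] by simp

lemma measurable_survives: "Measurable.pred \<Omega> (survives k m)"
proof -
  have "Measurable.pred \<Omega> (\<lambda>\<omega>. \<omega> \<tau>)" if "\<tau> \<in> L n" for n \<tau>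
    using that by (intro measurable_config_coordinate) (simp add: words_of_length_def)
  then show ?thesis
    unfolding survives_def by (intro pred_intros_countable pred_intros_finite finite_words_of_length)
qed

text \<open>If lines of descent died out almost surely, the normalised sizes would tend to zero. They are dominated by \<open>1 +
(\<Sum>j. \<bar>increment j c\<bar>)\<close>, which is integrable, so their means would tend to zero too; but all
means are one.\<close>

lemma prob_survives_pos: "0 < F.prob {c. survives k m (percolate c)}"
proof (rule ccontr)
  have sm: "Measurable.pred field (\<lambda>c. survives k m (percolate c))"
    using measurable_compose[OF measurable_percolate measurable_survives] .
  assume "\<not> ?thesis"
  then have "F.prob {c. survives k m (percolate c)} = 0" by (simp add: zero_less_measure_iff)
  then have ext: "AE c in field. \<not> survives k m (percolate c)"
    using sm F.prob_Collect_eq_0[of "\<lambda>c. survives k m (percolate c)"] by (simp add: pred_def)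
  have "(\<lambda>n. F.expectation (normalised_size n)) \<longlonglongrightarrow> F.expectation (\<lambda>_. 0)"
  proof (rule integral_dominated_convergence)
    show "integrable field (\<lambda>c. 1 + (\<Sum>j. \<bar>increment j c\<bar>))"
      using integrable_increment summable_abs_increments AE_summable_increments
      by (intro Bochner_Integration.integrable_add integrable_suminf) auto
    show "AE c in field. (\<lambda>n. normalised_size n c) \<longlonglongrightarrow> 0"
      using ext
    proof eventually_elim
      case (elim c)
      then obtain n0 where n0: "\<And>\<tau>. \<tau> \<in> L n0 \<Longrightarrow> \<not> percolate c \<tau>" by (auto simp: survives_def)
      have "gen_size n (percolate c) = 0" if "n0 \<le> n" for n
        unfolding gen_size_eq_0_iff
      proof
        fix \<tau> assume "\<tau> \<in> L n"
        then have "take n0 \<tau> \<in> L n0" "\<tau> \<in> W" using that by (auto simp: words_of_length_def)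
        then show "\<not> percolate c \<tau>" using n0 percolate_take by blast
      qed
      then have "eventually (\<lambda>n. normalised_size n c = 0) sequentially"
        unfolding normalised_size_def eventually_sequentially by (intro exI[of _ n0]) simp
      then show ?case by (rule tendsto_eventually)
    qed
    show "AE c in field. norm (normalised_size n c) \<le> 1 + (\<Sum>j. \<bar>increment j c\<bar>)" for n
      using AE_summable_increments
    proof eventually_elim
      case (elim c)
      have "\<bar>normalised_size n c\<bar> \<le> 1 + (\<Sum>j<n. \<bar>increment j c\<bar>)"
        unfolding normalised_size_eq_sum using sum_abs[of "\<lambda>j. increment j c" "{..<n}"] by linarith
      also have "\<dots> \<le> 1 + (\<Sum>j. \<bar>increment j c\<bar>)"
        using sum_le_suminf[OF elim, of "{..<n}"] by simp
      finally show ?case by simp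
    qed
  qed measurable
  then show False by (simp add: expectation_normalised_size LIMSEQ_const_iff)
qed


section \<open>Block events along a path chosen by mass\<close>

text \<open>The lower limit agrees with the limit of the normalised generation sizes wherever that exists, and it is measurable
and defined without any convergence.\<close>

definition mass :: "(nat list \<Rightarrow> bool) \<Rightarrow> ennreal" where
  "mass \<omega> = liminf (\<lambda>j. ennreal (decay ^ j * gen_size j \<omega>))"

lemma measurable_mass [measurable]: "mass \<in> borel_measurable \<Omega>"
  unfolding mass_def by measurable

text \<open>Fatou. This one-sided bound is enough, since the mass enters only upper estimates.\<close>

lemma nn_integral_mass_le_1: "(\<integral>\<^sup>+c. mass (percolate c) \<partial>field) \<le> 1"
proof -
  have "(\<integral>\<^sup>+c. mass (percolate c) \<partial>field) \<le> liminf (\<lambda>j. \<integral>\<^sup>+c. ennreal (normalised_size j c) \<partial>field)"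
    unfolding mass_def normalised_size_def[symmetric] by (rule nn_integral_liminf) measurable
  also have "\<dots> = liminf (\<lambda>j. 1)"
    using integrable_normalised_size normalised_size_bounds(1)
    by (subst nn_integral_eq_integral) (simp_all add: expectation_normalised_size)
  finally show ?thesis by (simp add: Liminf_const)
qed

text \<open>\<open>A \<sigma> \<omega> \<tau>\<close> reads: the event occurs at the block \<open>\<tau>\<close> following the
word \<open>\<sigma>\<close>, when \<open>\<omega>\<close> is the configuration below \<open>\<sigma>\<close>. The
absolute position \<open>\<sigma>\<close> is needed because the enumeration of the subcubes may change from cube to
cube. The last \<open>l\<close> letters of a word form its block; \<open>\<sigma>\<^sub>0\<close> is the position of
the root of \<open>\<omega>\<close>.\<close>

definition occurs :: "(nat list \<Rightarrow> (nat list \<Rightarrow> bool) \<Rightarrow> nat list \<Rightarrow> bool) \<Rightarrow> nat \<Rightarrow>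
    nat list \<Rightarrow> (nat list \<Rightarrow> bool) \<Rightarrow> nat list \<Rightarrow> bool" where
  "occurs A l \<sigma>\<^sub>0 \<omega> \<sigma> \<longleftrightarrow>
     A (\<sigma>\<^sub>0 @ take (length \<sigma> - l) \<sigma>) (subtree (take (length \<sigma> - l) \<sigma>) \<omega>) (drop (length \<sigma> - l) \<sigma>)"

definition occurrences :: "(nat list \<Rightarrow> (nat list \<Rightarrow> bool) \<Rightarrow> nat list \<Rightarrow> bool) \<Rightarrow> nat \<Rightarrow>
    nat list \<Rightarrow> (nat list \<Rightarrow> bool) \<Rightarrow> nat \<Rightarrow> nat list \<Rightarrow> nat" where
  "occurrences A l \<sigma>\<^sub>0 \<omega> n \<sigma> = card {i\<in>{1..n}. occurs A l \<sigma>\<^sub>0 \<omega> (take (i * l) \<sigma>)}"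

definition damped_mass :: "(nat list \<Rightarrow> (nat list \<Rightarrow> bool) \<Rightarrow> nat list \<Rightarrow> bool) \<Rightarrow> nat \<Rightarrow>
    nat \<Rightarrow> nat list \<Rightarrow> (nat list \<Rightarrow> bool) \<Rightarrow> ennreal" where
  "damped_mass A l n \<sigma>\<^sub>0 \<omega> = (\<Sum>\<sigma>\<in>L (n * l).
     if \<omega> \<sigma> then ennreal (decay ^ (n * l) * (1 / 2) ^ occurrences A l \<sigma>\<^sub>0 \<omega> n \<sigma>) * mass (subtree \<sigma> \<omega>) else 0)"

text \<open>The event may look at the whole configuration except strictly below the block, where the mass of the continuing words
lives. Its probability is bounded below uniformly in the position of the block.\<close>

definition block_event :: "nat \<Rightarrow> (nat list \<Rightarrow> (nat list \<Rightarrow> bool) \<Rightarrow> nat list \<Rightarrow> bool) \<Rightarrow> bool" where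
  "block_event l A \<longleftrightarrow> 0 < l \<and> (\<forall>\<sigma>\<in>W. \<forall>\<tau>\<in>L l. Measurable.pred \<Omega> (\<lambda>\<omega>. A \<sigma> \<omega> \<tau>) \<and>
     depends_on (- {\<rho>. strict_prefix \<tau> \<rho>}) (\<lambda>\<omega>. A \<sigma> \<omega> \<tau>)) \<and>
     (\<exists>\<delta>>0. \<forall>\<sigma>\<in>W. \<exists>\<tau>\<in>L l. \<delta> \<le> F.prob {c. percolate c \<tau> \<and> A \<sigma> (percolate c) \<tau>})"

lemma occurs_append:
  "length \<tau> = l \<Longrightarrow> l \<le> length \<sigma> \<Longrightarrow>
    occurs A l \<sigma>\<^sub>0 \<omega> (\<tau> @ \<sigma>) \<longleftrightarrow> occurs A l (\<sigma>\<^sub>0 @ \<tau>) (subtree \<tau> \<omega>) \<sigma>"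
  by (simp add: occurs_def)

lemma occurs_block: "length \<tau> = l \<Longrightarrow> occurs A l \<sigma>\<^sub>0 \<omega> \<tau> \<longleftrightarrow> A \<sigma>\<^sub>0 \<omega> \<tau>"
  by (simp add: occurs_def)

lemma occurrences_append:
  assumes "length \<tau> = l" "length \<sigma> = n * l"
  shows "occurrences A l \<sigma>\<^sub>0 \<omega> (Suc n) (\<tau> @ \<sigma>) =
    of_bool (A \<sigma>\<^sub>0 \<omega> \<tau>) + occurrences A l (\<sigma>\<^sub>0 @ \<tau>) (subtree \<tau> \<omega>) n \<sigma>"
proof -
  let ?f = "\<lambda>i. of_bool (occurs A l \<sigma>\<^sub>0 \<omega> (take (i * l) (\<tau> @ \<sigma>))) :: nat"
  have card_eq: "card {i\<in>{1..N}. Q i} = (\<Sum>i\<in>{1..N}. of_bool (Q i))" for N and Q :: "nat \<Rightarrow> bool"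
  proof -
    have "{i\<in>{1..N}. Q i} = {1..N} \<inter> {i. Q i}" by blast
    then show ?thesis by simp
  qed
  have "(\<Sum>i\<in>{1..Suc n}. g i) = g 1 + (\<Sum>i\<in>{1..n}. g (Suc i))" for g :: "nat \<Rightarrow> nat"
    by (induction n) simp_all
  from this[of ?f] have "(\<Sum>i\<in>{1..Suc n}. ?f i) = ?f 1 + (\<Sum>i\<in>{1..n}. ?f (Suc i))" .
  also have "?f 1 = of_bool (A \<sigma>\<^sub>0 \<omega> \<tau>)" using assms by (simp add: occurs_block)
  also have "(\<Sum>i\<in>{1..n}. ?f (Suc i)) =
      (\<Sum>i\<in>{1..n}. of_bool (occurs A l (\<sigma>\<^sub>0 @ \<tau>) (subtree \<tau> \<omega>) (take (i * l) \<sigma>)))"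
  proof (rule sum.cong[OF refl])
    fix i assume "i \<in> {1..n}"
    then have "l \<le> i * l" "i * l \<le> n * l" by auto
    then have "l \<le> length (take (i * l) \<sigma>)" using assms by simp
    moreover have "take (Suc i * l) (\<tau> @ \<sigma>) = \<tau> @ take (i * l) \<sigma>" using assms by simp
    ultimately show "?f (Suc i) = of_bool (occurs A l (\<sigma>\<^sub>0 @ \<tau>) (subtree \<tau> \<omega>) (take (i * l) \<sigma>))"
      using occurs_append[OF assms(1), of "take (i * l) \<sigma>"] by simp
  qed
  finally show ?thesis unfolding occurrences_def card_eq .
qed

lemma measurable_occurs:
  assumes A: "block_event l A" and \<sigma>: "\<sigma>\<^sub>0 \<in> W" "\<sigma> \<in> W" "l \<le> length \<sigma>"
  shows "Measurable.pred \<Omega> (\<lambda>\<omega>. occurs A l \<sigma>\<^sub>0 \<omega> \<sigma>)"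
proof -
  have "Measurable.pred \<Omega> (\<lambda>\<omega>. A (\<sigma>\<^sub>0 @ take (length \<sigma> - l) \<sigma>) \<omega> (drop (length \<sigma> - l) \<sigma>))"
    using A \<sigma> by (auto simp: block_event_def words_of_length_def)
  from measurable_compose[OF measurable_subtree_config this] show ?thesis
    unfolding occurs_def using \<sigma> by auto
qed

lemma measurable_occurrences:
  assumes A: "block_event l A" and \<sigma>: "\<sigma>\<^sub>0 \<in> W" "\<sigma> \<in> L (n * l)"
  shows "(\<lambda>\<omega>. occurrences A l \<sigma>\<^sub>0 \<omega> n \<sigma>) \<in> measurable \<Omega> (count_space UNIV)"
proof -
  have "Measurable.pred \<Omega> (\<lambda>\<omega>. occurs A l \<sigma>\<^sub>0 \<omega> (take (i * l) \<sigma>))" if "i \<in> {1..n}" for i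
    using \<sigma> that by (intro measurable_occurs[OF A]) (auto simp: words_of_length_def)
  then show ?thesis
    unfolding occurrences_def
    by (intro measurable_card[where S="\<lambda>\<omega>. {i\<in>{1..n}. occurs A l \<sigma>\<^sub>0 \<omega> (take (i * l) \<sigma>)}"])
       (auto intro!: pred_intros_logic)
qed

lemma measurable_damped_mass:
  assumes A: "block_event l A" and \<sigma>: "\<sigma>\<^sub>0 \<in> W"
  shows "damped_mass A l n \<sigma>\<^sub>0 \<in> borel_measurable \<Omega>"
  unfolding damped_mass_def
proof (intro borel_measurable_sum measurable_If)
  fix \<sigma> assume s: "\<sigma> \<in> L (n * l)"
  then have w: "\<sigma> \<in> W" by (simp add: words_of_length_def)
  have "(\<lambda>\<omega>. ennreal (decay ^ (n * l) * (1 / 2) ^ occurrences A l \<sigma>\<^sub>0 \<omega> n \<sigma>)) \<in> borel_measurable \<Omega>"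
    using measurable_compose[OF measurable_occurrences[OF A \<sigma> s],
      of "\<lambda>i. ennreal (decay ^ (n * l) * (1 / 2) ^ i)" borel] by simp
  moreover have "(\<lambda>\<omega>. mass (subtree \<sigma> \<omega>)) \<in> borel_measurable \<Omega>"
    by (rule measurable_compose[OF measurable_subtree_config[OF w] measurable_mass])
  ultimately show "(\<lambda>\<omega>. ennreal (decay ^ (n * l) * (1 / 2) ^ occurrences A l \<sigma>\<^sub>0 \<omega> n \<sigma>) * mass (subtree \<sigma> \<omega>))
      \<in> borel_measurable \<Omega>" by (rule borel_measurable_times_ennreal)
  show "{\<omega> \<in> space \<Omega>. \<omega> \<sigma>} \<in> sets \<Omega>"
    using measurable_config_coordinate[OF w] by (simp add: pred_def)
qed simp

text \<open>Split off the first block. Below it the same functional appears for the shifted field, so that expectations can be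
computed recursively.\<close>

lemma damped_mass_Suc:
  "damped_mass A l (Suc n) \<sigma>\<^sub>0 (percolate c) = (\<Sum>\<tau>\<in>L l. ennreal (decay ^ l) *
     ((if percolate c \<tau> then if A \<sigma>\<^sub>0 (percolate c) \<tau> then ennreal (1 / 2) else 1 else 0) *
      damped_mass A l n (\<sigma>\<^sub>0 @ \<tau>) (percolate (subtree \<tau> c))))"
proof -
  have "damped_mass A l (Suc n) \<sigma>\<^sub>0 (percolate c) = (\<Sum>\<tau>\<in>L l. \<Sum>\<sigma>\<in>L (n * l).
      if percolate c (\<tau> @ \<sigma>) then ennreal (decay ^ (l + n * l) *
        (1 / 2) ^ occurrences A l \<sigma>\<^sub>0 (percolate c) (Suc n) (\<tau> @ \<sigma>)) * mass (subtree (\<tau> @ \<sigma>) (percolate c)) else 0)"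
    unfolding damped_mass_def by (simp only: mult_Suc sum_words_of_length_add)
  also have "\<dots> = (\<Sum>\<tau>\<in>L l. \<Sum>\<sigma>\<in>L (n * l). ennreal (decay ^ l) *
      ((if percolate c \<tau> then if A \<sigma>\<^sub>0 (percolate c) \<tau> then ennreal (1 / 2) else 1 else 0) *
      (if percolate (subtree \<tau> c) \<sigma> then ennreal (decay ^ (n * l) *
        (1 / 2) ^ occurrences A l (\<sigma>\<^sub>0 @ \<tau>) (percolate (subtree \<tau> c)) n \<sigma>) *
        mass (subtree \<sigma> (percolate (subtree \<tau> c))) else 0)))"
  proof (intro sum.cong refl)
    fix \<tau> \<sigma> assume "\<tau> \<in> L l" "\<sigma> \<in> L (n * l)"
    then have w: "\<tau> \<in> W" "\<sigma> \<in> W" "length \<tau> = l" "length \<sigma> = n * l" by (auto simp: words_of_length_def)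
    show "(if percolate c (\<tau> @ \<sigma>) then ennreal (decay ^ (l + n * l) *
        (1 / 2) ^ occurrences A l \<sigma>\<^sub>0 (percolate c) (Suc n) (\<tau> @ \<sigma>)) * mass (subtree (\<tau> @ \<sigma>) (percolate c)) else 0) =
      ennreal (decay ^ l) *
      ((if percolate c \<tau> then if A \<sigma>\<^sub>0 (percolate c) \<tau> then ennreal (1 / 2) else 1 else 0) *
      (if percolate (subtree \<tau> c) \<sigma> then ennreal (decay ^ (n * l) *
        (1 / 2) ^ occurrences A l (\<sigma>\<^sub>0 @ \<tau>) (percolate (subtree \<tau> c)) n \<sigma>) *
        mass (subtree \<sigma> (percolate (subtree \<tau> c))) else 0))"
    proof (cases "percolate c \<tau> \<and> percolate (subtree \<tau> c) \<sigma>")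
      case True
      let ?o = "occurrences A l (\<sigma>\<^sub>0 @ \<tau>) (percolate (subtree \<tau> c)) n \<sigma>"
      have sub: "subtree \<tau> (percolate c) = percolate (subtree \<tau> c)"
        using True w by (intro subtree_percolate) auto
      have s2: "subtree (\<tau> @ \<sigma>) (percolate c) = subtree \<sigma> (percolate (subtree \<tau> c))"
        by (simp flip: sub)
      have "occurrences A l \<sigma>\<^sub>0 (percolate c) (Suc n) (\<tau> @ \<sigma>) = of_bool (A \<sigma>\<^sub>0 (percolate c) \<tau>) + ?o"
        using occurrences_append[OF w(3,4), of A \<sigma>\<^sub>0 "percolate c"] by (simp only: sub)
      then have "decay ^ (l + n * l) * (1 / 2) ^ occurrences A l \<sigma>\<^sub>0 (percolate c) (Suc n) (\<tau> @ \<sigma>) =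
          decay ^ l * ((if A \<sigma>\<^sub>0 (percolate c) \<tau> then 1 / 2 else 1) * (decay ^ (n * l) * (1 / 2) ^ ?o))"
        by (simp add: power_add)
      also have "ennreal \<dots> = ennreal (decay ^ l) * ((if A \<sigma>\<^sub>0 (percolate c) \<tau> then ennreal (1 / 2) else 1) *
          ennreal (decay ^ (n * l) * (1 / 2) ^ ?o))"
        using decay_pos by (subst ennreal_mult, simp, simp, subst ennreal_mult) auto
      finally show ?thesis
        using True percolate_append[OF w(1,2), of c] by (simp add: s2 mult.assoc)
    qed (use percolate_append[OF w(1,2), of c] in auto)
  qed
  finally show ?thesis
    by (simp only: damped_mass_def sum_distrib_left)
qed

lemma depends_on_off_branch:
  assumes "depends_on (- {\<rho>. strict_prefix \<tau> \<rho>}) f"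
  shows "depends_on (- {\<rho>. strict_prefix \<tau> \<rho>}) (\<lambda>c. f (percolate c))"
proof (rule depends_onI)
  fix c c' :: "nat list \<Rightarrow> bool"
  assume eq: "\<And>\<rho>. \<rho> \<in> - {\<rho>. strict_prefix \<tau> \<rho>} \<Longrightarrow> c \<rho> = c' \<rho>"
  show "f (percolate c) = f (percolate c')"
  proof (rule depends_onD[OF assms])
    fix \<rho> assume "\<rho> \<in> - {\<rho>. strict_prefix \<tau> \<rho>}"
    then have "\<not> strict_prefix \<tau> (take i \<rho>)" for i
      using take_is_prefix[of i \<rho>] prefix_order.less_le_trans by blast
    then have "c (take i \<rho>) = c' (take i \<rho>)" for i by (intro eq) simp
    then show "percolate c \<rho> = percolate c' \<rho>" by (simp add: percolate_def)
  qed
qed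

text \<open>The factor of the first block depends on marks that are not strictly below \<open>\<tau>\<close>, the remaining damped
mass on marks strictly below \<open>\<tau>\<close>.\<close>

lemma nn_integral_damped_mass_Suc:
  assumes A: "block_event l A" and \<sigma>\<^sub>0: "\<sigma>\<^sub>0 \<in> W"
  shows "(\<integral>\<^sup>+c. damped_mass A l (Suc n) \<sigma>\<^sub>0 (percolate c) \<partial>field) = (\<Sum>\<tau>\<in>L l. ennreal (decay ^ l) *
     (ennreal (F.prob {c. percolate c \<tau>} - F.prob {c. percolate c \<tau> \<and> A \<sigma>\<^sub>0 (percolate c) \<tau>} / 2) *
      (\<integral>\<^sup>+c. damped_mass A l n (\<sigma>\<^sub>0 @ \<tau>) (percolate c) \<partial>field)))"
proof -
  define h :: "nat list \<Rightarrow> (nat list \<Rightarrow> bool) \<Rightarrow> ennreal" where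
    "h \<tau> c = (if percolate c \<tau> then if A \<sigma>\<^sub>0 (percolate c) \<tau> then ennreal (1 / 2) else 1 else 0)" for \<tau> c
  define V where "V \<tau> c = damped_mass A l n (\<sigma>\<^sub>0 @ \<tau>) (percolate c)" for \<tau> c
  have open_m: "Measurable.pred field (\<lambda>c. percolate c \<tau>)" if "\<tau> \<in> L l" for \<tau>
    using that by (intro measurable_compose[OF measurable_percolate measurable_config_coordinate])
      (simp add: words_of_length_def)
  have A_m: "Measurable.pred field (\<lambda>c. A \<sigma>\<^sub>0 (percolate c) \<tau>)" if "\<tau> \<in> L l" for \<tau>
    using A \<sigma>\<^sub>0 that
    by (intro measurable_compose[OF measurable_percolate, of "\<lambda>\<omega>. A \<sigma>\<^sub>0 \<omega> \<tau>"]) (simp add: block_event_def)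
  have hm: "h \<tau> \<in> borel_measurable field" if "\<tau> \<in> L l" for \<tau>
    unfolding h_def using open_m[OF that] A_m[OF that] by (intro measurable_If) (simp_all add: pred_def)
  have Vm: "V \<tau> \<in> borel_measurable field" if "\<tau> \<in> L l" for \<tau>
    unfolding V_def using that \<sigma>\<^sub>0
    by (intro measurable_compose[OF measurable_percolate measurable_damped_mass[OF A]])
      (simp add: words_of_length_def)
  have Vm': "(\<lambda>c. V \<tau> (subtree \<tau> c)) \<in> borel_measurable field" if "\<tau> \<in> L l" for \<tau>
    by (rule measurable_compose[OF measurable_subtree Vm[OF that]])
  have indep: "(\<integral>\<^sup>+c. h \<tau> c * V \<tau> (subtree \<tau> c) \<partial>field) = (\<integral>\<^sup>+c. h \<tau> c \<partial>field) * (\<integral>\<^sup>+c. V \<tau> c \<partial>field)"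
    if t: "\<tau> \<in> L l" for \<tau>
  proof -
    have "depends_on (- {\<rho>. strict_prefix \<tau> \<rho>}) (h \<tau>)"
    proof -
      have "depends_on (- {\<rho>. strict_prefix \<tau> \<rho>}) (\<lambda>\<omega>. \<omega> \<tau>)"
        by (rule depends_onI) simp
      moreover have "depends_on (- {\<rho>. strict_prefix \<tau> \<rho>}) (\<lambda>\<omega>. A \<sigma>\<^sub>0 \<omega> \<tau>)"
        using A \<sigma>\<^sub>0 t by (simp add: block_event_def)
      ultimately have "depends_on (- {\<rho>. strict_prefix \<tau> \<rho>})
          (\<lambda>\<omega>. if \<omega> \<tau> then if A \<sigma>\<^sub>0 \<omega> \<tau> then ennreal (1 / 2) else 1 else 0)"
        by (rule depends_on_compose2[where h="\<lambda>x y. if x then if y then ennreal (1 / 2) else 1 else 0"])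
      from depends_on_off_branch[OF this] show ?thesis by (simp add: h_def[abs_def])
    qed
    moreover have "depends_on ((@) \<tau> ` (- {[]})) (\<lambda>c. V \<tau> (subtree \<tau> c))"
      unfolding V_def
      by (rule depends_on_subtree[OF depends_on_compose[OF depends_on_percolate,
            where h="damped_mass A l n (\<sigma>\<^sub>0 @ \<tau>)"]])
    moreover have "- {\<rho>. strict_prefix \<tau> \<rho>} \<inter> (@) \<tau> ` (- {[]}) = {}"
      by (auto simp: strict_prefix_def)
    ultimately have "(\<integral>\<^sup>+c. h \<tau> c * V \<tau> (subtree \<tau> c) \<partial>field) =
        (\<integral>\<^sup>+c. h \<tau> c \<partial>field) * (\<integral>\<^sup>+c. V \<tau> (subtree \<tau> c) \<partial>field)"
      using hm[OF t] Vm'[OF t] by (intro nn_integral_mult_of_depends_on)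
    then show ?thesis using nn_integral_subtree[OF Vm[OF t]] by simp
  qed
  have h_int: "(\<integral>\<^sup>+c. h \<tau> c \<partial>field) =
      ennreal (F.prob {c. percolate c \<tau>} - F.prob {c. percolate c \<tau> \<and> A \<sigma>\<^sub>0 (percolate c) \<tau>} / 2)"
    if t: "\<tau> \<in> L l" for \<tau>
  proof -
    let ?B = "{c. percolate c \<tau>}" and ?C = "{c. percolate c \<tau> \<and> A \<sigma>\<^sub>0 (percolate c) \<tau>}"
    have C: "?C = ?B \<inter> {c. A \<sigma>\<^sub>0 (percolate c) \<tau>}" by blast
    have "?B \<in> sets field" "{c. A \<sigma>\<^sub>0 (percolate c) \<tau>} \<in> sets field"
      using open_m[OF t] A_m[OF t] by (simp_all add: pred_def)
    then have sets: "?B \<in> sets field" "?C \<in> sets field"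
      unfolding C by (simp_all only: sets.Int)
    have int: "integrable field (indicator ?B :: _ \<Rightarrow> real)" "integrable field (\<lambda>c. indicator ?C c / 2 :: real)"
      using sets by (auto intro!: integrable_real_indicator integrable_divide simp: F.emeasure_eq_measure)
    have "h \<tau> c = ennreal (indicator ?B c - indicator ?C c / 2)" for c
      by (auto simp: h_def indicator_def)
    then have "(\<integral>\<^sup>+c. h \<tau> c \<partial>field) = (\<integral>\<^sup>+c. ennreal (indicator ?B c - indicator ?C c / 2) \<partial>field)"
      by simp
    also have "\<dots> = ennreal (\<integral>c. indicator ?B c - indicator ?C c / 2 \<partial>field)"
    proof (rule nn_integral_eq_integral)
      show "integrable field (\<lambda>c. indicator ?B c - indicator ?C c / 2 :: real)"
        by (rule Bochner_Integration.integrable_diff[OF int])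
      show "AE c in field. 0 \<le> (indicator ?B c - indicator ?C c / 2 :: real)"
        by (rule AE_I2) (simp add: indicator_def)
    qed
    also have "(\<integral>c. indicator ?B c - indicator ?C c / 2 \<partial>field) = F.prob ?B - F.prob ?C / 2"
      by (subst Bochner_Integration.integral_diff[OF int]) simp
    finally show ?thesis .
  qed
  have "(\<integral>\<^sup>+c. damped_mass A l (Suc n) \<sigma>\<^sub>0 (percolate c) \<partial>field) =
      (\<integral>\<^sup>+c. (\<Sum>\<tau>\<in>L l. ennreal (decay ^ l) * (h \<tau> c * V \<tau> (subtree \<tau> c))) \<partial>field)"
    unfolding damped_mass_Suc h_def V_def ..
  also have "\<dots> = (\<Sum>\<tau>\<in>L l. ennreal (decay ^ l) * (\<integral>\<^sup>+c. h \<tau> c * V \<tau> (subtree \<tau> c) \<partial>field))"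
    using hm Vm' by (subst nn_integral_sum) (auto intro!: sum.cong nn_integral_cmult)
  also have "\<dots> = (\<Sum>\<tau>\<in>L l. ennreal (decay ^ l) *
     (ennreal (F.prob {c. percolate c \<tau>} - F.prob {c. percolate c \<tau> \<and> A \<sigma>\<^sub>0 (percolate c) \<tau>} / 2) *
      (\<integral>\<^sup>+c. V \<tau> c \<partial>field)))"
    by (intro sum.cong refl) (simp add: indep h_int)
  finally show ?thesis by (simp only: V_def)
qed

text \<open>The expected normalised size of generation \<open>l\<close> is one.\<close>

lemma sum_prob_open: "decay ^ l * (\<Sum>\<tau>\<in>L l. F.prob {c. percolate c \<tau>}) = 1"
proof -
  have sets: "{c. percolate c \<tau>} \<in> sets field" if "\<tau> \<in> L l" for \<tau>
    using measurable_compose[OF measurable_percolate measurable_config_coordinate, of \<tau>] that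
    by (simp add: pred_def words_of_length_def)
  have eq: "normalised_size l = (\<lambda>c. decay ^ l * (\<Sum>\<tau>\<in>L l. indicator {c. percolate c \<tau>} c))"
    by (rule ext) (simp add: normalised_size_def gen_size_def indicator_def)
  have "F.expectation (normalised_size l) =
      decay ^ l * (\<integral>c. (\<Sum>\<tau>\<in>L l. indicator {c. percolate c \<tau>} c) \<partial>field)"
    unfolding eq by (rule integral_mult_right_zero)
  also have "(\<integral>c. (\<Sum>\<tau>\<in>L l. indicator {c. percolate c \<tau>} c) \<partial>field) =
      (\<Sum>\<tau>\<in>L l. F.prob {c. percolate c \<tau>})"
    using sets by (subst Bochner_Integration.integral_sum)
      (auto intro!: integrable_real_indicator simp: F.emeasure_eq_measure)
  finally show ?thesis by (simp add: expectation_normalised_size)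
qed

text \<open>Without damping, the weights of the blocks of one level sum to one; damping removes at least \<open>decay ^ l *
\<delta> / 2\<close> of them. The maximum with \<open>1 / 2\<close> only keeps \<open>r\<close> positive.\<close>

lemma nn_integral_damped_mass_le:
  assumes A: "block_event l A"
  shows "\<exists>r>0. r < 1 \<and> (\<forall>n. \<forall>\<sigma>\<in>W. (\<integral>\<^sup>+c. damped_mass A l n \<sigma> (percolate c) \<partial>field) \<le> ennreal (r ^ n))"
proof -
  obtain \<delta> where \<delta>: "0 < \<delta>"
    "\<And>\<sigma>. \<sigma> \<in> W \<Longrightarrow> \<exists>\<tau>\<in>L l. \<delta> \<le> F.prob {c. percolate c \<tau> \<and> A \<sigma> (percolate c) \<tau>}"
    using A unfolding block_event_def by blast
  define r where "r = max (1 / 2) (1 - decay ^ l * \<delta> / 2)"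
  have r: "0 < r" "r < 1" using \<delta> decay_pos by (auto simp: r_def)
  have "(\<integral>\<^sup>+c. damped_mass A l n \<sigma> (percolate c) \<partial>field) \<le> ennreal (r ^ n)" if "\<sigma> \<in> W" for n \<sigma>
    using that
  proof (induction n arbitrary: \<sigma>)
    case 0
    have "damped_mass A l 0 \<sigma> (percolate c) = mass (percolate c)" for c
      by (simp add: damped_mass_def words_of_length_0 occurrences_def)
    then show ?case using nn_integral_mass_le_1 by simp
  next
    case (Suc n)
    define q where "q \<tau> = F.prob {c. percolate c \<tau>}" for \<tau>
    define s where "s \<tau> = F.prob {c. percolate c \<tau> \<and> A \<sigma> (percolate c) \<tau>}" for \<tau>
    have sq: "s \<tau> \<le> q \<tau>" if "\<tau> \<in> L l" for \<tau>
      unfolding s_def q_def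
    proof (rule F.finite_measure_mono)
      show "{c. percolate c \<tau>} \<in> F.events"
        using measurable_compose[OF measurable_percolate measurable_config_coordinate, of \<tau>] that
        by (simp add: pred_def words_of_length_def)
    qed auto
    have s0: "0 \<le> s \<tau>" for \<tau> by (simp add: s_def)
    obtain \<tau>\<^sub>0 where \<tau>\<^sub>0: "\<tau>\<^sub>0 \<in> L l" "\<delta> \<le> s \<tau>\<^sub>0" using \<delta>(2)[OF Suc.prems] by (auto simp: s_def)
    have "s \<tau>\<^sub>0 \<le> (\<Sum>\<tau>\<in>L l. s \<tau>)" using \<tau>\<^sub>0 s0 by (intro member_le_sum) auto
    then have "decay ^ l * (\<Sum>\<tau>\<in>L l. s \<tau>) \<ge> decay ^ l * \<delta>"
      using \<tau>\<^sub>0 decay_pos by (intro mult_left_mono) auto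
    then have "decay ^ l * (\<Sum>\<tau>\<in>L l. q \<tau> - s \<tau> / 2) \<le> r"
      using sum_prob_open[of l]
      by (simp add: q_def[symmetric] sum_subtractf right_diff_distrib r_def flip: sum_divide_distrib)
    have "(\<integral>\<^sup>+c. damped_mass A l (Suc n) \<sigma> (percolate c) \<partial>field) = (\<Sum>\<tau>\<in>L l. ennreal (decay ^ l) *
       (ennreal (q \<tau> - s \<tau> / 2) * (\<integral>\<^sup>+c. damped_mass A l n (\<sigma> @ \<tau>) (percolate c) \<partial>field)))"
      unfolding q_def s_def by (rule nn_integral_damped_mass_Suc[OF A Suc.prems])
    also have "\<dots> \<le> (\<Sum>\<tau>\<in>L l. ennreal (decay ^ l) * (ennreal (q \<tau> - s \<tau> / 2) * ennreal (r ^ n)))"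
      using Suc.prems by (intro sum_mono mult_left_mono Suc.IH) (auto simp: words_of_length_def)
    also have "\<dots> = (\<Sum>\<tau>\<in>L l. ennreal (decay ^ l * ((q \<tau> - s \<tau> / 2) * r ^ n)))"
    proof (rule sum.cong[OF refl])
      fix \<tau> assume "\<tau> \<in> L l"
      then have "0 \<le> q \<tau> - s \<tau> / 2" using sq[of \<tau>] s0[of \<tau>] by simp
      then show "ennreal (decay ^ l) * (ennreal (q \<tau> - s \<tau> / 2) * ennreal (r ^ n)) =
          ennreal (decay ^ l * ((q \<tau> - s \<tau> / 2) * r ^ n))"
        using r decay_pos by (simp add: ennreal_mult)
    qed
    also have "\<dots> = ennreal (\<Sum>\<tau>\<in>L l. decay ^ l * ((q \<tau> - s \<tau> / 2) * r ^ n))"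
    proof (rule sum_ennreal)
      fix \<tau> assume "\<tau> \<in> L l"
      then have "0 \<le> q \<tau> - s \<tau> / 2" using sq[of \<tau>] s0[of \<tau>] by simp
      then show "0 \<le> decay ^ l * ((q \<tau> - s \<tau> / 2) * r ^ n)" using decay_pos r by simp
    qed
    also have "(\<Sum>\<tau>\<in>L l. decay ^ l * ((q \<tau> - s \<tau> / 2) * r ^ n)) =
        decay ^ l * (\<Sum>\<tau>\<in>L l. q \<tau> - s \<tau> / 2) * r ^ n"
      by (simp only: sum_distrib_left sum_distrib_right mult.assoc)
    also have "\<dots> \<le> r * r ^ n"
      using r \<open>decay ^ l * (\<Sum>\<tau>\<in>L l. q \<tau> - s \<tau> / 2) \<le> r\<close> by (intro mult_right_mono) auto
    finally show ?case by (simp add: ennreal_leI)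
  qed
  then show ?thesis using r by blast
qed

lemma AE_damped_mass_summable:
  assumes A: "block_event l A" and P: "percolation_measure k m p P"
  obtains s where "1 < s" "AE \<omega> in P. (\<Sum>n. ennreal (s ^ n) * damped_mass A l n [] \<omega>) \<noteq> \<infinity>"
proof -
  obtain r where r: "0 < r" "r < 1"
    and le: "\<And>n \<sigma>. \<sigma> \<in> W \<Longrightarrow> (\<integral>\<^sup>+c. damped_mass A l n \<sigma> (percolate c) \<partial>field) \<le> ennreal (r ^ n)"
    using nn_integral_damped_mass_le[OF A] by auto
  \<comment> \<open>Any \<open>s\<close> strictly between \<open>1\<close> and \<open>1 / r\<close> serves; this one gives \<open>s * r = sqrt r\<close>.\<close>
  define s where "s = 1 / sqrt r"
  have s: "1 < s" using r by (simp add: s_def)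
  have sr: "s * r = sqrt r" using r by (simp add: s_def real_div_sqrt)
  have Peq: "P = distr field \<Omega> percolate" by (rule percolation_measure_eq_distr[OF P])
  have meas: "damped_mass A l n [] \<in> borel_measurable \<Omega>" for n
    by (rule measurable_damped_mass[OF A Nil_in_words])
  have meas': "(\<lambda>\<omega>. \<Sum>n. ennreal (s ^ n) * damped_mass A l n [] \<omega>) \<in> borel_measurable \<Omega>"
    using meas by measurable
  have "(\<integral>\<^sup>+\<omega>. (\<Sum>n. ennreal (s ^ n) * damped_mass A l n [] \<omega>) \<partial>P) =
      (\<integral>\<^sup>+c. (\<Sum>n. ennreal (s ^ n) * damped_mass A l n [] (percolate c)) \<partial>field)"
    unfolding Peq by (rule nn_integral_distr[OF measurable_percolate]) (use meas' in simp)
  also have "\<dots> = (\<Sum>n. ennreal (s ^ n) * (\<integral>\<^sup>+c. damped_mass A l n [] (percolate c) \<partial>field))"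
    using measurable_compose[OF measurable_percolate meas]
    by (subst nn_integral_suminf) (simp_all add: nn_integral_cmult)
  also have "\<dots> \<le> (\<Sum>n. ennreal (sqrt r ^ n))"
  proof (rule suminf_le)
    fix n
    have "ennreal (s ^ n) * (\<integral>\<^sup>+c. damped_mass A l n [] (percolate c) \<partial>field) \<le> ennreal (s ^ n) * ennreal (r ^ n)"
      by (intro mult_left_mono le) auto
    also have "\<dots> = ennreal (sqrt r ^ n)"
      using s r by (simp only: ennreal_mult[symmetric] power_mult_distrib[symmetric] sr zero_le_power less_imp_le
        order.strict_trans[OF zero_less_one])
    finally show "ennreal (s ^ n) * (\<integral>\<^sup>+c. damped_mass A l n [] (percolate c) \<partial>field) \<le> ennreal (sqrt r ^ n)" .
  qed auto
  also have "\<dots> = ennreal (\<Sum>n. sqrt r ^ n)"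
    using r by (intro suminf_ennreal2 summable_geometric) auto
  finally have "(\<integral>\<^sup>+\<omega>. (\<Sum>n. ennreal (s ^ n) * damped_mass A l n [] \<omega>) \<partial>P) \<noteq> \<infinity>"
    by (auto simp: top_unique)
  then have "AE \<omega> in P. (\<Sum>n. ennreal (s ^ n) * damped_mass A l n [] \<omega>) \<noteq> \<infinity>"
    by (intro nn_integral_noteq_infinite) (use meas' in \<open>simp add: Peq\<close>)
  then show ?thesis using s that by blast
qed

end


section \<open>The measure on codes\<close>

text \<open>The consecutive intervals with lengths \<open>g 1, g 2, \<dots>\<close> partition the interval from zero to the total
length.\<close>

lemma ex1_partition_cell:
  fixes g :: "nat \<Rightarrow> real"
  assumes nonneg: "\<And>j. j \<in> {1..q} \<Longrightarrow> 0 \<le> g j" and x: "0 \<le> x" "x < (\<Sum>j\<in>{1..q}. g j)"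
  shows "\<exists>!j. j \<in> {1..q} \<and> (\<Sum>i\<in>{1..<j}. g i) \<le> x \<and> x < (\<Sum>i\<in>{1..<j}. g i) + g j"
proof -
  define S where "S j = (\<Sum>i\<in>{1..<j}. g i)" for j
  have S_Suc: "S (Suc j) = S j + g j" if "1 \<le> j" for j using that by (simp add: S_def)
  have mono: "S i \<le> S j" if "i \<le> j" "j \<le> Suc q" for i j
    unfolding S_def using that by (intro sum_mono2) (auto intro!: nonneg)
  define j where "j = (LEAST j. x < S (Suc j))"
  have Sq: "x < S (Suc q)" using x by (simp add: S_def atLeastLessThanSuc_atLeastAtMost)
  have j: "x < S (Suc j)" unfolding j_def by (rule LeastI[of "\<lambda>j. x < S (Suc j)" q, OF Sq])
  have jq: "j \<le> q" unfolding j_def by (rule Least_le[of "\<lambda>j. x < S (Suc j)" q, OF Sq])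
  have j1: "1 \<le> j"
  proof (rule ccontr)
    assume "\<not> 1 \<le> j" then have "j = 0" by simp
    then show False using j x by (simp add: S_def)
  qed
  have "S j \<le> x"
  proof -
    have "\<not> x < S (Suc (j - 1))"
      using not_less_Least[of "j - 1" "\<lambda>j. x < S (Suc j)"] j1 unfolding j_def[symmetric] by simp
    then show ?thesis using j1 by simp
  qed
  moreover have uniq: "i = j" if "i \<in> {1..q} \<and> S i \<le> x \<and> x < S i + g i" for i
  proof (rule linorder_cases[of i j])
    assume "i < j"
    then have "S (Suc i) \<le> S j" using jq by (intro mono) auto
    then show ?thesis using that S_Suc[of i] \<open>S j \<le> x\<close> by simp
  next
    assume "j < i"
    then have "S (Suc j) \<le> S i" using that by (intro mono) auto
    then show ?thesis using that j by simp
  qed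
  moreover have "j \<in> {1..q} \<and> S j \<le> x \<and> x < S j + g j"
    using \<open>S j \<le> x\<close> j j1 jq S_Suc[OF j1] by simp
  ultimately show ?thesis
    unfolding S_def[symmetric] by (intro ex1I[of _ j])
qed

context supercritical
begin

lemma space_code_space: "space (code_space k m) = UNIV \<rightarrow>\<^sub>E I"
  by (simp add: code_space_def space_PiM)

lemma initial_word_in_words: "\<eta> \<in> UNIV \<rightarrow>\<^sub>E I \<Longrightarrow> initial_word \<eta> n \<in> L n"
  by (auto simp: initial_word_def words_of_length_def words_def PiE_iff in_lists_conv_set)

lemma initial_word_Suc: "initial_word \<eta> (Suc n) = initial_word \<eta> n @ [\<eta> n]"
  by (simp add: initial_word_def)

lemma length_initial_word [simp]: "length (initial_word \<eta> n) = n"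
  by (simp add: initial_word_def)

lemma take_initial_word: "i \<le> n \<Longrightarrow> take i (initial_word \<eta> n) = initial_word \<eta> i"
  by (simp add: initial_word_def take_map)

lemma measurable_initial_word: "(\<lambda>\<eta>. initial_word \<eta> n) \<in> measurable (code_space k m) (count_space (L n))"
proof (induction n)
  case 0
  show ?case by (simp add: initial_word_def words_of_length_0)
next
  case (Suc n)
  have c: "(\<lambda>\<eta>. \<eta> n) \<in> measurable (code_space k m) (count_space I)"
    unfolding code_space_def by measurable
  show ?case
  proof (subst measurable_count_space_eq2, simp, intro conjI ballI)
    show "(\<lambda>\<eta>. initial_word \<eta> (Suc n)) \<in> space (code_space k m) \<rightarrow> L (Suc n)"
      using initial_word_in_words by (auto simp: space_code_space)
    fix \<sigma> assume "\<sigma> \<in> L (Suc n)"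
    then have s: "take n \<sigma> \<in> L n" "\<sigma> ! n \<in> I" "\<sigma> = take n \<sigma> @ [\<sigma> ! n]"
      using take_in_words[of \<sigma> n] nth_mem[of n \<sigma>]
      by (auto simp: words_of_length_def words_def in_lists_conv_set take_Suc_conv_app_nth[symmetric])
    have "initial_word \<eta> (Suc n) = \<sigma> \<longleftrightarrow> initial_word \<eta> n = take n \<sigma> \<and> \<eta> n = \<sigma> ! n" for \<eta>
      by (subst s(3)) (simp add: initial_word_Suc)
    then have "(\<lambda>\<eta>. initial_word \<eta> (Suc n)) -` {\<sigma>} \<inter> space (code_space k m) =
       ((\<lambda>\<eta>. initial_word \<eta> n) -` {take n \<sigma>} \<inter> space (code_space k m)) \<inter>
       ((\<lambda>\<eta>. \<eta> n) -` {\<sigma> ! n} \<inter> space (code_space k m))"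
      by auto
    also have "\<dots> \<in> sets (code_space k m)"
      by (intro sets.Int measurable_sets[OF Suc] measurable_sets[OF c]) (use s(1,2) in auto)
    finally show "(\<lambda>\<eta>. initial_word \<eta> (Suc n)) -` {\<sigma>} \<inter> space (code_space k m) \<in> sets (code_space k m)" .
  qed
qed

lemma sets_code_cylinder: "\<sigma> \<in> W \<Longrightarrow> code_cylinder k m \<sigma> \<in> sets (code_space k m)"
  using measurable_sets[OF measurable_initial_word, of "{\<sigma>}" "length \<sigma>"]
  by (simp add: code_cylinder_def vimage_def Int_def conj_commute words_of_length_def)

lemma code_measure_unique:
  assumes "sets \<mu> = sets (code_space k m)" "sets \<nu> = sets (code_space k m)"
    and eq: "\<And>\<sigma>. \<sigma> \<in> W \<Longrightarrow> emeasure \<mu> (code_cylinder k m \<sigma>) = emeasure \<nu> (code_cylinder k m \<sigma>)"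
    and fin: "emeasure \<mu> (code_cylinder k m []) < \<infinity>"
  shows "\<mu> = \<nu>"
proof (rule measure_eqI_finite_patterns)
  show "sets \<mu> = sets (\<Pi>\<^sub>M i\<in>UNIV. count_space I)" "sets \<nu> = sets (\<Pi>\<^sub>M i\<in>UNIV. count_space I)"
    using assms(1,2) by (simp_all add: code_space_def)
  have "code_cylinder k m [] = space \<mu>"
    using sets_eq_imp_space_eq[OF assms(1)] by (simp add: code_cylinder_def initial_word_def)
  then show "finite_measure \<mu>" using fin by (intro finite_measureI) auto
  fix J :: "nat set" assume J: "finite J"
  from finite_nat_bounded[OF J] obtain n where n: "J \<subseteq> {..<n}" by blast
  have *: "emeasure \<mu> {x \<in> UNIV \<rightarrow>\<^sub>E I. \<forall>i\<in>{..<n}. x i = s i} = emeasure \<nu> {x \<in> UNIV \<rightarrow>\<^sub>E I. \<forall>i\<in>{..<n}. x i = s i}"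
    if "s \<in> {..<n} \<rightarrow>\<^sub>E I" for s
  proof -
    have "map s [0..<n] \<in> W" using PiE_mem[OF that] by (auto simp: words_def in_lists_conv_set)
    moreover have "{x \<in> UNIV \<rightarrow>\<^sub>E I. \<forall>i\<in>{..<n}. x i = s i} = code_cylinder k m (map s [0..<n])"
      by (simp add: code_cylinder_def initial_word_def space_code_space Ball_def)
    ultimately show ?thesis using eq[of "map s [0..<n]"] by simp
  qed
  show "\<exists>K. J \<subseteq> K \<and> K \<subseteq> UNIV \<and> finite K \<and> (\<forall>s\<in>K \<rightarrow>\<^sub>E I.
      emeasure \<mu> {x \<in> UNIV \<rightarrow>\<^sub>E I. \<forall>i\<in>K. x i = s i} = emeasure \<nu> {x \<in> UNIV \<rightarrow>\<^sub>E I. \<forall>i\<in>K. x i = s i})"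
    by (intro exI[of _ "{..<n}"] conjI ballI *) (use n in simp_all)
qed simp

text \<open>Consistent weights are the lengths of nested half-open intervals: the interval of \<open>\<sigma>\<close> is divided
into consecutive intervals of lengths \<open>w (\<sigma> @ [j])\<close>. Reading off the sequence of intervals around
a point maps Lebesgue measure to the required measure.\<close>

lemma code_measure_exists:
  fixes w :: "nat list \<Rightarrow> real"
  assumes nonneg: "\<And>\<sigma>. \<sigma> \<in> W \<Longrightarrow> 0 \<le> w \<sigma>"
    and additive: "\<And>\<sigma>. \<sigma> \<in> W \<Longrightarrow> w \<sigma> = (\<Sum>j\<in>I. w (\<sigma> @ [j]))"
  shows "\<exists>\<mu>. sets \<mu> = sets (code_space k m) \<and>
    (\<forall>\<sigma>\<in>W. emeasure \<mu> (code_cylinder k m \<sigma>) = ennreal (w \<sigma>))"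
proof -
  define left where "left \<sigma> = (\<Sum>i<length \<sigma>. \<Sum>j\<in>{1..<\<sigma> ! i}. w (take i \<sigma> @ [j]))" for \<sigma>
  define J where "J \<sigma> = {left \<sigma>..<left \<sigma> + w \<sigma>}" for \<sigma>
  have left_snoc: "left (\<sigma> @ [j]) = left \<sigma> + (\<Sum>i\<in>{1..<j}. w (\<sigma> @ [i]))" for \<sigma> j
    by (simp add: left_def nth_append)
  have ex1: "\<exists>!j. j \<in> I \<and> u \<in> J (\<sigma> @ [j])" if "\<sigma> \<in> W" "u \<in> J \<sigma>" for \<sigma> u
  proof -
    have "\<exists>!j. j \<in> {1..k ^ m} \<and> (\<Sum>i\<in>{1..<j}. w (\<sigma> @ [i])) \<le> u - left \<sigma> \<and>
        u - left \<sigma> < (\<Sum>i\<in>{1..<j}. w (\<sigma> @ [i])) + w (\<sigma> @ [j])"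
      using that additive[OF that(1)]
      by (intro ex1_partition_cell nonneg) (auto simp: J_def alphabet_def)
    then show ?thesis
      by (simp add: J_def left_snoc alphabet_def le_diff_eq diff_less_eq add_ac)
  qed
  have J_sub: "J (\<sigma> @ [j]) \<subseteq> J \<sigma>" if "\<sigma> \<in> W" "j \<in> I" for \<sigma> j
  proof -
    have nn: "0 \<le> w (\<sigma> @ [i])" if "i \<in> I" for i using that \<open>\<sigma> \<in> W\<close> by (intro nonneg) simp
    have "(\<Sum>i\<in>{1..<j}. w (\<sigma> @ [i])) + w (\<sigma> @ [j]) = (\<Sum>i\<in>{1..j}. w (\<sigma> @ [i]))"
      using that by (simp add: alphabet_def flip: atLeastLessThanSuc_atLeastAtMost)
    also have "\<dots> \<le> (\<Sum>i\<in>I. w (\<sigma> @ [i]))"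
      by (intro sum_mono2 finite_alphabet nn) (use that in \<open>auto simp: alphabet_def\<close>)
    finally have "(\<Sum>i\<in>{1..<j}. w (\<sigma> @ [i])) + w (\<sigma> @ [j]) \<le> w \<sigma>" using additive[OF that(1)] by simp
    moreover have "0 \<le> (\<Sum>i\<in>{1..<j}. w (\<sigma> @ [i]))"
      by (intro sum_nonneg nn) (use that in \<open>auto simp: alphabet_def\<close>)
    ultimately show ?thesis by (auto simp: J_def left_snoc)
  qed
  define step where "step u \<sigma> = \<sigma> @ [THE j. j \<in> I \<and> u \<in> J (\<sigma> @ [j])]" for u \<sigma>
  define path where "path u n = (step u ^^ n) []" for u n
  define code where "code u n = (if u \<in> J [] then last (path u (Suc n)) else undefined)" for u n
  have path: "path u n \<in> L n \<and> u \<in> J (path u n)" if "u \<in> J []" for u n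
  proof (induction n)
    case 0 then show ?case using that by (simp add: path_def words_of_length_0)
  next
    case (Suc n)
    then have "path u n \<in> W" by (simp add: words_of_length_def)
    from theI'[OF ex1[OF this]] Suc show ?case
      by (simp add: path_def step_def words_of_length_def)
  qed
  have path_Suc: "path u (Suc n) = path u n @ [code u n]" if "u \<in> J []" for u n
    using that by (simp add: path_def code_def step_def)
  have initial: "initial_word (code u) n = path u n" if "u \<in> J []" for u n
    by (induction n) (simp_all add: initial_word_def path_Suc[OF that], simp add: path_def)
  have J_nil: "J \<sigma> \<subseteq> J []" if "\<sigma> \<in> W" for \<sigma>
    using that
  proof (induction \<sigma> rule: rev_induct)
    case (snoc j \<sigma>)
    then have "J \<sigma> \<subseteq> J []" "J (\<sigma> @ [j]) \<subseteq> J \<sigma>" using J_sub[of \<sigma> j] by auto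
    then show ?case by (rule order.trans[rotated])
  qed simp
  have path_eq: "path u (length \<sigma>) = \<sigma>" if "\<sigma> \<in> W" "u \<in> J \<sigma>" for \<sigma> u
    using that
  proof (induction \<sigma> rule: rev_induct)
    case Nil show ?case by (simp add: path_def)
  next
    case (snoc j \<sigma>)
    then have j: "\<sigma> \<in> W" "j \<in> I" "u \<in> J \<sigma>" using J_sub[of \<sigma> j] by auto
    have "(THE j. j \<in> I \<and> u \<in> J (\<sigma> @ [j])) = j"
      using snoc.prems j by (intro the1_equality ex1) auto
    then show ?case using snoc.IH j by (simp add: path_def step_def)
  qed
  have cyl: "initial_word (code u) (length \<sigma>) = \<sigma> \<longleftrightarrow> u \<in> J \<sigma>" if "\<sigma> \<in> W" "u \<in> J []" for \<sigma> u
  proof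
    assume "initial_word (code u) (length \<sigma>) = \<sigma>"
    then have "path u (length \<sigma>) = \<sigma>" using initial[OF that(2)] by simp
    then show "u \<in> J \<sigma>" using path[OF that(2), of "length \<sigma>"] by simp
  next
    assume "u \<in> J \<sigma>"
    then show "initial_word (code u) (length \<sigma>) = \<sigma>" using path_eq[OF that(1)] initial[OF that(2)] by simp
  qed
  define B where "B = restrict_space lborel (J [])"
  have space_B: "space B = J []" by (simp add: B_def space_restrict_space)
  have J_sets: "J \<sigma> \<in> sets B" if "\<sigma> \<in> W" for \<sigma>
    using J_nil[OF that] by (auto simp: B_def sets_restrict_space J_def intro!: image_eqI[of _ _ "J \<sigma>"])
  have code_in: "code u \<in> UNIV \<rightarrow>\<^sub>E I" if "u \<in> J []" for u
  proof -
    have "code u n \<in> I" for n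
      using path[OF that, of "Suc n"] by (simp add: path_Suc[OF that] words_of_length_def)
    then show ?thesis by (simp add: PiE_iff)
  qed
  have code_m: "code \<in> measurable B (code_space k m)"
    unfolding code_space_def
  proof (rule measurable_PiM_single')
    show "(\<lambda>u. code u n) \<in> measurable B (count_space I)" for n
    proof (subst measurable_count_space_eq2, simp, intro conjI ballI)
      show "(\<lambda>u. code u n) \<in> space B \<rightarrow> I" using code_in by (auto simp: space_B PiE_iff)
      fix j assume j: "j \<in> I"
      have "(\<lambda>u. code u n) -` {j} \<inter> space B = (\<Union>\<sigma>\<in>L n. J (\<sigma> @ [j]))"
      proof (intro set_eqI iffI)
        fix u assume "u \<in> (\<lambda>u. code u n) -` {j} \<inter> space B"
        then have u: "code u n = j" "u \<in> J []" by (auto simp: space_B)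
        then show "u \<in> (\<Union>\<sigma>\<in>L n. J (\<sigma> @ [j]))"
          using path[OF u(2), of n] path[OF u(2), of "Suc n"] path_Suc[OF u(2), of n] by auto
      next
        fix u assume "u \<in> (\<Union>\<sigma>\<in>L n. J (\<sigma> @ [j]))"
        then obtain \<sigma> where \<sigma>: "\<sigma> \<in> L n" "u \<in> J (\<sigma> @ [j])" by blast
        then have "\<sigma> @ [j] \<in> W" using j by (simp add: words_of_length_def)
        then have u: "u \<in> J []" and "path u (length (\<sigma> @ [j])) = \<sigma> @ [j]"
          using \<sigma> J_nil[of "\<sigma> @ [j]"] path_eq[of "\<sigma> @ [j]" u] by auto
        then have "path u (Suc n) = \<sigma> @ [j]" using \<sigma> by (simp add: words_of_length_def)
        then show "u \<in> (\<lambda>u. code u n) -` {j} \<inter> space B"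
          using u path_Suc[OF u, of n] by (simp add: space_B)
      qed
      also have "\<dots> \<in> sets B"
        using j by (intro sets.finite_UN finite_words_of_length J_sets) (auto simp: words_of_length_def)
      finally show "(\<lambda>u. code u n) -` {j} \<inter> space B \<in> sets B" .
    qed
    show "(\<lambda>u n. code u n) \<in> space B \<rightarrow> (\<Pi>\<^sub>E n\<in>UNIV. space (count_space I))"
      using code_in by (auto simp: space_B)
  qed
  have "emeasure (distr B (code_space k m) code) (code_cylinder k m \<sigma>) = ennreal (w \<sigma>)" if "\<sigma> \<in> W" for \<sigma>
  proof -
    have "code -` code_cylinder k m \<sigma> \<inter> space B = J \<sigma>"
      using cyl[OF that] J_nil[OF that] code_in by (auto simp: space_B code_cylinder_def space_code_space)
    then have "emeasure (distr B (code_space k m) code) (code_cylinder k m \<sigma>) = emeasure B (J \<sigma>)"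
      using emeasure_distr[OF code_m sets_code_cylinder[OF that]] by simp
    also have "\<dots> = emeasure lborel (J \<sigma>)"
      using J_nil[OF that] unfolding B_def by (intro emeasure_restrict_space) (auto simp: J_def)
    also have "\<dots> = ennreal (w \<sigma>)" using nonneg[OF that] by (simp add: J_def)
    finally show ?thesis .
  qed
  then show ?thesis by (intro exI[of _ "distr B (code_space k m) code"]) simp
qed

lemma gen_size_Suc: "gen_size (Suc j) \<omega> = (\<Sum>i\<in>I. gen_size j (subtree [i] \<omega>))"
proof -
  have "gen_size (Suc 0 + j) \<omega> = (\<Sum>i\<in>I. \<Sum>\<tau>\<in>L j. of_bool (\<omega> ([i] @ \<tau>)))"
    unfolding gen_size_def by (simp only: sum_words_of_length_add sum_words_of_length_1)
  then show ?thesis by (simp only: gen_size_def subtree_apply plus_nat.simps)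
qed

definition converging :: "(nat list \<Rightarrow> bool) \<Rightarrow> bool" where
  "converging \<omega> \<longleftrightarrow> (\<forall>\<sigma>\<in>W. convergent (\<lambda>j. decay ^ j * gen_size j (subtree \<sigma> \<omega>)))"

lemma powr_perc_dim: "real k powr - (real j * perc_dim k m p) = decay ^ j"
  using decay_powr by simp

lemma mart_limit_LIMSEQ:
  assumes "converging \<omega>" "\<sigma> \<in> W"
  shows "(\<lambda>j. decay ^ j * gen_size j (subtree \<sigma> \<omega>)) \<longlonglongrightarrow> mart_limit k m p \<omega> \<sigma>"
proof -
  have "mart_limit k m p \<omega> \<sigma> = lim (\<lambda>j. decay ^ j * gen_size j (subtree \<sigma> \<omega>))"
    unfolding mart_limit_def using assms(2) by (simp add: num_chosen_eq powr_perc_dim mult.commute)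
  then show ?thesis using assms by (simp add: converging_def convergent_LIMSEQ_iff)
qed

lemma mart_limit_nonneg: "converging \<omega> \<Longrightarrow> \<sigma> \<in> W \<Longrightarrow> 0 \<le> mart_limit k m p \<omega> \<sigma>"
  using decay_pos gen_size_nonneg by (intro LIMSEQ_le_const[OF mart_limit_LIMSEQ]) auto

lemma mass_eq_mart_limit:
  "converging \<omega> \<Longrightarrow> \<sigma> \<in> W \<Longrightarrow> mass (subtree \<sigma> \<omega>) = ennreal (mart_limit k m p \<omega> \<sigma>)"
  unfolding mass_def by (intro lim_imp_Liminf tendsto_ennrealI mart_limit_LIMSEQ) simp

text \<open>Generation \<open>j + 1\<close> below \<open>\<sigma>\<close> consists of the generations \<open>j\<close> below the
children of \<open>\<sigma>\<close>; pass to the limit.\<close>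

lemma mart_limit_additive:
  assumes "converging \<omega>" "\<sigma> \<in> W"
  shows "mart_limit k m p \<omega> \<sigma> = decay * (\<Sum>i\<in>I. mart_limit k m p \<omega> (\<sigma> @ [i]))"
proof (rule LIMSEQ_unique)
  show "(\<lambda>j. decay ^ Suc j * gen_size (Suc j) (subtree \<sigma> \<omega>)) \<longlonglongrightarrow> mart_limit k m p \<omega> \<sigma>"
    by (rule LIMSEQ_Suc[OF mart_limit_LIMSEQ[OF assms]])
  have "(\<lambda>j. decay ^ Suc j * gen_size (Suc j) (subtree \<sigma> \<omega>)) =
      (\<lambda>j. decay * (\<Sum>i\<in>I. decay ^ j * gen_size j (subtree (\<sigma> @ [i]) \<omega>)))"
    by (simp add: gen_size_Suc sum_distrib_left mult.assoc)
  also have "\<dots> \<longlonglongrightarrow> decay * (\<Sum>i\<in>I. mart_limit k m p \<omega> (\<sigma> @ [i]))"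
    using assms by (intro tendsto_mult_left tendsto_sum mart_limit_LIMSEQ) auto
  finally show "(\<lambda>j. decay ^ Suc j * gen_size (Suc j) (subtree \<sigma> \<omega>)) \<longlonglongrightarrow>
      decay * (\<Sum>i\<in>I. mart_limit k m p \<omega> (\<sigma> @ [i]))" .
qed

text \<open>Additivity of the limits is what existence needs, and measures on codes are determined by cylinders; so the definite
description in the definition of the measure is meaningful.\<close>

lemma is_code_measure_code_measure:
  fixes e :: "nat list \<Rightarrow> nat \<Rightarrow> real ^ 'm"
  assumes m: "m = CARD('m)" and conv: "converging \<omega>"
  shows "is_code_measure k e p \<omega> (code_measure k e p \<omega>)"
proof -
  define D where "D = diameter (cube k e []) powr perc_dim k m p"
  define w where "w \<sigma> = D * decay ^ length \<sigma> * mart_limit k m p \<omega> \<sigma>" for \<sigma>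
  have D: "0 \<le> D" by (simp add: D_def)
  have iff: "is_code_measure k e p \<omega> \<mu> \<longleftrightarrow> sets \<mu> = sets (code_space k m) \<and>
      (\<forall>\<sigma>\<in>W. emeasure \<mu> (code_cylinder k m \<sigma>) = ennreal (w \<sigma>))" for \<mu>
    by (simp add: is_code_measure_def w_def D_def powr_perc_dim flip: m)
  have "\<exists>!\<mu>. is_code_measure k e p \<omega> \<mu>"
  proof (rule ex_ex1I)
    show "\<exists>\<mu>. is_code_measure k e p \<omega> \<mu>"
      unfolding iff
    proof (rule code_measure_exists)
      fix \<sigma> assume \<sigma>: "\<sigma> \<in> W"
      show "0 \<le> w \<sigma>" using D decay_pos mart_limit_nonneg[OF conv \<sigma>] by (simp add: w_def)
      show "w \<sigma> = (\<Sum>j\<in>I. w (\<sigma> @ [j]))"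
        unfolding w_def mart_limit_additive[OF conv \<sigma>]
        by (simp add: sum_distrib_left mult_ac)
    qed
    fix \<mu> \<nu> assume "is_code_measure k e p \<omega> \<mu>" "is_code_measure k e p \<omega> \<nu>"
    then show "\<mu> = \<nu>" unfolding iff by (intro code_measure_unique) auto
  qed
  then show ?thesis unfolding code_measure_def by (rule theI')
qed

lemma
  fixes e :: "nat list \<Rightarrow> nat \<Rightarrow> real ^ 'm"
  assumes m: "m = CARD('m)" and conv: "converging \<omega>"
  shows sets_code_measure: "sets (code_measure k e p \<omega>) = sets (code_space k m)"
    and emeasure_code_cylinder: "\<exists>D\<ge>0. \<forall>\<sigma>\<in>W. emeasure (code_measure k e p \<omega>) (code_cylinder k m \<sigma>) =
       ennreal (D * decay ^ length \<sigma>) * mass (subtree \<sigma> \<omega>)"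
proof -
  define D where "D = diameter (cube k e []) powr perc_dim k m p"
  have D: "0 \<le> D" by (simp add: D_def)
  show "sets (code_measure k e p \<omega>) = sets (code_space k m)"
    using is_code_measure_code_measure[OF assms, of e] by (simp add: is_code_measure_def flip: m)
  have "emeasure (code_measure k e p \<omega>) (code_cylinder k m \<sigma>) =
       ennreal (D * decay ^ length \<sigma>) * mass (subtree \<sigma> \<omega>)" if "\<sigma> \<in> W" for \<sigma>
    using is_code_measure_code_measure[OF assms, of e] that mass_eq_mart_limit[OF conv that]
      mart_limit_nonneg[OF conv that] D decay_pos
    by (simp add: is_code_measure_def D_def powr_perc_dim ennreal_mult flip: m)
  then show "\<exists>D\<ge>0. \<forall>\<sigma>\<in>W. emeasure (code_measure k e p \<omega>) (code_cylinder k m \<sigma>) =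
       ennreal (D * decay ^ length \<sigma>) * mass (subtree \<sigma> \<omega>)" using D by blast
qed


section \<open>Frequency of block events\<close>

text \<open>The almost sure properties of a configuration that the deterministic arguments use.\<close>

definition regular :: "(nat list \<Rightarrow> bool) \<Rightarrow> bool" where
  "regular \<omega> \<longleftrightarrow> converging \<omega> \<and> (\<forall>\<sigma>\<in>W. \<forall>\<tau>\<in>W. \<omega> (\<sigma> @ \<tau>) \<longrightarrow> \<omega> \<sigma>)"

lemma regular_take: "regular \<omega> \<Longrightarrow> \<sigma> \<in> W \<Longrightarrow> \<omega> \<sigma> \<Longrightarrow> \<omega> (take n \<sigma>)"
  unfolding regular_def using take_in_words[of \<sigma> n] drop_in_words[of \<sigma> n] append_take_drop_id[of n \<sigma>] by metis

lemma measurable_regular: "Measurable.pred \<Omega> regular"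
proof -
  have "Measurable.pred \<Omega> (\<lambda>\<omega>. \<omega> (\<sigma> @ \<tau>) \<longrightarrow> \<omega> \<sigma>)" if "\<sigma> \<in> W" "\<tau> \<in> W" for \<sigma> \<tau>
    using that by (intro pred_intros_logic measurable_config_coordinate) auto
  moreover have "Measurable.pred \<Omega> (\<lambda>\<omega>. convergent (\<lambda>j. decay ^ j * gen_size j (subtree \<sigma> \<omega>)))" if "\<sigma> \<in> W" for \<sigma>
  proof -
    have "(\<lambda>\<omega>. gen_size j (subtree \<sigma> \<omega>)) \<in> borel_measurable \<Omega>" for j
      by (rule measurable_compose[OF measurable_subtree_config[OF that] measurable_gen_size])
    then have "(\<lambda>\<omega>. decay ^ j * gen_size j (subtree \<sigma> \<omega>)) \<in> borel_measurable \<Omega>" for j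
      by (intro borel_measurable_times borel_measurable_const)
    from sets_Collect_Cauchy[OF this] show ?thesis
      by (simp add: pred_def Cauchy_convergent_iff)
  qed
  ultimately show ?thesis
    unfolding regular_def converging_def
    by (intro pred_intros_logic pred_intros_countable_bounded countable_subset[OF subset_UNIV]) auto
qed

lemma AE_regular:
  assumes P: "percolation_measure k m p P" shows "AE \<omega> in P. regular \<omega>"
proof -
  have "AE c in field. \<forall>\<sigma>\<in>W. convergent (\<lambda>j. decay ^ j * gen_size j (subtree \<sigma> (percolate c)))"
  proof (subst AE_ball_countable, simp, intro ballI)
    fix \<sigma> assume \<sigma>: "\<sigma> \<in> W"
    from AE_subtree[OF AE_convergent_normalised_size, of \<sigma>]
    show "AE c in field. convergent (\<lambda>j. decay ^ j * gen_size j (subtree \<sigma> (percolate c)))"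
    proof eventually_elim
      case (elim c)
      show ?case
      proof (cases "percolate c \<sigma>")
        case True
        then show ?thesis using elim by (simp add: subtree_percolate[OF \<sigma>] normalised_size_def)
      next
        case False
        have "gen_size j (subtree \<sigma> (percolate c)) = 0" for j
          unfolding gen_size_eq_0_iff using False percolate_append[OF \<sigma>, of _ c]
          by (auto simp: subtree_apply words_of_length_def)
        then show ?thesis by (simp add: convergent_const)
      qed
    qed
  qed
  moreover have "\<forall>\<sigma>\<in>W. \<forall>\<tau>\<in>W. percolate c (\<sigma> @ \<tau>) \<longrightarrow> percolate c \<sigma>" for c
    by (simp add: percolate_append)
  ultimately have "AE c in field. regular (percolate c)"
    unfolding regular_def converging_def by simp
  moreover have "{\<omega> \<in> space \<Omega>. regular \<omega>} \<in> sets \<Omega>" using measurable_regular by (simp add: pred_def)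
  ultimately show ?thesis
    unfolding percolation_measure_eq_distr[OF P] by (subst AE_distr_iff) auto
qed

lemma mass_eq_0:
  assumes "regular \<omega>" "\<sigma> \<in> W" "\<not> \<omega> \<sigma>" shows "mass (subtree \<sigma> \<omega>) = 0"
proof -
  have "gen_size j (subtree \<sigma> \<omega>) = 0" for j
    unfolding gen_size_eq_0_iff using assms by (auto simp: subtree_apply words_of_length_def regular_def)
  then show ?thesis by (simp add: mass_def Liminf_const)
qed

text \<open>The cylinder of a neglected word has no mass, and there are countably many words.\<close>

lemma AE_code_measure_chosen:
  fixes e :: "nat list \<Rightarrow> nat \<Rightarrow> real ^ 'm"
  assumes m: "m = CARD('m)" and \<omega>: "regular \<omega>"
  shows "AE \<eta> in code_measure k e p \<omega>. \<forall>n. \<omega> (initial_word \<eta> n)"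
proof -
  let ?\<mu> = "code_measure k e p \<omega>"
  have conv: "converging \<omega>" using \<omega> by (simp add: regular_def)
  note sets = sets_code_measure[OF m conv, of e]
  obtain D where D: "\<And>\<sigma>. \<sigma> \<in> W \<Longrightarrow> emeasure ?\<mu> (code_cylinder k m \<sigma>) = ennreal (D * decay ^ length \<sigma>) * mass (subtree \<sigma> \<omega>)"
    using emeasure_code_cylinder[OF m conv, of e] by blast
  \<comment> \<open>Pass to a countable family of null sets, one for each neglected word.\<close>
  have "AE \<eta> in ?\<mu>. \<forall>\<sigma>\<in>{\<sigma>\<in>W. \<not> \<omega> \<sigma>}. \<eta> \<notin> code_cylinder k m \<sigma>"
  proof (subst AE_ball_countable, simp, intro ballI)
    fix \<sigma> assume "\<sigma> \<in> {\<sigma>\<in>W. \<not> \<omega> \<sigma>}"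
    then have "code_cylinder k m \<sigma> \<in> null_sets ?\<mu>"
      using mass_eq_0[OF \<omega>] D sets sets_code_cylinder by (intro null_setsI) auto
    then show "AE \<eta> in ?\<mu>. \<eta> \<notin> code_cylinder k m \<sigma>" by (rule AE_not_in)
  qed
  with AE_space show ?thesis
  proof eventually_elim
    case (elim \<eta>)
    then have \<eta>: "\<eta> \<in> UNIV \<rightarrow>\<^sub>E I" using sets_eq_imp_space_eq[OF sets] by (simp add: space_code_space)
    show ?case
    proof
      fix n
      have "initial_word \<eta> n \<in> W" using initial_word_in_words[OF \<eta>, of n] by (simp add: words_of_length_def)
      moreover have "\<eta> \<in> code_cylinder k m (initial_word \<eta> n)"
        using \<eta> by (simp add: code_cylinder_def space_code_space)
      ultimately show "\<omega> (initial_word \<eta> n)" using elim(2) by blast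
    qed
  qed
qed

text \<open>On words with fewer than \<open>\<epsilon> n\<close> occurrences the damping costs at most the factor \<open>s ^
n\<close> if \<open>2 powr \<epsilon> = s\<close>. The measure of the corresponding codes is therefore bounded by
\<open>s ^ n\<close> times the damped mass, which is summable.\<close>

lemma AE_occurrences_frequent:
  fixes e :: "nat list \<Rightarrow> nat \<Rightarrow> real ^ 'm"
  assumes m: "m = CARD('m)" and A: "block_event l A" and P: "percolation_measure k m p P"
  shows "\<exists>\<epsilon>>0. AE \<omega> in P. AE \<eta> in code_measure k e p \<omega>.
    eventually (\<lambda>n. \<epsilon> * real n \<le> real (occurrences A l [] \<omega> n (initial_word \<eta> (n * l)))) sequentially"
proof -
  obtain s where s: "1 < s" "AE \<omega> in P. (\<Sum>n. ennreal (s ^ n) * damped_mass A l n [] \<omega>) \<noteq> \<infinity>"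
    using AE_damped_mass_summable[OF A P] by auto
  define \<epsilon> where "\<epsilon> = log 2 s"
  have \<epsilon>: "0 < \<epsilon>" using s by (simp add: \<epsilon>_def)
  have "AE \<omega> in P. AE \<eta> in code_measure k e p \<omega>.
    eventually (\<lambda>n. \<epsilon> * real n \<le> real (occurrences A l [] \<omega> n (initial_word \<eta> (n * l)))) sequentially"
    using s(2) AE_regular[OF P]
  proof eventually_elim
    case (elim \<omega>)
    let ?\<mu> = "code_measure k e p \<omega>"
    have conv: "converging \<omega>" using elim by (simp add: regular_def)
    note sets = sets_code_measure[OF m conv, of e]
    have space: "space ?\<mu> = UNIV \<rightarrow>\<^sub>E I"
      using sets_eq_imp_space_eq[OF sets] by (simp add: space_code_space)
    obtain D where D: "0 \<le> D" "\<And>\<sigma>. \<sigma> \<in> W \<Longrightarrow>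
        emeasure ?\<mu> (code_cylinder k m \<sigma>) = ennreal (D * decay ^ length \<sigma>) * mass (subtree \<sigma> \<omega>)"
      using emeasure_code_cylinder[OF m conv, of e] by blast
    define occ where "occ n \<sigma> = occurrences A l [] \<omega> n \<sigma>" for n \<sigma>
    define S where "S n = {\<sigma>\<in>L (n * l). real (occ n \<sigma>) < \<epsilon> * real n}" for n
    define Bad where "Bad n = (\<Union>\<sigma>\<in>S n. code_cylinder k m \<sigma>)" for n
    have SL: "S n \<subseteq> L (n * l)" for n by (auto simp: S_def)
    have finS: "finite (S n)" for n by (rule finite_subset[OF SL]) simp
    have SW: "\<sigma> \<in> W" if "\<sigma> \<in> S n" for \<sigma> n using that by (simp add: S_def words_of_length_def)
    have Bad_sets: "Bad n \<in> sets ?\<mu>" for n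
      unfolding Bad_def sets using finS SW by (intro sets.finite_UN sets_code_cylinder) auto
    have Bad_le: "emeasure ?\<mu> (Bad n) \<le> ennreal D * (ennreal (s ^ n) * damped_mass A l n [] \<omega>)" for n
    proof -
      define f where "f \<sigma> = (if \<omega> \<sigma> then ennreal (decay ^ (n * l) * (1 / 2) ^ occ n \<sigma>) * mass (subtree \<sigma> \<omega>) else 0)" for \<sigma>
      have le: "emeasure ?\<mu> (code_cylinder k m \<sigma>) \<le> ennreal D * (ennreal (s ^ n) * f \<sigma>)" if \<sigma>: "\<sigma> \<in> S n" for \<sigma>
      proof (cases "\<omega> \<sigma>")
        case False
        then show ?thesis using D(2)[OF SW[OF \<sigma>]] mass_eq_0[OF elim(2) SW[OF \<sigma>]] by simp
      next
        case True
        have len: "length \<sigma> = n * l" using \<sigma> by (simp add: S_def words_of_length_def)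
        have "2 ^ occ n \<sigma> = 2 powr real (occ n \<sigma>)" by (simp add: powr_realpow)
        also have "\<dots> \<le> 2 powr (\<epsilon> * real n)" using \<sigma> by (simp add: S_def)
        also have "\<dots> = s ^ n" using s(1) by (simp add: \<epsilon>_def powr_powr[symmetric] powr_realpow)
        finally have "1 \<le> s ^ n * (1 / 2) ^ occ n \<sigma>" by (simp add: power_one_over field_simps)
        then have "decay ^ (n * l) * 1 \<le> decay ^ (n * l) * (s ^ n * (1 / 2) ^ occ n \<sigma>)"
          using decay_pos by (intro mult_left_mono) auto
        then have "D * decay ^ (n * l) \<le> D * (s ^ n * (decay ^ (n * l) * (1 / 2) ^ occ n \<sigma>))"
          using D(1) by (intro mult_left_mono) (simp_all add: mult_ac)
        then have "ennreal (D * decay ^ (n * l)) \<le> ennreal (D * (s ^ n * (decay ^ (n * l) * (1 / 2) ^ occ n \<sigma>)))"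
          by (rule ennreal_leI)
        also have "\<dots> = ennreal D * (ennreal (s ^ n) * ennreal (decay ^ (n * l) * (1 / 2) ^ occ n \<sigma>))"
          using D(1) s(1) decay_pos by (subst ennreal_mult, simp, simp, subst ennreal_mult) auto
        finally have "ennreal (D * decay ^ (n * l)) * mass (subtree \<sigma> \<omega>) \<le>
            ennreal D * (ennreal (s ^ n) * ennreal (decay ^ (n * l) * (1 / 2) ^ occ n \<sigma>)) * mass (subtree \<sigma> \<omega>)"
          by (rule mult_right_mono) simp
        then show ?thesis using D(2)[OF SW[OF \<sigma>]] True by (simp add: len f_def mult.assoc)
      qed
      have "emeasure ?\<mu> (Bad n) \<le> (\<Sum>\<sigma>\<in>S n. emeasure ?\<mu> (code_cylinder k m \<sigma>))"
        unfolding Bad_def using finS SW sets_code_cylinder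
        by (intro emeasure_subadditive_finite) (auto simp: sets)
      also have "\<dots> \<le> (\<Sum>\<sigma>\<in>S n. ennreal D * (ennreal (s ^ n) * f \<sigma>))" by (intro sum_mono le)
      also have "\<dots> \<le> (\<Sum>\<sigma>\<in>L (n * l). ennreal D * (ennreal (s ^ n) * f \<sigma>))"
        by (intro sum_mono2 SL) auto
      also have "\<dots> = ennreal D * (ennreal (s ^ n) * (\<Sum>\<sigma>\<in>L (n * l). f \<sigma>))"
        by (simp only: sum_distrib_left)
      finally show ?thesis by (simp only: f_def damped_mass_def occ_def)
    qed
    have "(\<Sum>n. emeasure ?\<mu> (Bad n)) \<le> (\<Sum>n. ennreal D * (ennreal (s ^ n) * damped_mass A l n [] \<omega>))"
      by (intro suminf_le Bad_le) auto
    also have "\<dots> = ennreal D * (\<Sum>n. ennreal (s ^ n) * damped_mass A l n [] \<omega>)" by simp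
    also have "\<dots> < \<infinity>" using elim(1) by (simp add: ennreal_mult_less_top top.not_eq_extremum)
    finally have fin: "(\<Sum>n. emeasure ?\<mu> (Bad n)) < \<infinity>" .
    have "(\<integral>\<^sup>+\<eta>. (\<Sum>n. indicator (Bad n) \<eta>) \<partial>?\<mu>) = (\<Sum>n. emeasure ?\<mu> (Bad n))"
      using Bad_sets by (subst nn_integral_suminf) auto
    then have "AE \<eta> in ?\<mu>. (\<Sum>n. indicator (Bad n) \<eta> :: ennreal) \<noteq> \<infinity>"
      using fin Bad_sets by (intro nn_integral_noteq_infinite) auto
    with AE_space show ?case
    proof eventually_elim
      case (elim \<eta>)
      have "eventually (\<lambda>n. \<eta> \<notin> Bad n) sequentially"
      proof -
        have "(\<Sum>n. ennreal (indicator (Bad n) \<eta>)) \<noteq> \<top>"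
          using elim(2) by (simp add: ennreal_indicator)
        then have "summable (\<lambda>n. indicator (Bad n) \<eta> :: real)"
          by (intro summable_suminf_not_top) auto
        then have "(\<lambda>n. indicator (Bad n) \<eta> :: real) \<longlonglongrightarrow> 0" by (rule summable_LIMSEQ_zero)
        then have "eventually (\<lambda>n. indicator (Bad n) \<eta> < (1 :: real)) sequentially"
          by (rule order_tendstoD) simp
        then show ?thesis by eventually_elim (auto simp: indicator_def split: if_splits)
      qed
      then show ?case
      proof eventually_elim
        case (elim n)
        have \<eta>: "\<eta> \<in> UNIV \<rightarrow>\<^sub>E I" using \<open>\<eta> \<in> space ?\<mu>\<close> space by simp
        have "initial_word \<eta> (n * l) \<in> L (n * l)" by (rule initial_word_in_words[OF \<eta>])
        moreover have "\<eta> \<in> code_cylinder k m (initial_word \<eta> (n * l))"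
          using \<eta> by (simp add: code_cylinder_def space_code_space)
        ultimately show ?case using elim unfolding Bad_def S_def occ_def by fastforce
      qed
    qed
  qed
  then show ?thesis using \<epsilon> by blast
qed

end


section \<open>Counting scales\<close>

lemma frequent_imp_infinitely_often:
  assumes \<epsilon>: "0 < \<epsilon>" and ev: "eventually (\<lambda>n. \<epsilon> * real n \<le> real (card {i\<in>{1..n}. Q i})) sequentially"
  shows "\<exists>i>n. Q i"
proof (rule ccontr)
  assume "\<not> (\<exists>i>n. Q i)"
  then have "i \<le> n" if "Q i" for i using that by (intro leI) blast
  then have sub: "{i\<in>{1..N}. Q i} \<subseteq> {1..n}" for N by (intro subsetI) simp
  obtain N\<^sub>0 where N0: "\<And>N. N \<ge> N\<^sub>0 \<Longrightarrow> \<epsilon> * real N \<le> real (card {i\<in>{1..N}. Q i})"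
    using ev by (auto simp: eventually_sequentially)
  obtain N\<^sub>1 where N1: "real n / \<epsilon> < real N\<^sub>1" using reals_Archimedean2 by blast
  define N where "N = max N\<^sub>0 N\<^sub>1"
  have "real (card {i\<in>{1..N}. Q i}) \<le> real n" using card_mono[OF _ sub[of N]] by simp
  moreover have "real n < \<epsilon> * real N"
  proof -
    have "real n / \<epsilon> < real N" using N1 by (simp add: N_def)
    then show ?thesis using \<epsilon> by (simp add: divide_less_eq mult.commute)
  qed
  ultimately show False using N0[of N] by (simp add: N_def)
qed

text \<open>Block \<open>i\<close> starts at level \<open>(i - 1) * l\<close>. The first block starts at level zero, which is not
among the scales counted; it accounts for the summand one.\<close>

lemma card_scaled_indices_le:
  fixes l N :: nat and Q H :: "nat \<Rightarrow> bool"
  assumes l: "0 < l" and H: "\<And>i. 1 \<le> i \<Longrightarrow> Q i \<Longrightarrow> H ((i - 1) * l)"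
  shows "card {i\<in>{1..N div l}. Q i} \<le> card {j\<in>{1..N}. H j} + 1"
proof -
  let ?B = "{i\<in>{2..N div l}. Q i}"
  have "card {i\<in>{1..N div l}. Q i} \<le> card (insert 1 ?B)" by (intro card_mono) auto
  also have "\<dots> \<le> card ?B + 1" by (simp add: card_insert_if)
  also have "card ?B \<le> card {j\<in>{1..N}. H j}"
  proof (rule card_inj_on_le)
    show "inj_on (\<lambda>i. (i - 1) * l) ?B" using l by (auto simp: inj_on_def)
    show "(\<lambda>i. (i - 1) * l) ` ?B \<subseteq> {j\<in>{1..N}. H j}"
    proof (rule image_subsetI)
      fix i assume i: "i \<in> ?B"
      then have "1 * 1 \<le> (i - 1) * l" using l by (intro mult_le_mono) auto
      moreover have "(i - 1) * l \<le> (N div l) * l" using i by (intro mult_le_mono) auto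
      moreover have "(N div l) * l \<le> N" by simp
      ultimately have "1 \<le> (i - 1) * l" "(i - 1) * l \<le> N" by linarith+
      then show "(i - 1) * l \<in> {j\<in>{1..N}. H j}" using H[of i] i by simp
    qed
  qed simp
  finally show ?thesis by simp
qed

text \<open>A positive frequency among blocks is a positive frequency among scales, as consecutive blocks start \<open>l\<close>
scales apart. The constant \<open>\<epsilon> / (2 * l)\<close> leaves room for the boundary terms.\<close>

lemma frequency_of_scales:
  fixes l :: nat and Q H :: "nat \<Rightarrow> bool"
  assumes \<epsilon>: "0 < \<epsilon>" and l: "0 < l"
    and ev: "eventually (\<lambda>n. \<epsilon> * real n \<le> real (card {i\<in>{1..n}. Q i})) sequentially"
    and H: "\<And>i. 1 \<le> i \<Longrightarrow> Q i \<Longrightarrow> H ((i - 1) * l)"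
  shows "\<exists>c>0. eventually (\<lambda>N. c \<le> real (card {j\<in>{1..N}. H j}) / real N) sequentially"
proof -
  define c where "c = \<epsilon> / (2 * real l)"
  have c: "0 < c" using \<epsilon> l by (simp add: c_def)
  have "filterlim (\<lambda>N. N div l) at_top sequentially"
    unfolding filterlim_at_top
  proof
    fix Z
    show "eventually (\<lambda>N. Z \<le> N div l) sequentially"
      using eventually_ge_at_top[of "Z * l"]
      by eventually_elim (use l in \<open>simp add: less_eq_div_iff_mult_less_eq\<close>)
  qed
  from eventually_compose_filterlim[OF ev this]
  have ev': "eventually (\<lambda>N. \<epsilon> * real (N div l) \<le> real (card {i\<in>{1..N div l}. Q i})) sequentially" .
  obtain M where M: "(\<epsilon> + 1) / c < real M" using reals_Archimedean2 by blast
  from ev' eventually_ge_at_top[of "max 1 M"]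
  have "eventually (\<lambda>N. c \<le> real (card {j\<in>{1..N}. H j}) / real N) sequentially"
  proof eventually_elim
    case (elim N)
    have N: "0 < real N" "(\<epsilon> + 1) / c < real N" using elim(2) M by auto
    have "real N / real l \<le> real (N div l) + 1"
    proof -
      have "N \<le> (N div l + 1) * l"
        using div_mult_mod_eq[of N l] mod_less_divisor[OF l, of N] unfolding distrib_right by linarith
      then have "real N \<le> real ((N div l + 1) * l)" by (rule of_nat_mono)
      then have "real N \<le> (real (N div l) + 1) * real l" by (simp only: of_nat_mult of_nat_add of_nat_1)
      then show ?thesis using l by (simp add: pos_divide_le_eq)
    qed
    then have "\<epsilon> * (real N / real l) \<le> \<epsilon> * (real (N div l) + 1)" using \<epsilon> by (intro mult_left_mono) auto
    also have "\<epsilon> * (real N / real l) = 2 * (c * real N)" by (simp add: c_def)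
    finally have "2 * (c * real N) \<le> \<epsilon> * real (N div l) + \<epsilon>" by (simp add: distrib_left)
    moreover have "real (card {i\<in>{1..N div l}. Q i}) \<le> real (card {j\<in>{1..N}. H j}) + 1"
      using card_scaled_indices_le[where Q=Q and H=H and N=N, OF l H] by simp
    moreover have "\<epsilon> + 1 < c * real N" using N(2) c by (simp add: pos_divide_less_eq mult.commute)
    ultimately have "c * real N \<le> real (card {j\<in>{1..N}. H j})" using elim(1) by linarith
    then show ?case using N(1) by (simp add: pos_le_divide_eq)
  qed
  then show ?thesis using c by blast
qed


section \<open>Geometry of the coding\<close>

lemma infnorm_less_iff_cart: "infnorm (x :: real ^ 'm) < r \<longleftrightarrow> (\<forall>i. \<bar>x $ i\<bar> < r)"
proof -
  have "infnorm x < r \<longleftrightarrow> (\<forall>b\<in>Basis. \<bar>x \<bullet> b\<bar> < r)"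
    unfolding infnorm_Max by (subst Max_less_iff) auto
  then show ?thesis by (simp add: Basis_vec_def inner_axis)
qed

lemma mem_max_ball: "y \<in> max_ball z r \<longleftrightarrow> (\<forall>i. \<bar>z $ i - y $ i\<bar> < r)"
  by (simp add: max_ball_def infnorm_less_iff_cart)

lemma cube_nest_point:
  assumes "\<And>n. C n \<noteq> {}" "\<And>n. compact (C n)" "\<And>n. C (Suc n) \<subseteq> C n"
  shows "\<exists>x :: real ^ 'm. \<forall>n. x \<in> C n"
proof -
  have "decseq C" using assms(3) by (rule decseq_SucI)
  then have "(\<Inter>n. C n) \<noteq> {}"
    using compact_nest[of C] assms(1,2) by (auto simp: decseq_def)
  then show ?thesis by blast
qed

locale fractal_percolation = supercritical k "CARD('m)" p
  for k :: nat and p :: real and e :: "nat list \<Rightarrow> nat \<Rightarrow> real ^ 'm" +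
  assumes enumeration: "subcube_enumeration k e"
begin

definition side :: "nat \<Rightarrow> real" where "side n = 1 / real k ^ n"

definition open_cube :: "nat list \<Rightarrow> (real ^ 'm) set" where
  "open_cube \<sigma> = {y. \<forall>i. corner k e \<sigma> $ i < y $ i \<and> y $ i < corner k e \<sigma> $ i + side (length \<sigma>)}"

definition letter :: "nat list \<Rightarrow> real ^ 'm \<Rightarrow> nat" where
  "letter \<sigma> v = inv_into I (e \<sigma>) v"

lemma side_pos: "0 < side n" using k_ge_2 by (simp add: side_def)
lemma side_Suc: "side (Suc n) * real k = side n" using k_ge_2 by (simp add: side_def)
lemma side_add: "side (a + b) = side a * side b" by (simp add: side_def power_add)

lemma side_tendsto_0: "side \<longlonglongrightarrow> 0"
proof -
  have "(\<lambda>n. (1 / real k) ^ n) \<longlonglongrightarrow> 0" using k_ge_2 by (intro LIMSEQ_realpow_zero) auto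
  then show ?thesis by (simp add: side_def[abs_def] power_one_over)
qed

lemma mem_cube: "y \<in> cube k e \<sigma> \<longleftrightarrow>
    (\<forall>i. corner k e \<sigma> $ i \<le> y $ i \<and> y $ i \<le> corner k e \<sigma> $ i + side (length \<sigma>))"
  by (simp add: cube_def mem_box_cart side_def)

lemma open_cube_subset_cube: "open_cube \<sigma> \<subseteq> cube k e \<sigma>"
  unfolding open_cube_def mem_cube subset_iff mem_Collect_eq by (simp add: less_imp_le)

lemma open_open_cube: "open (open_cube \<sigma>)"
proof -
  have "open_cube \<sigma> = box (corner k e \<sigma>) (corner k e \<sigma> + (\<chi> i. side (length \<sigma>)))"
    unfolding open_cube_def set_eq_iff mem_box_cart by simp
  then show ?thesis by (simp add: open_box)
qed

lemma digit_bij: "\<sigma> \<in> W \<Longrightarrow> bij_betw (e \<sigma>) I (digits k)"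
  using enumeration by (simp add: subcube_enumeration_def)

lemma digit_cases:
  assumes "\<sigma> \<in> W" "j \<in> I"
  obtains d where "d < k" "e \<sigma> j $ i = real d"
proof -
  have "e \<sigma> j \<in> digits k" using digit_bij[OF assms(1)] assms(2) by (rule bij_betwE[rule_format])
  then show ?thesis using that by (auto simp: digits_def)
qed

lemma letter: "\<sigma> \<in> W \<Longrightarrow> v \<in> digits k \<Longrightarrow> letter \<sigma> v \<in> I \<and> e \<sigma> (letter \<sigma> v) = v"
proof -
  assume a: "\<sigma> \<in> W" "v \<in> digits k"
  then have "v \<in> e \<sigma> ` I" using digit_bij[of \<sigma>] by (simp add: bij_betw_def)
  from inv_into_into[OF this] f_inv_into_f[OF this]
  show ?thesis unfolding letter_def by (rule conjI)
qed

lemma corner_snoc: "corner k e (\<sigma> @ [j]) $ i = corner k e \<sigma> $ i + side (Suc (length \<sigma>)) * e \<sigma> j $ i"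
proof -
  have "corner k e (\<sigma> @ [j]) = corner k e \<sigma> + side (Suc (length \<sigma>)) *\<^sub>R e \<sigma> j"
    by (simp add: corner_def side_def nth_append)
  then show ?thesis by simp
qed

lemma corner_Nil: "corner k e [] $ i = 0" by (simp add: corner_def)

lemma digit_side_bounds:
  assumes "\<sigma> \<in> W" "j \<in> I"
  shows "0 \<le> side (Suc n) * e \<sigma> j $ i" "side (Suc n) * e \<sigma> j $ i + side (Suc n) \<le> side n"
proof -
  obtain d where d: "d < k" "e \<sigma> j $ i = real d" using digit_cases[OF assms] .
  show "0 \<le> side (Suc n) * e \<sigma> j $ i" using d side_pos[of "Suc n"] by simp
  have "side (Suc n) * (real d + 1) \<le> side (Suc n) * real k"
    using d side_pos[of "Suc n"] by (intro mult_left_mono) auto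
  then show "side (Suc n) * e \<sigma> j $ i + side (Suc n) \<le> side n"
    using d side_Suc[of n] by (simp add: distrib_left)
qed

lemma cube_snoc_subset:
  assumes "\<sigma> \<in> W" "j \<in> I" shows "cube k e (\<sigma> @ [j]) \<subseteq> cube k e \<sigma>"
proof
  fix y assume y: "y \<in> cube k e (\<sigma> @ [j])"
  show "y \<in> cube k e \<sigma>"
    unfolding mem_cube
  proof
    fix i
    show "corner k e \<sigma> $ i \<le> y $ i \<and> y $ i \<le> corner k e \<sigma> $ i + side (length \<sigma>)"
      using y[unfolded mem_cube, rule_format, of i] digit_side_bounds[OF assms, of "length \<sigma>" i]
      by (simp add: corner_snoc)
  qed
qed

lemma open_cube_snoc_subset:
  assumes "\<sigma> \<in> W" "j \<in> I" shows "open_cube (\<sigma> @ [j]) \<subseteq> open_cube \<sigma>"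
proof
  fix y assume y: "y \<in> open_cube (\<sigma> @ [j])"
  show "y \<in> open_cube \<sigma>"
    unfolding open_cube_def mem_Collect_eq
  proof
    fix i
    show "corner k e \<sigma> $ i < y $ i \<and> y $ i < corner k e \<sigma> $ i + side (length \<sigma>)"
      using y[unfolded open_cube_def mem_Collect_eq, rule_format, of i] digit_side_bounds[OF assms, of "length \<sigma>" i]
      by (simp add: corner_snoc)
  qed
qed

lemma cube_append_subset: "\<tau> \<in> W \<Longrightarrow> \<sigma> \<in> W \<Longrightarrow> cube k e (\<sigma> @ \<tau>) \<subseteq> cube k e \<sigma>"
proof (induction \<tau> rule: rev_induct)
  case (snoc j \<tau>)
  then have "cube k e ((\<sigma> @ \<tau>) @ [j]) \<subseteq> cube k e (\<sigma> @ \<tau>)" by (intro cube_snoc_subset) auto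
  then show ?case using snoc by auto
qed simp

lemma open_cube_append_subset: "\<tau> \<in> W \<Longrightarrow> \<sigma> \<in> W \<Longrightarrow> open_cube (\<sigma> @ \<tau>) \<subseteq> open_cube \<sigma>"
proof (induction \<tau> rule: rev_induct)
  case (snoc j \<tau>)
  then have "open_cube ((\<sigma> @ \<tau>) @ [j]) \<subseteq> open_cube (\<sigma> @ \<tau>)" by (intro open_cube_snoc_subset) auto
  then show ?case using snoc by auto
qed simp

lemma cube_take_subset: "\<sigma> \<in> W \<Longrightarrow> cube k e \<sigma> \<subseteq> cube k e (take n \<sigma>)"
  using cube_append_subset[of "drop n \<sigma>" "take n \<sigma>"] by simp

lemma cube_cover_snoc:
  assumes \<sigma>: "\<sigma> \<in> W" and y: "y \<in> cube k e \<sigma>"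
  shows "\<exists>j\<in>I. y \<in> cube k e (\<sigma> @ [j])"
proof -
  define s where "s = side (Suc (length \<sigma>))"
  define t where "t i = (y $ i - corner k e \<sigma> $ i) / s" for i
  \<comment> \<open>The minimum puts the points of an upper face, where \<open>t i = k\<close>, into the last subcube.\<close>
  define d where "d i = min (nat \<lfloor>t i\<rfloor>) (k - 1)" for i
  have s: "0 < s" by (simp add: s_def side_pos)
  have t: "0 \<le> t i" "t i \<le> real k" for i
    using y[unfolded mem_cube, rule_format, of i] s side_Suc[of "length \<sigma>"]
    by (auto simp: t_def s_def[symmetric] pos_divide_le_eq mult.commute)
  have d: "real (d i) \<le> t i" "t i \<le> real (d i) + 1" "d i < k" for i
  proof -
    have fl: "real (nat \<lfloor>t i\<rfloor>) \<le> t i" "t i < real (nat \<lfloor>t i\<rfloor>) + 1"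
      using t(1)[of i] by (auto simp: of_nat_nat)
    show "real (d i) \<le> t i" unfolding d_def using fl by linarith
    show "d i < k" using k_ge_2 by (simp add: d_def)
    show "t i \<le> real (d i) + 1"
    proof (cases "nat \<lfloor>t i\<rfloor> \<le> k - 1")
      case True then show ?thesis using fl by (simp add: d_def)
    next
      case False then have "d i = k - 1" by (simp add: d_def)
      then show ?thesis using t(2)[of i] k_ge_2 by simp
    qed
  qed
  define v :: "real ^ 'm" where "v = (\<chi> i. real (d i))"
  have v: "v \<in> digits k" using d(3) by (simp add: digits_def v_def)
  define j where "j = letter \<sigma> v"
  have j: "j \<in> I" "e \<sigma> j = v" using letter[OF \<sigma> v] by (simp_all add: j_def)
  have "y \<in> cube k e (\<sigma> @ [j])"
    unfolding mem_cube
  proof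
    fix i
    have "y $ i = corner k e \<sigma> $ i + s * t i" using s by (simp add: t_def)
    moreover have "s * real (d i) \<le> s * t i" "s * t i \<le> s * (real (d i) + 1)"
      using d(1,2)[of i] s by (auto intro!: mult_left_mono)
    ultimately show "corner k e (\<sigma> @ [j]) $ i \<le> y $ i \<and>
        y $ i \<le> corner k e (\<sigma> @ [j]) $ i + side (length (\<sigma> @ [j]))"
      by (simp add: corner_snoc j v_def s_def[symmetric] distrib_left)
  qed
  then show ?thesis using j by blast
qed

lemma cube_cover:
  assumes \<sigma>: "\<sigma> \<in> W" and y: "y \<in> cube k e \<sigma>"
  shows "\<exists>\<tau>\<in>L l. y \<in> cube k e (\<sigma> @ \<tau>)"
proof (induction l)
  case 0 then show ?case using y by (simp add: words_of_length_0)
next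
  case (Suc l)
  then obtain \<tau> where \<tau>: "\<tau> \<in> L l" "y \<in> cube k e (\<sigma> @ \<tau>)" by blast
  then have "\<sigma> @ \<tau> \<in> W" using \<sigma> by (simp add: words_of_length_def)
  from cube_cover_snoc[OF this \<tau>(2)] obtain j where "j \<in> I" "y \<in> cube k e (\<sigma> @ (\<tau> @ [j]))" by auto
  moreover from this have "\<tau> @ [j] \<in> L (Suc l)" using \<tau> by (simp add: words_of_length_def)
  ultimately show ?case by blast
qed

text \<open>An interior point of a cube lies in no other closed cube of the same generation: its digits are determined one
generation after the other.\<close>

lemma open_cube_unique:
  assumes "\<sigma> \<in> W" "\<sigma>' \<in> W" "length \<sigma> = length \<sigma>'" "y \<in> open_cube \<sigma>" "y \<in> cube k e \<sigma>'"
  shows "\<sigma> = \<sigma>'"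
  using assms
proof (induction \<sigma> arbitrary: \<sigma>' rule: rev_induct)
  case (snoc j \<sigma>)
  then obtain \<sigma>'' j' where s': "\<sigma>' = \<sigma>'' @ [j']" by (cases \<sigma>' rule: rev_cases) auto
  have w: "\<sigma> \<in> W" "j \<in> I" "\<sigma>'' \<in> W" "j' \<in> I" "length \<sigma> = length \<sigma>''" using snoc.prems s' by auto
  have "y \<in> open_cube \<sigma>" "y \<in> cube k e \<sigma>''"
    using snoc.prems open_cube_snoc_subset[OF w(1,2)] cube_snoc_subset[OF w(3,4)] s' by auto
  then have eq: "\<sigma> = \<sigma>''" using snoc.IH w by blast
  have "e \<sigma> j = e \<sigma> j'"
  proof (rule vec_eq_iff[THEN iffD2, rule_format])
    fix i
    define s where "s = side (Suc (length \<sigma>))"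
    define t where "t = (y $ i - corner k e \<sigma> $ i) / s"
    have s: "0 < s" by (simp add: s_def side_pos)
    have y: "y $ i = corner k e \<sigma> $ i + s * t" using s by (simp add: t_def)
    obtain d where d: "e \<sigma> j $ i = real d" using digit_cases[OF w(1,2)] by blast
    obtain d' where d': "e \<sigma> j' $ i = real d'" using digit_cases[OF w(1,4)] by blast
    have "s * real d < s * t" "s * t < s * (real d + 1)"
      using snoc.prems(4)[unfolded open_cube_def mem_Collect_eq, rule_format, of i]
      by (simp_all add: corner_snoc y d s_def distrib_left)
    moreover have "s * real d' \<le> s * t" "s * t \<le> s * (real d' + 1)"
      using snoc.prems(5)[unfolded s' mem_cube, rule_format, of i]
      by (simp_all add: corner_snoc y d' s_def distrib_left flip: eq)
    ultimately have "real d < t" "t < real d + 1" "real d' \<le> t" "t \<le> real d' + 1"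
      using s by (simp_all only: mult_less_cancel_left_pos mult_le_cancel_left_pos)
    then have "d = d'" by linarith
    then show "e \<sigma> j $ i = e \<sigma> j' $ i" by (simp add: d d')
  qed
  then have "j = j'"
    using inj_onD[OF bij_betw_imp_inj_on[OF digit_bij[OF w(1)]]] w(2,4) by blast
  then show ?case using eq s' by simp
qed simp

lemma corner_scaled_integer: "\<sigma> \<in> W \<Longrightarrow> \<exists>a::int. real k ^ length \<sigma> * corner k e \<sigma> $ i = of_int a"
proof (induction \<sigma> rule: rev_induct)
  case Nil show ?case by (intro exI[of _ 0]) (simp add: corner_Nil)
next
  case (snoc j \<sigma>)
  then obtain a where a: "real k ^ length \<sigma> * corner k e \<sigma> $ i = of_int a" by auto
  obtain d where d: "e \<sigma> j $ i = real d" using digit_cases[of \<sigma> j] snoc.prems by auto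
  have "real k ^ Suc (length \<sigma>) * corner k e (\<sigma> @ [j]) $ i =
      real k * (real k ^ length \<sigma> * corner k e \<sigma> $ i) + real d"
    using k_ge_2 by (simp add: corner_snoc d side_def field_simps)
  also have "\<dots> = of_int (int k * a + int d)" by (simp add: a)
  finally show ?case by (intro exI[of _ "int k * a + int d"]) simp
qed

text \<open>Corners of cubes of generation \<open>n\<close> are integer vectors divided by \<open>k ^ n\<close>, so for an
interior point the integer parts that define the half-open cube are those of the corner.\<close>

lemma kadic_cube_at_eq:
  assumes \<sigma>: "\<sigma> \<in> W" and x: "x \<in> open_cube \<sigma>"
  shows "kadic_cube_at k (length \<sigma>) x =
    {y. \<forall>i. corner k e \<sigma> $ i \<le> y $ i \<and> y $ i < corner k e \<sigma> $ i + side (length \<sigma>)}"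
proof -
  define n where "n = length \<sigma>"
  have K: "0 < real k ^ n" using k_ge_2 by simp
  have fl: "of_int \<lfloor>real k ^ n * x $ i\<rfloor> = real k ^ n * corner k e \<sigma> $ i" for i
  proof -
    obtain a where a: "real k ^ n * corner k e \<sigma> $ i = of_int a"
      using corner_scaled_integer[OF \<sigma>, of i] by (auto simp: n_def)
    have "real k ^ n * corner k e \<sigma> $ i < real k ^ n * x $ i"
      "real k ^ n * x $ i < real k ^ n * (corner k e \<sigma> $ i + side n)"
      using x[unfolded open_cube_def mem_Collect_eq, rule_format, of i] K
      by (simp_all add: n_def)
    moreover have "real k ^ n * (corner k e \<sigma> $ i + side n) = of_int a + 1"
      using K a by (simp add: distrib_left side_def)
    ultimately have "\<lfloor>real k ^ n * x $ i\<rfloor> = a"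
      unfolding a by (intro floor_unique) auto
    then show ?thesis by (simp add: a)
  qed
  have "kadic_cube_at k n x = {y. \<forall>i. corner k e \<sigma> $ i \<le> y $ i \<and> y $ i < corner k e \<sigma> $ i + side n}"
    unfolding kadic_cube_at_def kadic_cube_def using K
    by (simp add: fl side_def add_divide_distrib)
  then show ?thesis by (simp add: n_def)
qed

lemma corner_in_cube: "corner k e \<sigma> \<in> cube k e \<sigma>"
  unfolding mem_cube using side_pos[of "length \<sigma>"] by simp

lemma compact_cube: "compact (cube k e \<sigma>)" by (simp add: cube_def compact_cbox)

lemma cube_diff_le: "x \<in> cube k e \<sigma> \<Longrightarrow> y \<in> cube k e \<sigma> \<Longrightarrow> \<bar>x $ i - y $ i\<bar> \<le> side (length \<sigma>)"
  unfolding mem_cube by (drule spec[of _ i], drule spec[of _ i]) linarith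

lemma coded_point_in_cube:
  assumes \<eta>: "\<eta> \<in> UNIV \<rightarrow>\<^sub>E I"
  shows "coded_point k e \<eta> \<in> cube k e (initial_word \<eta> n)"
proof -
  have w: "initial_word \<eta> n \<in> W" for n
    using initial_word_in_words[OF \<eta>, of n] by (simp add: words_of_length_def)
  have "cube k e (initial_word \<eta> (Suc n)) \<subseteq> cube k e (initial_word \<eta> n)" for n
    unfolding initial_word_Suc using w[of "Suc n"] w[of n] by (intro cube_snoc_subset) (auto simp: initial_word_Suc)
  then obtain x where x: "\<And>n. x \<in> cube k e (initial_word \<eta> n)"
    using cube_nest_point[of "\<lambda>n. cube k e (initial_word \<eta> n)"] corner_in_cube compact_cube by blast
  have "coded_point k e \<eta> = x"
    unfolding coded_point_def
  proof (rule the_equality)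
    show "x \<in> (\<Inter>i. cube k e (initial_word \<eta> i))" using x by blast
    fix y assume "y \<in> (\<Inter>i. cube k e (initial_word \<eta> i))"
    then have y: "y \<in> cube k e (initial_word \<eta> n)" for n by blast
    show "y = x"
    proof (rule vec_eq_iff[THEN iffD2, rule_format])
      fix i
      have "\<bar>y $ i - x $ i\<bar> \<le> 0"
        by (rule LIMSEQ_le_const[OF side_tendsto_0]) (use cube_diff_le[OF y x] in auto)
      then show "y $ i = x $ i" by simp
    qed
  qed
  then show ?thesis using x by simp
qed

lemma coded_point_LIMSEQ:
  assumes \<eta>: "\<eta> \<in> UNIV \<rightarrow>\<^sub>E I"
  shows "(\<lambda>n. corner k e (initial_word \<eta> n)) \<longlonglongrightarrow> coded_point k e \<eta>"
proof (rule vec_tendstoI)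
  fix i
  show "(\<lambda>n. corner k e (initial_word \<eta> n) $ i) \<longlonglongrightarrow> coded_point k e \<eta> $ i"
  proof (rule LIM_zero_cancel, rule Lim_null_comparison)
    show "eventually (\<lambda>n. norm (corner k e (initial_word \<eta> n) $ i - coded_point k e \<eta> $ i) \<le> side n) sequentially"
      using cube_diff_le[OF corner_in_cube coded_point_in_cube[OF \<eta>]] by (intro always_eventually allI) simp
    show "side \<longlonglongrightarrow> 0" by (rule side_tendsto_0)
  qed
qed

lemma measurable_coded_point: "coded_point k e \<in> borel_measurable (code_space k CARD('m))"
proof (rule borel_measurable_LIMSEQ_metric)
  show "(\<lambda>\<eta>. corner k e (initial_word \<eta> n)) \<in> borel_measurable (code_space k CARD('m))" for n
    by (rule measurable_compose[OF measurable_initial_word]) simp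
  show "(\<lambda>n. corner k e (initial_word \<eta> n)) \<longlonglongrightarrow> coded_point k e \<eta>" if "\<eta> \<in> space (code_space k CARD('m))" for \<eta>
    using that by (intro coded_point_LIMSEQ) (simp add: space_code_space)
qed

text \<open>A digit \<open>k - 1\<close> at a later level moves the point strictly away from the lower faces of a cube, and a
digit \<open>0\<close> strictly away from the upper faces.\<close>

lemma coded_point_in_open_cube:
  assumes \<eta>: "\<eta> \<in> UNIV \<rightarrow>\<^sub>E I"
    and low: "\<And>n. \<exists>N\<ge>n. e (initial_word \<eta> N) (\<eta> N) = 0"
    and high: "\<And>n. \<exists>N\<ge>n. e (initial_word \<eta> N) (\<eta> N) = (\<chi> i. real (k - 1))"
  shows "coded_point k e \<eta> \<in> open_cube (initial_word \<eta> n)"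
  unfolding open_cube_def mem_Collect_eq
proof (intro allI conjI)
  fix i
  let ?x = "coded_point k e \<eta>"
  have w: "initial_word \<eta> N \<in> W" for N
    using initial_word_in_words[OF \<eta>, of N] by (simp add: words_of_length_def)
  have nest: "corner k e (initial_word \<eta> n) $ i \<le> corner k e (initial_word \<eta> N) $ i"
    "corner k e (initial_word \<eta> N) $ i + side N \<le> corner k e (initial_word \<eta> n) $ i + side n" if "n \<le> N" for N
  proof -
    have sub: "cube k e (initial_word \<eta> N) \<subseteq> cube k e (initial_word \<eta> n)"
      using cube_take_subset[OF w, of N n] by (simp add: take_initial_word that)
    have "corner k e (initial_word \<eta> N) \<in> cube k e (initial_word \<eta> n)"
      using sub corner_in_cube by blast
    then show "corner k e (initial_word \<eta> n) $ i \<le> corner k e (initial_word \<eta> N) $ i"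
      by (simp add: mem_cube)
    have "corner k e (initial_word \<eta> N) + (\<chi> i. side N) \<in> cube k e (initial_word \<eta> N)"
      unfolding mem_cube using side_pos[of N] by simp
    then have "corner k e (initial_word \<eta> N) + (\<chi> i. side N) \<in> cube k e (initial_word \<eta> n)"
      using sub by blast
    then show "corner k e (initial_word \<eta> N) $ i + side N \<le> corner k e (initial_word \<eta> n) $ i + side n"
      by (simp add: mem_cube)
  qed
  have kid: "corner k e (initial_word \<eta> (Suc N)) $ i \<le> ?x $ i"
      "?x $ i \<le> corner k e (initial_word \<eta> (Suc N)) $ i + side (Suc N)" for N
    using coded_point_in_cube[OF \<eta>, of "Suc N"] by (simp_all add: mem_cube)
  have less: "side (Suc N) < side N" for N
  proof -
    have "side (Suc N) * 1 < side (Suc N) * real k"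
      using k_ge_2 side_pos[of "Suc N"] by (intro mult_strict_left_mono) auto
    then show ?thesis by (simp add: side_Suc)
  qed
  obtain N where N: "n \<le> N" "e (initial_word \<eta> N) (\<eta> N) = (\<chi> i. real (k - 1))" using high by blast
  have "0 < side (Suc N) * real (k - 1)" using k_ge_2 side_pos[of "Suc N"] by simp
  moreover have "corner k e (initial_word \<eta> (Suc N)) $ i = corner k e (initial_word \<eta> N) $ i + side (Suc N) * real (k - 1)"
    by (simp only: initial_word_Suc corner_snoc length_initial_word N(2) vec_lambda_beta)
  ultimately show "corner k e (initial_word \<eta> n) $ i < ?x $ i"
    using kid(1)[of N] nest(1)[OF N(1)] by linarith
  obtain M where M: "n \<le> M" "e (initial_word \<eta> M) (\<eta> M) = 0" using low by blast
  show "?x $ i < corner k e (initial_word \<eta> n) $ i + side (length (initial_word \<eta> n))"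
    using kid(2)[of M] nest(2)[OF M(1)] M(2) less[of M] by (simp add: initial_word_Suc corner_snoc)
qed

abbreviation "K \<omega> \<equiv> limit_set k e \<omega>"

lemma mem_limit_set: "x \<in> K \<omega> \<longleftrightarrow> (\<forall>n. \<exists>\<sigma>\<in>L n. \<omega> \<sigma> \<and> x \<in> cube k e \<sigma>)"
  unfolding limit_set_def words_of_length_def by blast

text \<open>Compactness: the chosen descendants of generation \<open>n\<close> form decreasing non-empty compact sets.\<close>

lemma limit_set_meets_cube:
  assumes \<omega>: "regular \<omega>" and \<sigma>: "\<sigma> \<in> W" and surv: "survives k CARD('m) (subtree \<sigma> \<omega>)"
  shows "\<exists>y\<in>cube k e \<sigma>. y \<in> K \<omega>"
proof -
  define C where "C n = (\<Union>\<tau>\<in>{\<tau>\<in>L n. \<omega> (\<sigma> @ \<tau>)}. cube k e (\<sigma> @ \<tau>))" for n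
  have ne: "C n \<noteq> {}" for n
  proof -
    obtain \<tau> where "\<tau> \<in> L n" "\<omega> (\<sigma> @ \<tau>)" using surv by (auto simp: survives_def subtree_apply)
    then show ?thesis using corner_in_cube unfolding C_def by blast
  qed
  have comp: "compact (C n)" for n
    unfolding C_def by (intro compact_UN compact_cube finite_subset[OF _ finite_words_of_length]) auto
  have sub: "C (Suc n) \<subseteq> C n" for n
  proof
    fix y assume "y \<in> C (Suc n)"
    then obtain \<tau> where \<tau>: "\<tau> \<in> L (Suc n)" "\<omega> (\<sigma> @ \<tau>)" "y \<in> cube k e (\<sigma> @ \<tau>)" by (auto simp: C_def)
    have t: "\<sigma> @ \<tau> \<in> W" "length \<tau> = Suc n" using \<tau>(1) \<sigma> by (auto simp: words_of_length_def)
    have tk: "take (length \<sigma> + n) (\<sigma> @ \<tau>) = \<sigma> @ take n \<tau>" by simp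
    have "\<omega> (\<sigma> @ take n \<tau>)" using regular_take[OF \<omega> t(1) \<tau>(2), of "length \<sigma> + n"] by (simp only: tk)
    moreover have "y \<in> cube k e (\<sigma> @ take n \<tau>)"
      using cube_take_subset[OF t(1), of "length \<sigma> + n"] \<tau>(3) unfolding tk by blast
    moreover have "take n \<tau> \<in> L n" using \<tau>(1) by (auto simp: words_of_length_def)
    ultimately show "y \<in> C n" unfolding C_def by blast
  qed
  obtain y where y: "\<And>n. y \<in> C n" using cube_nest_point[of C, OF ne comp sub] by blast
  have y': "\<exists>\<tau>\<in>L n. \<omega> (\<sigma> @ \<tau>) \<and> y \<in> cube k e (\<sigma> @ \<tau>)" for n using y[of n] by (auto simp: C_def)
  have y0: "\<omega> \<sigma>" "y \<in> cube k e \<sigma>" using y'[of 0] by (simp_all add: words_of_length_0)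
  have "y \<in> K \<omega>"
    unfolding mem_limit_set
  proof
    fix n
    show "\<exists>\<rho>\<in>L n. \<omega> \<rho> \<and> y \<in> cube k e \<rho>"
    proof (cases "n \<le> length \<sigma>")
      case True
      have "take n \<sigma> \<in> L n" using True \<sigma> by (auto simp: words_of_length_def)
      moreover have "\<omega> (take n \<sigma>)" using regular_take[OF \<omega> \<sigma> y0(1)] .
      moreover have "y \<in> cube k e (take n \<sigma>)" using cube_take_subset[OF \<sigma>] y0(2) by blast
      ultimately show ?thesis by blast
    next
      case False
      obtain \<tau> where "\<tau> \<in> L (n - length \<sigma>)" "\<omega> (\<sigma> @ \<tau>)" "y \<in> cube k e (\<sigma> @ \<tau>)"
        using y'[of "n - length \<sigma>"] by blast
      moreover from this have "\<sigma> @ \<tau> \<in> L n" using False \<sigma> by (simp add: words_of_length_def)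
      ultimately show ?thesis by blast
    qed
  qed
  then show ?thesis using y0 by blast
qed


section \<open>Three kinds of block events\<close>

text \<open>The block of \<open>l\<close> letters after \<open>\<sigma>\<close> that leads into the lower corner of its cube.\<close>

primrec zeros :: "nat list \<Rightarrow> nat \<Rightarrow> nat list" where
  "zeros \<sigma> 0 = []"
| "zeros \<sigma> (Suc l) = zeros \<sigma> l @ [letter (\<sigma> @ zeros \<sigma> l) 0]"

lemma zero_digit: "0 \<in> digits k"
  using k_ge_2 by (auto simp: digits_def intro!: image_eqI[of _ _ 0])

lemma top_digit: "(\<chi> i. real (k - 1)) \<in> digits k"
  using k_ge_2 by (auto simp: digits_def intro!: image_eqI[of _ _ "k - 1"])

lemma zeros_in: "\<sigma> \<in> W \<Longrightarrow> zeros \<sigma> l \<in> L l"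
proof (induction l)
  case (Suc l)
  then have "\<sigma> @ zeros \<sigma> l \<in> W" by (simp add: words_of_length_def)
  from letter[OF this zero_digit] Suc show ?case by (simp add: words_of_length_def)
qed (simp add: words_of_length_def)

lemma corner_zeros: "\<sigma> \<in> W \<Longrightarrow> corner k e (\<sigma> @ zeros \<sigma> l) $ i = corner k e \<sigma> $ i"
proof (induction l)
  case (Suc l)
  then have "\<sigma> @ zeros \<sigma> l \<in> W" using zeros_in[of \<sigma> l] by (simp add: words_of_length_def)
  from letter[OF this zero_digit] Suc show ?case
    using corner_snoc[of "\<sigma> @ zeros \<sigma> l" "letter (\<sigma> @ zeros \<sigma> l) 0" i] by simp
qed simp

definition corner_block :: "nat \<Rightarrow> nat list \<Rightarrow> (nat list \<Rightarrow> bool) \<Rightarrow> nat list \<Rightarrow> bool" where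
  "corner_block l \<sigma> \<omega> \<tau> \<longleftrightarrow> \<tau> = zeros \<sigma> l \<and> (\<forall>\<rho>\<in>L l. \<omega> \<rho> \<longrightarrow> \<rho> = \<tau>)"

text \<open>Survival is required of all descendants but the one that continues the code: whether \<open>\<tau>\<close> survives
would depend on marks strictly below it. That cube meets the limit set in the coded point anyway.\<close>

definition full_block :: "nat \<Rightarrow> nat list \<Rightarrow> (nat list \<Rightarrow> bool) \<Rightarrow> nat list \<Rightarrow> bool" where
  "full_block l \<sigma> \<omega> \<tau> \<longleftrightarrow> (\<forall>\<rho>\<in>L l. \<omega> \<rho> \<and> (\<rho> \<noteq> \<tau> \<longrightarrow> survives k CARD('m) (subtree \<rho> \<omega>)))"

definition digit_block :: "real ^ 'm \<Rightarrow> nat list \<Rightarrow> (nat list \<Rightarrow> bool) \<Rightarrow> nat list \<Rightarrow> bool" where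
  "digit_block v \<sigma> \<omega> \<tau> \<longleftrightarrow> \<tau> = [letter \<sigma> v]"

lemma measurable_word: "\<tau> \<in> L l \<Longrightarrow> Measurable.pred \<Omega> (\<lambda>\<omega>. \<omega> \<tau>)"
  by (rule measurable_config_coordinate) (simp add: words_of_length_def)

lemma sets_open_and:
  assumes "\<tau> \<in> L l" "Measurable.pred \<Omega> (\<lambda>\<omega>. A \<sigma> \<omega> \<tau>)"
  shows "{c. percolate c \<tau> \<and> A \<sigma> (percolate c) \<tau>} \<in> sets field"
proof -
  have "Measurable.pred \<Omega> (\<lambda>\<omega>. \<omega> \<tau> \<and> A \<sigma> \<omega> \<tau>)"
    using measurable_word[OF assms(1)] assms(2) by (rule pred_intros_logic)
  from measurable_compose[OF measurable_percolate this] show ?thesis by (simp add: pred_def)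
qed

lemma not_strict_prefix_length: "length \<rho> \<le> length \<tau> \<Longrightarrow> \<rho> \<in> - {\<rho>. strict_prefix \<tau> \<rho>}"
  using prefix_length_less[of \<tau> \<rho>] by auto

lemma prob_bernoulli_ge:
  assumes "finite D"
  shows "min p (1 - p) ^ card D \<le> F.prob {c. \<forall>\<tau>\<in>D. c \<tau> = s \<tau>}"
proof -
  have "min p (1 - p) ^ card D = (\<Prod>\<tau>\<in>D. min p (1 - p))" by simp
  also have "\<dots> \<le> (\<Prod>\<tau>\<in>D. measure (bernoulli_pmf p) {s \<tau>})"
  proof (rule prod_mono)
    fix \<tau> show "0 \<le> min p (1 - p) \<and> min p (1 - p) \<le> measure (bernoulli_pmf p) {s \<tau>}"
      using p_pos p_le_1 by (cases "s \<tau>") (simp_all add: measure_pmf_single)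
  qed
  also have "\<dots> = F.prob {c. \<forall>\<tau>\<in>D. c \<tau> \<in> {s \<tau>}}" by (rule prob_finite_box[OF assms, symmetric])
  finally show ?thesis by simp
qed

text \<open>Prescribing the marks of all words of length at most \<open>l\<close>, open exactly along the block, realises the
event. The probability of a pattern is at least \<open>min p (1 - p)\<close> to the number of marks.\<close>

lemma block_event_corner_block:
  assumes l: "0 < l" and p1: "p < 1"
  shows "block_event l (corner_block l)"
  unfolding block_event_def
proof (intro conjI ballI)
  have meas: "Measurable.pred \<Omega> (\<lambda>\<omega>. corner_block l \<sigma> \<omega> \<tau>)" for \<sigma> \<tau>
    unfolding corner_block_def
    by (intro pred_intros_logic pred_intros_finite finite_words_of_length measurable_word) simp_all
  show "Measurable.pred \<Omega> (\<lambda>\<omega>. corner_block l \<sigma> \<omega> \<tau>)" for \<sigma> \<tau> by (rule meas)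
  show "depends_on (- {\<rho>. strict_prefix \<tau> \<rho>}) (\<lambda>\<omega>. corner_block l \<sigma> \<omega> \<tau>)" if \<tau>: "\<tau> \<in> L l" for \<sigma> \<tau>
  proof (rule depends_onI)
    fix c c' :: "nat list \<Rightarrow> bool" assume eq: "\<And>i. i \<in> - {\<rho>. strict_prefix \<tau> \<rho>} \<Longrightarrow> c i = c' i"
    have "c \<rho> = c' \<rho>" if "\<rho> \<in> L l" for \<rho>
      using that \<tau> by (intro eq not_strict_prefix_length) (simp add: words_of_length_def)
    then show "corner_block l \<sigma> c \<tau> = corner_block l \<sigma> c' \<tau>" by (simp add: corner_block_def)
  qed
  define D where "D = {\<rho>\<in>W. length \<rho> \<le> l}"
  have "min p (1 - p) ^ card D \<le> F.prob {c. percolate c (zeros \<sigma> l) \<and> corner_block l \<sigma> (percolate c) (zeros \<sigma> l)}"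
    if \<sigma>: "\<sigma> \<in> W" for \<sigma>
  proof -
    let ?\<tau> = "zeros \<sigma> l"
    have \<tau>: "?\<tau> \<in> L l" by (rule zeros_in[OF \<sigma>])
    have "percolate c ?\<tau> \<and> corner_block l \<sigma> (percolate c) ?\<tau>" if c: "\<forall>\<rho>\<in>D. c \<rho> = prefix \<rho> ?\<tau>" for c
    proof
      have "c (take i ?\<tau>)" for i
      proof -
        have "take i ?\<tau> \<in> D" using \<tau> by (auto simp: D_def words_of_length_def)
        then show ?thesis using c take_is_prefix[of i ?\<tau>] by blast
      qed
      then show "percolate c ?\<tau>" using \<tau> by (simp add: percolate_def words_of_length_def)
      have "\<rho> = ?\<tau>" if \<rho>: "\<rho> \<in> L l" "percolate c \<rho>" for \<rho>
      proof -
        have len: "length \<rho> = l" "\<rho> \<in> W" using \<rho>(1) by (simp_all add: words_of_length_def)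
        then have "\<forall>i\<in>{1..l}. c (take i \<rho>)" using \<rho>(2) by (simp add: percolate_def)
        then have "c (take l \<rho>)" by (rule bspec) (use l in simp)
        then have "c \<rho>" using len by simp
        then have "prefix \<rho> ?\<tau>" using c len by (simp add: D_def)
        then show ?thesis using \<tau> len by (auto simp: prefix_def words_of_length_def)
      qed
      then show "corner_block l \<sigma> (percolate c) ?\<tau>" by (simp add: corner_block_def)
    qed
    then have "F.prob {c. \<forall>\<rho>\<in>D. c \<rho> = prefix \<rho> ?\<tau>} \<le>
        F.prob {c. percolate c ?\<tau> \<and> corner_block l \<sigma> (percolate c) ?\<tau>}"
      by (intro F.finite_measure_mono sets_open_and[where A="corner_block l", OF \<tau> meas]) (auto simp: subset_iff)
    then show ?thesis using prob_bernoulli_ge[of D "\<lambda>\<rho>. prefix \<rho> ?\<tau>"] by (simp add: D_def)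
  qed
  moreover have "0 < min p (1 - p) ^ card D" using p_pos p1 by simp
  ultimately show "\<exists>\<delta>>0. \<forall>\<sigma>\<in>W. \<exists>\<tau>\<in>L l. \<delta> \<le> F.prob {c. percolate c \<tau> \<and> corner_block l \<sigma> (percolate c) \<tau>}"
    using zeros_in by blast
qed (rule l)

definition fully_surviving :: "nat \<Rightarrow> (nat list \<Rightarrow> bool) \<Rightarrow> bool" where
  "fully_surviving l c \<longleftrightarrow> (\<forall>\<rho>\<in>L l. percolate c \<rho> \<and> survives k CARD('m) (percolate (subtree \<rho> c)))"

lemma measurable_fully_surviving: "Measurable.pred field (fully_surviving l)"
proof -
  have "Measurable.pred field (\<lambda>c. percolate c \<rho>)" if "\<rho> \<in> L l" for \<rho>
    by (rule measurable_compose[OF measurable_percolate measurable_word[OF that]])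
  moreover have "Measurable.pred field (\<lambda>c. survives k CARD('m) (percolate (subtree \<rho> c)))" for \<rho>
    by (rule measurable_compose[OF measurable_subtree measurable_compose[OF measurable_percolate measurable_survives]])
  ultimately show ?thesis
    unfolding fully_surviving_def
    by (intro pred_intros_finite finite_words_of_length pred_intros_logic)
qed

lemma depends_on_fully_surviving: "depends_on (- {[]}) (fully_surviving l)"
proof (rule depends_onI)
  fix c c' :: "nat list \<Rightarrow> bool" assume eq: "\<And>i. i \<in> - {[]} \<Longrightarrow> c i = c' i"
  have "percolate (subtree \<rho> c) = percolate (subtree \<rho> c')" for \<rho>
    by (rule depends_onD[OF depends_on_percolate]) (simp add: subtree_apply eq)
  moreover have "percolate c = percolate c'" by (rule depends_onD[OF depends_on_percolate]) (rule eq)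
  ultimately show "fully_surviving l c = fully_surviving l c'" by (simp add: fully_surviving_def)
qed

text \<open>Induction on \<open>l\<close>: it suffices that each child is open and fully surviving to depth \<open>l - 1\<close>,
and these finitely many conditions are independent.\<close>

lemma prob_fully_surviving_pos: "0 < F.prob {c. fully_surviving l c}"
proof (induction l)
  case 0
  have "fully_surviving 0 c \<longleftrightarrow> survives k CARD('m) (percolate c)" for c
    by (simp add: fully_surviving_def words_of_length_0)
  then show ?case using prob_survives_pos by simp
next
  case (Suc l)
  define g where "g j c \<longleftrightarrow> c [j] \<and> fully_surviving l (subtree [j] c)" for j :: nat and c
  define branch where "branch j = range (\<lambda>\<rho>. j # \<rho>)" for j :: nat
  have fm: "Measurable.pred field (\<lambda>c. fully_surviving l (subtree [j] c))" for j
    by (rule measurable_compose[OF measurable_subtree measurable_fully_surviving])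
  have gm: "Measurable.pred field (g j)" for j
    unfolding g_def using measurable_coordinate[of "[j]"] fm[of j] by (rule pred_intros_logic)
  have dep_f: "depends_on ((@) [j] ` (- {[]})) (\<lambda>c. fully_surviving l (subtree [j] c))" for j
    by (rule depends_on_subtree[OF depends_on_fully_surviving])
  have dep_g: "depends_on (branch j) (g j)" for j
  proof (rule depends_onI)
    fix c c' :: "nat list \<Rightarrow> bool" assume eq: "\<And>i. i \<in> branch j \<Longrightarrow> c i = c' i"
    have "fully_surviving l (subtree [j] c) = fully_surviving l (subtree [j] c')"
      by (rule depends_onD[OF dep_f]) (auto simp: branch_def intro!: eq)
    moreover have "c [j] = c' [j]" by (rule eq) (simp add: branch_def)
    ultimately show "g j c = g j c'" by (simp add: g_def)
  qed
  have g_pos: "0 < F.prob {c. g j c}" for j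
  proof -
    have "F.prob {c. g j c} = F.prob {c. c [j]} * F.prob {c. fully_surviving l (subtree [j] c)}"
      unfolding g_def
    proof (rule prob_conj_of_depends_on[OF measurable_coordinate _ fm dep_f])
      show "depends_on {[j]} (\<lambda>c. c [j])" by (rule depends_onI) simp
    qed auto
    moreover have "F.prob {c. c [j]} = p"
      using prob_finite_box[of "{[j]}" "\<lambda>_. {True}"] p_pos p_le_1 by (simp add: measure_pmf_single)
    moreover have "F.prob {c. fully_surviving l (subtree [j] c)} = F.prob {c. fully_surviving l c}"
    proof -
      have S: "{c. fully_surviving l c} \<in> sets field" using measurable_fully_surviving by (simp add: pred_def)
      have "F.prob {c. fully_surviving l c} = measure (distr field field (subtree [j])) {c. fully_surviving l c}"
        by (simp only: distr_subtree)
      also have "\<dots> = F.prob (subtree [j] -` {c. fully_surviving l c} \<inter> space field)"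
        by (rule measure_distr[OF measurable_subtree S])
      finally show ?thesis by (simp add: vimage_def)
    qed
    ultimately show ?thesis using Suc.IH p_pos by simp
  qed
  have "0 < F.prob {c. \<forall>j\<in>S. g j c}" if "finite S" for S
    using that
  proof (induction S rule: finite_induct)
    case empty then show ?case using F.prob_space by simp
  next
    case (insert j S)
    have "F.prob {c. g j c \<and> (\<forall>j\<in>S. g j c)} = F.prob {c. g j c} * F.prob {c. \<forall>j\<in>S. g j c}"
    proof (rule prob_conj_of_depends_on[OF gm dep_g])
      show "Measurable.pred field (\<lambda>c. \<forall>j\<in>S. g j c)" using insert gm by (intro pred_intros_finite)
      show "depends_on (\<Union>j\<in>S. branch j) (\<lambda>c. \<forall>j\<in>S. g j c)"
      proof (rule depends_onI)
        fix c c' :: "nat list \<Rightarrow> bool" assume eq: "\<And>i. i \<in> (\<Union>j\<in>S. branch j) \<Longrightarrow> c i = c' i"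
        have "g j c = g j c'" if "j \<in> S" for j
          by (rule depends_onD[OF dep_g]) (use that in \<open>auto intro!: eq\<close>)
        then show "(\<forall>j\<in>S. g j c) = (\<forall>j\<in>S. g j c')" by simp
      qed
      show "branch j \<inter> (\<Union>j\<in>S. branch j) = {}" using insert by (auto simp: branch_def)
    qed
    then show ?case using insert g_pos[of j] by simp
  qed
  from this[OF finite_alphabet] have "0 < F.prob {c. \<forall>j\<in>I. g j c}" .
  also have "\<dots> \<le> F.prob {c. fully_surviving (Suc l) c}"
  proof (rule F.finite_measure_mono)
    show "{c. fully_surviving (Suc l) c} \<in> F.events" using measurable_fully_surviving by (simp add: pred_def)
    show "{c. \<forall>j\<in>I. g j c} \<subseteq> {c. fully_surviving (Suc l) c}"
    proof
      fix c assume "c \<in> {c. \<forall>j\<in>I. g j c}"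
      then have g: "g j c" if "j \<in> I" for j using that by simp
      have "percolate c \<rho> \<and> survives k CARD('m) (percolate (subtree \<rho> c))" if \<rho>L: "\<rho> \<in> L (Suc l)" for \<rho>
      proof -
        obtain j \<rho>' where \<rho>: "\<rho> = [j] @ \<rho>'" "j \<in> I" "\<rho>' \<in> L l"
          using \<rho>L by (cases \<rho>) (auto simp: words_of_length_def)
        have "percolate (subtree [j] c) \<rho>'" "survives k CARD('m) (percolate (subtree \<rho>' (subtree [j] c)))" "c [j]"
          using g[OF \<rho>(2)] \<rho>(3) by (simp_all add: g_def fully_surviving_def del: subtree_subtree)
        moreover have "percolate c \<rho> \<longleftrightarrow> percolate c [j] \<and> percolate (subtree [j] c) \<rho>'"
          unfolding \<rho>(1) using \<rho>(2,3) by (intro percolate_append) (auto simp: words_of_length_def)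
        ultimately show ?thesis using \<rho>(2) by (simp add: \<rho>(1) percolate_singleton)
      qed
      then show "c \<in> {c. fully_surviving (Suc l) c}" by (simp add: fully_surviving_def)
    qed
  qed
  finally show ?case .
qed

lemma block_event_full_block:
  assumes l: "0 < l"
  shows "block_event l (full_block l)"
  unfolding block_event_def
proof (intro conjI ballI)
  have sm: "Measurable.pred \<Omega> (\<lambda>\<omega>. survives k CARD('m) (subtree \<rho> \<omega>))" if "\<rho> \<in> L l" for \<rho>
    by (rule measurable_compose[OF measurable_subtree_config measurable_survives])
      (use that in \<open>simp add: words_of_length_def\<close>)
  have meas: "Measurable.pred \<Omega> (\<lambda>\<omega>. full_block l \<sigma> \<omega> \<tau>)" for \<sigma> \<tau>
    unfolding full_block_def
    by (intro pred_intros_finite finite_words_of_length pred_intros_logic measurable_word sm) simp_all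
  show "Measurable.pred \<Omega> (\<lambda>\<omega>. full_block l \<sigma> \<omega> \<tau>)" for \<sigma> \<tau> by (rule meas)
  {
    fix \<sigma> \<tau> assume "\<sigma> \<in> W" and \<tau>: "\<tau> \<in> L l"
    show "depends_on (- {\<rho>. strict_prefix \<tau> \<rho>}) (\<lambda>\<omega>. full_block l \<sigma> \<omega> \<tau>)"
    proof (rule depends_onI)
      fix c c' :: "nat list \<Rightarrow> bool" assume eq: "\<And>i. i \<in> - {\<rho>. strict_prefix \<tau> \<rho>} \<Longrightarrow> c i = c' i"
      have 1: "c \<rho> = c' \<rho>" if "\<rho> \<in> L l" for \<rho>
        using that \<tau> by (intro eq not_strict_prefix_length) (simp add: words_of_length_def)
      have 2: "subtree \<rho> c = subtree \<rho> c'" if "\<rho> \<in> L l" "\<rho> \<noteq> \<tau>" for \<rho>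
      proof
        fix \<rho>'
        have "\<not> strict_prefix \<tau> (\<rho> @ \<rho>')"
          using that \<tau> by (auto simp: strict_prefix_def prefix_def words_of_length_def append_eq_append_conv)
        then show "subtree \<rho> c \<rho>' = subtree \<rho> c' \<rho>'" by (simp add: subtree_apply eq)
      qed
      show "full_block l \<sigma> c \<tau> = full_block l \<sigma> c' \<tau>"
        unfolding full_block_def
      proof (rule ball_cong[OF refl])
        fix \<rho> assume "\<rho> \<in> L l"
        then show "(c \<rho> \<and> (\<rho> \<noteq> \<tau> \<longrightarrow> survives k CARD('m) (subtree \<rho> c))) =
            (c' \<rho> \<and> (\<rho> \<noteq> \<tau> \<longrightarrow> survives k CARD('m) (subtree \<rho> c')))"
          using 1[of \<rho>] 2[of \<rho>] by (cases "\<rho> = \<tau>") simp_all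
      qed
    qed
  }
  \<comment> \<open>Every block serves as witness; \<open>zeros \<sigma> l\<close> is one at hand.\<close>
  have "F.prob {c. fully_surviving l c} \<le> F.prob {c. percolate c (zeros \<sigma> l) \<and> full_block l \<sigma> (percolate c) (zeros \<sigma> l)}"
    if \<sigma>: "\<sigma> \<in> W" for \<sigma>
  proof (rule F.finite_measure_mono)
    show "{c. percolate c (zeros \<sigma> l) \<and> full_block l \<sigma> (percolate c) (zeros \<sigma> l)} \<in> F.events"
      by (rule sets_open_and[where A="full_block l", OF zeros_in[OF \<sigma>] meas])
    show "{c. fully_surviving l c} \<subseteq> {c. percolate c (zeros \<sigma> l) \<and> full_block l \<sigma> (percolate c) (zeros \<sigma> l)}"
    proof
      fix c assume "c \<in> {c. fully_surviving l c}"
      then have c: "percolate c \<rho> \<and> survives k CARD('m) (percolate (subtree \<rho> c))" if "\<rho> \<in> L l" for \<rho>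
        using that by (simp add: fully_surviving_def)
      have "survives k CARD('m) (subtree \<rho> (percolate c))" if "\<rho> \<in> L l" for \<rho>
        using c[OF that] that by (simp add: subtree_percolate words_of_length_def)
      then show "c \<in> {c. percolate c (zeros \<sigma> l) \<and> full_block l \<sigma> (percolate c) (zeros \<sigma> l)}"
        using c zeros_in[OF \<sigma>, of l] by (simp add: full_block_def)
    qed
  qed
  then show "\<exists>\<delta>>0. \<forall>\<sigma>\<in>W. \<exists>\<tau>\<in>L l. \<delta> \<le> F.prob {c. percolate c \<tau> \<and> full_block l \<sigma> (percolate c) \<tau>}"
    using zeros_in prob_fully_surviving_pos by blast
qed (rule l)

lemma block_event_digit_block:
  assumes v: "v \<in> digits k"
  shows "block_event 1 (digit_block v)"
  unfolding block_event_def
proof (intro conjI ballI)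
  show "depends_on (- {\<rho>. strict_prefix \<tau> \<rho>}) (\<lambda>\<omega>. digit_block v \<sigma> \<omega> \<tau>)" for \<sigma> \<tau>
    by (rule depends_onI) (simp add: digit_block_def)
  show "Measurable.pred \<Omega> (\<lambda>\<omega>. digit_block v \<sigma> \<omega> \<tau>)" for \<sigma> \<tau>
    unfolding digit_block_def by simp
  have "\<exists>\<tau>\<in>L 1. p \<le> F.prob {c. percolate c \<tau> \<and> digit_block v \<sigma> (percolate c) \<tau>}" if \<sigma>: "\<sigma> \<in> W" for \<sigma>
  proof
    let ?j = "letter \<sigma> v"
    have j: "?j \<in> I" using letter[OF \<sigma> v] by blast
    show "[?j] \<in> L 1" using j by (simp add: words_of_length_def)
    have "{c. percolate c [?j] \<and> digit_block v \<sigma> (percolate c) [?j]} = {c. c [?j]}"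
      using j by (simp add: digit_block_def percolate_singleton)
    then show "p \<le> F.prob {c. percolate c [?j] \<and> digit_block v \<sigma> (percolate c) [?j]}"
      using prob_finite_box[of "{[?j]}" "\<lambda>_. {True}"] p_pos p_le_1 by (simp add: measure_pmf_single)
  qed
  then show "\<exists>\<delta>>0. \<forall>\<sigma>\<in>W. \<exists>\<tau>\<in>L 1. \<delta> \<le> F.prob {c. percolate c \<tau> \<and> digit_block v \<sigma> (percolate c) \<tau>}"
    using p_pos by blast
qed simp


section \<open>Blocks that decide about holes\<close>

text \<open>Inside an open cube the limit set depends only on the configuration below its word.\<close>

lemma mem_limit_set_open_cube:
  assumes \<sigma>: "\<sigma> \<in> W" and y: "y \<in> open_cube \<sigma>" "y \<in> K \<omega>"
  shows "\<exists>\<rho>\<in>L l. \<omega> (\<sigma> @ \<rho>) \<and> y \<in> cube k e (\<sigma> @ \<rho>)"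
proof -
  obtain \<rho>' where \<rho>': "\<rho>' \<in> L (length \<sigma> + l)" "\<omega> \<rho>'" "y \<in> cube k e \<rho>'"
    using y(2) unfolding mem_limit_set by blast
  have w: "\<rho>' \<in> W" "length \<rho>' = length \<sigma> + l" using \<rho>'(1) by (simp_all add: words_of_length_def)
  have "y \<in> cube k e (take (length \<sigma>) \<rho>')" using cube_take_subset[OF w(1)] \<rho>'(3) by blast
  then have eq: "\<sigma> = take (length \<sigma>) \<rho>'"
    using w y(1) \<sigma> by (intro open_cube_unique) auto
  define \<rho> where "\<rho> = drop (length \<sigma>) \<rho>'"
  have "take (length \<sigma>) \<rho>' @ \<rho> = \<rho>'" by (simp add: \<rho>_def)
  then have "\<rho>' = \<sigma> @ \<rho>" by (simp only: eq[symmetric])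
  moreover have "\<rho> \<in> L l" using w by (simp add: \<rho>_def words_of_length_def)
  ultimately show ?thesis using \<rho>' by blast
qed

text \<open>The hole is the open cube of side \<open>\<alpha>\<close> times the side of \<open>J\<^bsub>\<sigma>\<^esub>\<close>
in the upper corner; it is disjoint from the corner cube that contains the limit set since the two relative sides add
up to at most one.\<close>

lemma has_hole_of_corner:
  assumes \<sigma>: "\<sigma> \<in> W" and x: "x \<in> open_cube \<sigma>"
    and only: "\<And>\<rho>. \<rho> \<in> L l \<Longrightarrow> \<omega> (\<sigma> @ \<rho>) \<Longrightarrow> \<rho> = zeros \<sigma> l"
    and \<alpha>: "0 < \<alpha>" "\<alpha> \<le> 1 - side l"
  shows "has_hole k (K \<omega>) x \<alpha> (length \<sigma>)"
proof -
  define s where "s = side (length \<sigma>)"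
  define z :: "real ^ 'm" where "z = (\<chi> i. corner k e \<sigma> $ i + s - \<alpha> * s / 2)"
  have s: "0 < s" by (simp add: s_def side_pos)
  have rad: "\<alpha> / (2 * real k ^ length \<sigma>) = \<alpha> * s / 2" by (simp add: s_def side_def)
  have as: "0 < \<alpha> * s" "\<alpha> * s \<le> s - s * side l"
    using \<alpha> s mult_right_mono[OF \<alpha>(2), of s] by (simp_all add: algebra_simps)
  have sl: "0 < s * side l" using s side_pos by simp
  have \<alpha>1: "\<alpha> < 1" using \<alpha> side_pos[of l] by linarith
  have z: "z \<in> kadic_cube_at k (length \<sigma>) x"
    unfolding kadic_cube_at_eq[OF \<sigma> x] using as sl \<alpha>1 by (simp add: z_def flip: s_def)
  have "y \<in> kadic_cube_at k (length \<sigma>) x - K \<omega>" if "y \<in> max_ball z (\<alpha> / (2 * real k ^ length \<sigma>))" for y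
  proof
    have y: "corner k e \<sigma> $ i + s * side l < y $ i" "y $ i < corner k e \<sigma> $ i + s" for i
    proof -
      have zi: "z $ i = corner k e \<sigma> $ i + s - \<alpha> * s / 2" by (simp add: z_def)
      have "\<bar>z $ i - y $ i\<bar> < \<alpha> * s / 2" using that unfolding mem_max_ball rad by blast
      then have "z $ i - y $ i < \<alpha> * s / 2" "- (z $ i - y $ i) < \<alpha> * s / 2" by (simp_all only: abs_less_iff)
      then show "corner k e \<sigma> $ i + s * side l < y $ i" "y $ i < corner k e \<sigma> $ i + s"
        using zi as by linarith+
    qed
    have yo: "y \<in> open_cube \<sigma>"
      unfolding open_cube_def mem_Collect_eq
    proof (intro allI conjI)
      fix i
      show "corner k e \<sigma> $ i < y $ i" using y(1)[of i] sl by linarith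
      show "y $ i < corner k e \<sigma> $ i + side (length \<sigma>)" using y(2)[of i] by (simp add: s_def)
    qed
    show "y \<in> kadic_cube_at k (length \<sigma>) x"
      unfolding kadic_cube_at_eq[OF \<sigma> x] using yo by (simp add: open_cube_def less_imp_le)
    show "y \<notin> K \<omega>"
    proof
      assume "y \<in> K \<omega>"
      from mem_limit_set_open_cube[OF \<sigma> yo this] obtain \<rho> where
        \<rho>: "\<rho> \<in> L l" "\<omega> (\<sigma> @ \<rho>)" "y \<in> cube k e (\<sigma> @ \<rho>)" by blast
      then have "y \<in> cube k e (\<sigma> @ zeros \<sigma> l)" using only by blast
      then have "y $ i \<le> corner k e (\<sigma> @ zeros \<sigma> l) $ i + side (length (\<sigma> @ zeros \<sigma> l))" for i
        unfolding mem_cube by blast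
      then have "y $ i \<le> corner k e \<sigma> $ i + s * side l" for i
        using zeros_in[OF \<sigma>, of l] by (simp add: corner_zeros[OF \<sigma>] words_of_length_def side_add s_def)
      then show False using y(1) not_le by blast
    qed
  qed
  then show ?thesis unfolding has_hole_def using z by blast
qed

text \<open>The centre of a hole would lie in some subcube of generation \<open>l\<close>. Its relative side \<open>side l\<close>
is less than half of \<open>\<alpha>\<close>, so it would be contained in the hole; but it meets the limit set.\<close>

lemma no_hole_of_full:
  assumes \<omega>: "regular \<omega>" and \<sigma>: "\<sigma> \<in> W" and \<tau>: "\<tau> \<in> L l" and x: "x \<in> open_cube (\<sigma> @ \<tau>)" "x \<in> K \<omega>"
    and surv: "\<And>\<rho>. \<rho> \<in> L l \<Longrightarrow> \<rho> \<noteq> \<tau> \<Longrightarrow> survives k CARD('m) (subtree (\<sigma> @ \<rho>) \<omega>)"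
    and \<alpha>: "2 * side l < \<alpha>"
  shows "\<not> has_hole k (K \<omega>) x \<alpha> (length \<sigma>)"
proof
  define s where "s = side (length \<sigma>)"
  have s: "0 < s" by (simp add: s_def side_pos)
  have \<tau>W: "\<tau> \<in> W" using \<tau> by (simp add: words_of_length_def)
  have x\<sigma>: "x \<in> open_cube \<sigma>" using x(1) open_cube_append_subset[OF \<tau>W \<sigma>] by blast
  have rad: "\<alpha> / (2 * real k ^ length \<sigma>) = \<alpha> * s / 2" by (simp add: s_def side_def)
  assume "has_hole k (K \<omega>) x \<alpha> (length \<sigma>)"
  then obtain z where z: "z \<in> kadic_cube_at k (length \<sigma>) x"
    and sub: "max_ball z (\<alpha> * s / 2) \<subseteq> kadic_cube_at k (length \<sigma>) x - K \<omega>"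
    unfolding has_hole_def rad by blast
  have "z \<in> cube k e \<sigma>" using z unfolding kadic_cube_at_eq[OF \<sigma> x\<sigma>] mem_cube by (simp add: less_imp_le)
  from cube_cover[OF \<sigma> this, of l] obtain \<rho> where \<rho>: "\<rho> \<in> L l" "z \<in> cube k e (\<sigma> @ \<rho>)" by blast
  have "\<exists>y\<in>cube k e (\<sigma> @ \<rho>). y \<in> K \<omega>"
  proof (cases "\<rho> = \<tau>")
    case True then show ?thesis using x open_cube_subset_cube by blast
  next
    case False
    show ?thesis
      by (rule limit_set_meets_cube[OF \<omega> _ surv[OF \<rho>(1) False]]) (use \<sigma> \<rho>(1) in \<open>simp add: words_of_length_def\<close>)
  qed
  then obtain y where y: "y \<in> cube k e (\<sigma> @ \<rho>)" "y \<in> K \<omega>" by blast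
  have "y \<in> max_ball z (\<alpha> * s / 2)"
    unfolding mem_max_ball
  proof
    fix i
    have "\<bar>z $ i - y $ i\<bar> \<le> s * side l"
      using cube_diff_le[OF \<rho>(2) y(1), of i] \<rho>(1) by (simp add: words_of_length_def side_add s_def)
    also have "\<dots> < \<alpha> * s / 2" using mult_strict_right_mono[OF \<alpha> s] by (simp add: mult_ac)
    finally show "\<bar>z $ i - y $ i\<bar> < \<alpha> * s / 2" .
  qed
  then show False using sub y(2) by blast
qed

text \<open>A hole of full relative size is centred at the centre of the cube and fills its interior, which contains the point
\<open>x\<close> of the limit set.\<close>

lemma no_hole_1:
  assumes \<sigma>: "\<sigma> \<in> W" and x: "x \<in> open_cube \<sigma>" "x \<in> K \<omega>"
  shows "\<not> has_hole k (K \<omega>) x 1 (length \<sigma>)"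
proof
  define s where "s = side (length \<sigma>)"
  have s: "0 < s" by (simp add: s_def side_pos)
  have rad: "1 / (2 * real k ^ length \<sigma>) = s / 2" by (simp add: s_def side_def)
  assume "has_hole k (K \<omega>) x 1 (length \<sigma>)"
  then obtain z where sub: "max_ball z (s / 2) \<subseteq> kadic_cube_at k (length \<sigma>) x - K \<omega>"
    unfolding has_hole_def rad by blast
  have zi: "z $ i = corner k e \<sigma> $ i + s / 2" for i
  proof -
    \<comment> \<open>Moving the centre along axis \<open>i\<close> by less than the radius stays in the ball, hence in the cube.\<close>
    have *: "corner k e \<sigma> $ i \<le> z $ i + t \<and> z $ i + t < corner k e \<sigma> $ i + s" if "\<bar>t\<bar> < s / 2" for t
    proof -
      have "(\<chi> j. if j = i then z $ j + t else z $ j) \<in> max_ball z (s / 2)"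
        unfolding mem_max_ball using that s by simp
      then have "(\<chi> j. if j = i then z $ j + t else z $ j) \<in> kadic_cube_at k (length \<sigma>) x" using sub by blast
      then show ?thesis
        unfolding kadic_cube_at_eq[OF \<sigma> x(1)] mem_Collect_eq by (auto simp: s_def dest: spec[of _ i])
    qed
    have "corner k e \<sigma> $ i + s / 2 \<le> z $ i"
    proof (rule field_le_epsilon)
      fix d :: real assume d: "0 < d"
      have "\<bar>- max 0 (s / 2 - d)\<bar> < s / 2"
        using s d by (cases "d \<le> s / 2") (simp_all add: max_def)
      from *[OF this] show "corner k e \<sigma> $ i + s / 2 \<le> z $ i + d" by linarith
    qed
    moreover have "z $ i \<le> corner k e \<sigma> $ i + s / 2"
    proof (rule field_le_epsilon)
      fix d :: real assume d: "0 < d"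
      have "\<bar>max 0 (s / 2 - d)\<bar> < s / 2"
        using s d by (cases "d \<le> s / 2") (simp_all add: max_def)
      from *[OF this] show "z $ i \<le> corner k e \<sigma> $ i + s / 2 + d" by linarith
    qed
    ultimately show ?thesis by linarith
  qed
  have "x \<in> max_ball z (s / 2)"
    unfolding mem_max_ball
  proof
    fix i
    have "corner k e \<sigma> $ i < x $ i" "x $ i < corner k e \<sigma> $ i + s"
      using x(1) by (simp_all add: open_cube_def s_def)
    then show "\<bar>z $ i - x $ i\<bar> < s / 2" unfolding zi abs_less_iff by (intro conjI; linarith)
  qed
  then show False using sub x(2) by blast
qed

lemma has_hole_0:
  fixes x :: "real ^ 'm"
  shows "has_hole k A x 0 j"
proof -
  have "x \<in> kadic_cube_at k j x" using k_ge_2 by (intro mem_kadic_cube_at) simp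
  moreover have "max_ball x 0 = {}" by (simp add: max_ball_def set_eq_iff not_less infnorm_pos_le)
  ultimately show ?thesis unfolding has_hole_def by force
qed


section \<open>From codes to points\<close>

lemma occurrences_initial_word:
  "occurrences A l [] \<omega> n (initial_word \<eta> (n * l)) = card {i\<in>{1..n}. occurs A l [] \<omega> (initial_word \<eta> (i * l))}"
proof -
  have "{i\<in>{1..n}. occurs A l [] \<omega> (take (i * l) (initial_word \<eta> (n * l)))} =
      {i\<in>{1..n}. occurs A l [] \<omega> (initial_word \<eta> (i * l))}"
    by (rule Collect_cong, rule conj_cong[OF refl]) (simp add: take_initial_word)
  then show ?thesis by (simp add: occurrences_def)
qed

lemma occurs_digit_block:
  assumes \<eta>: "\<eta> \<in> UNIV \<rightarrow>\<^sub>E I" and v: "v \<in> digits k"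
    and occ: "occurs (digit_block v) 1 [] \<omega> (initial_word \<eta> (Suc n))"
  shows "e (initial_word \<eta> n) (\<eta> n) = v"
proof -
  have "[\<eta> n] = [letter (initial_word \<eta> n) v]"
    using occ by (simp add: occurs_def digit_block_def initial_word_Suc)
  then have "\<eta> n = letter (initial_word \<eta> n) v" by simp
  moreover have "initial_word \<eta> n \<in> W" using initial_word_in_words[OF \<eta>, of n] by (simp add: words_of_length_def)
  ultimately show ?thesis using letter[OF _ v] by simp
qed

lemma space_code_measure:
  "converging \<omega> \<Longrightarrow> space (code_measure k e p \<omega>) = UNIV \<rightarrow>\<^sub>E I"
  using sets_eq_imp_space_eq[OF sets_code_measure[OF refl, of \<omega> e]] by (simp add: space_code_space)

lemma AE_digit_infinitely_often:
  assumes P: "percolation_measure k CARD('m) p P" and v: "v \<in> digits k"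
  shows "AE \<omega> in P. AE \<eta> in code_measure k e p \<omega>. \<forall>n. \<exists>N\<ge>n. e (initial_word \<eta> N) (\<eta> N) = v"
proof -
  obtain \<epsilon> where \<epsilon>: "0 < \<epsilon>" and ev: "AE \<omega> in P. AE \<eta> in code_measure k e p \<omega>.
    eventually (\<lambda>n. \<epsilon> * real n \<le> real (occurrences (digit_block v) 1 [] \<omega> n (initial_word \<eta> (n * 1)))) sequentially"
    using AE_occurrences_frequent[OF refl block_event_digit_block[OF v] P, of e] by blast
  from ev AE_regular[OF P] show ?thesis
  proof eventually_elim
    case (elim \<omega>)
    then have conv: "converging \<omega>" by (simp add: regular_def)
    from elim(1) AE_space show ?case
    proof eventually_elim
      case (elim \<eta>)
      then have \<eta>: "\<eta> \<in> UNIV \<rightarrow>\<^sub>E I" by (simp add: space_code_measure[OF conv])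
      show ?case
      proof
        fix n
        have "eventually (\<lambda>n. \<epsilon> * real n \<le> real (card {i\<in>{1..n}. occurs (digit_block v) 1 [] \<omega> (initial_word \<eta> i)})) sequentially"
          using elim(1) unfolding occurrences_initial_word by simp
        from frequent_imp_infinitely_often[OF \<epsilon> this] obtain i where
          i: "n < i" "occurs (digit_block v) 1 [] \<omega> (initial_word \<eta> i)" by blast
        then obtain N where N: "i = Suc N" by (cases i) auto
        show "\<exists>N\<ge>n. e (initial_word \<eta> N) (\<eta> N) = v"
          using occurs_digit_block[OF \<eta> v] i N by (intro exI[of _ N]) auto
      qed
    qed
  qed
qed

lemma AE_code_open_cubes:
  assumes P: "percolation_measure k CARD('m) p P"
  shows "AE \<omega> in P. AE \<eta> in code_measure k e p \<omega>. \<forall>n. coded_point k e \<eta> \<in> open_cube (initial_word \<eta> n)"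
  using AE_digit_infinitely_often[OF P zero_digit] AE_digit_infinitely_often[OF P top_digit] AE_regular[OF P]
proof eventually_elim
  case (elim \<omega>)
  then have conv: "converging \<omega>" by (simp add: regular_def)
  from elim(1,2) AE_space show ?case
  proof eventually_elim
    case (elim \<eta>)
    then have \<eta>: "\<eta> \<in> UNIV \<rightarrow>\<^sub>E I" by (simp add: space_code_measure[OF conv])
    show ?case using elim(1,2) by (intro allI coded_point_in_open_cube[OF \<eta>]) blast+
  qed
qed

text \<open>Only Borel properties of points can be pulled back to codes. This is why the following statements refer to open cubes
containing \<open>x\<close> instead of a code of \<open>x\<close>.\<close>

lemma AE_natural_measureI:
  assumes conv: "converging \<omega>" and Q: "{x. Q x} \<in> sets borel"
    and AE: "AE \<eta> in code_measure k e p \<omega>. Q (coded_point k e \<eta>)"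
  shows "AE x in natural_measure k e p \<omega>. Q x"
proof -
  have "coded_point k e \<in> borel_measurable (code_measure k e p \<omega>)"
    unfolding measurable_cong_sets[OF sets_code_measure[OF refl conv, of e] refl] by (rule measurable_coded_point)
  then show ?thesis
    unfolding natural_measure_def by (rule AE_distr_iff[THEN iffD2]) (use Q AE in simp_all)
qed

lemma sets_open_cube: "open_cube \<sigma> \<in> sets borel" by (rule borel_open[OF open_open_cube])

lemma AE_natural_chosen:
  assumes P: "percolation_measure k CARD('m) p P"
  shows "AE \<omega> in P. AE x in natural_measure k e p \<omega>. \<forall>n. \<exists>\<sigma>\<in>L n. \<omega> \<sigma> \<and> x \<in> open_cube \<sigma>"
  using AE_code_open_cubes[OF P] AE_regular[OF P]
proof eventually_elim
  case (elim \<omega>)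
  then have conv: "converging \<omega>" by (simp add: regular_def)
  show ?case
  proof (rule AE_natural_measureI[OF conv])
    have "{x. \<forall>n. \<exists>\<sigma>\<in>L n. \<omega> \<sigma> \<and> x \<in> open_cube \<sigma>} = (\<Inter>n. \<Union>\<sigma>\<in>{\<sigma>\<in>L n. \<omega> \<sigma>}. open_cube \<sigma>)" by blast
    also have "\<dots> \<in> sets borel"
      by (intro sets.countable_INT' sets.finite_UN sets_open_cube finite_subset[OF _ finite_words_of_length] image_subsetI) auto
    finally show "{x. \<forall>n. \<exists>\<sigma>\<in>L n. \<omega> \<sigma> \<and> x \<in> open_cube \<sigma>} \<in> sets borel" .
    from elim(1) AE_code_measure_chosen[OF refl elim(2), of e] AE_space
    show "AE \<eta> in code_measure k e p \<omega>. \<forall>n. \<exists>\<sigma>\<in>L n. \<omega> \<sigma> \<and> coded_point k e \<eta> \<in> open_cube \<sigma>"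
    proof eventually_elim
      case (elim \<eta>)
      then have \<eta>: "\<eta> \<in> UNIV \<rightarrow>\<^sub>E I" by (simp add: space_code_measure[OF conv])
      show ?case using elim(1,2) initial_word_in_words[OF \<eta>] by blast
    qed
  qed
qed

definition frequent_at :: "(nat list \<Rightarrow> (nat list \<Rightarrow> bool) \<Rightarrow> nat list \<Rightarrow> bool) \<Rightarrow> nat \<Rightarrow>
    (nat list \<Rightarrow> bool) \<Rightarrow> real ^ 'm \<Rightarrow> bool" where
  "frequent_at A l \<omega> x \<longleftrightarrow> (\<exists>\<epsilon>>0. eventually (\<lambda>n. \<epsilon> * real n \<le>
    real (card {i\<in>{1..n}. \<exists>\<sigma>\<in>L (i * l). x \<in> open_cube \<sigma> \<and> occurs A l [] \<omega> \<sigma>})) sequentially)"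

lemma AE_natural_frequent:
  assumes P: "percolation_measure k CARD('m) p P" and A: "block_event l A"
  shows "AE \<omega> in P. AE x in natural_measure k e p \<omega>. frequent_at A l \<omega> x"
proof -
  obtain \<epsilon> where \<epsilon>: "0 < \<epsilon>" and ev: "AE \<omega> in P. AE \<eta> in code_measure k e p \<omega>.
    eventually (\<lambda>n. \<epsilon> * real n \<le> real (occurrences A l [] \<omega> n (initial_word \<eta> (n * l)))) sequentially"
    using AE_occurrences_frequent[OF refl A P, of e] by blast
  from ev AE_code_open_cubes[OF P] AE_regular[OF P] show ?thesis
  proof eventually_elim
    case (elim \<omega>)
    then have conv: "converging \<omega>" by (simp add: regular_def)
    define Q where "Q i x \<longleftrightarrow> (\<exists>\<sigma>\<in>L (i * l). x \<in> open_cube \<sigma> \<and> occurs A l [] \<omega> \<sigma>)" for i x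
    have Q_sets: "Measurable.pred borel (Q i)" for i
    proof -
      have "{x. Q i x} = (\<Union>\<sigma>\<in>{\<sigma>\<in>L (i * l). occurs A l [] \<omega> \<sigma>}. open_cube \<sigma>)" unfolding Q_def by blast
      also have "\<dots> \<in> sets borel"
        by (intro sets.finite_UN sets_open_cube finite_subset[OF _ finite_words_of_length]) auto
      finally show ?thesis by (simp add: pred_def)
    qed
    have "AE x in natural_measure k e p \<omega>. eventually (\<lambda>n. \<epsilon> * real n \<le> real (card {i\<in>{1..n}. Q i x})) sequentially"
    proof (rule AE_natural_measureI[OF conv])
      have "(\<lambda>x. card {i\<in>{1..n}. Q i x}) \<in> measurable borel (count_space UNIV)" for n
        using Q_sets by (intro measurable_card[where S="\<lambda>x. {i\<in>{1..n}. Q i x}"]) (auto intro!: pred_intros_logic)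
      then have "Measurable.pred borel (\<lambda>x. \<epsilon> * real n \<le> real (card {i\<in>{1..n}. Q i x}))" for n
        by (rule measurable_compose) simp
      then have S: "{x. \<epsilon> * real n \<le> real (card {i\<in>{1..n}. Q i x})} \<in> sets borel" for n
        by (simp only: pred_def space_borel UNIV_I simp_thms)
      have "{x. eventually (\<lambda>n. \<epsilon> * real n \<le> real (card {i\<in>{1..n}. Q i x})) sequentially} =
          (\<Union>N. \<Inter>n. {x. \<epsilon> * real (N + n) \<le> real (card {i\<in>{1..N + n}. Q i x})})"
        unfolding eventually_sequentially by (simp only: le_iff_add) blast
      also have "\<dots> \<in> sets borel"
        by (intro sets.countable_UN sets.countable_INT' image_subsetI S) simp_all
      finally show "{x. eventually (\<lambda>n. \<epsilon> * real n \<le> real (card {i\<in>{1..n}. Q i x})) sequentially} \<in> sets borel" .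
      from elim(1,2) AE_space
      show "AE \<eta> in code_measure k e p \<omega>. eventually (\<lambda>n. \<epsilon> * real n \<le>
          real (card {i\<in>{1..n}. Q i (coded_point k e \<eta>)})) sequentially"
      proof eventually_elim
        case (elim \<eta>)
        then have \<eta>: "\<eta> \<in> UNIV \<rightarrow>\<^sub>E I" by (simp add: space_code_measure[OF conv])
        have "Q i (coded_point k e \<eta>)" if "occurs A l [] \<omega> (initial_word \<eta> (i * l))" for i
          using that elim(2) initial_word_in_words[OF \<eta>, of "i * l"] unfolding Q_def by blast
        then have "card {i\<in>{1..n}. occurs A l [] \<omega> (initial_word \<eta> (i * l))} \<le> card {i\<in>{1..n}. Q i (coded_point k e \<eta>)}" for n
          by (intro card_mono) auto
        then have "real (occurrences A l [] \<omega> n (initial_word \<eta> (n * l))) \<le> real (card {i\<in>{1..n}. Q i (coded_point k e \<eta>)})" for n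
          unfolding occurrences_initial_word by simp
        then show ?case by (intro eventually_mono[OF elim(1)]) (rule order.trans)
      qed
    qed
    then show ?case
    proof eventually_elim
      case (elim x)
      then show ?case unfolding Q_def frequent_at_def using \<epsilon> by (intro exI[of _ \<epsilon>] conjI)
    qed
  qed
qed

text \<open>A word in the form in which the lemmas about holes need it: position followed by block.\<close>

lemma occurs_split:
  assumes "1 \<le> i" "\<sigma> \<in> L (i * l)" "x \<in> open_cube \<sigma>" "occurs A l [] \<omega> \<sigma>"
  obtains \<sigma>' \<tau> where "\<sigma> = \<sigma>' @ \<tau>" "\<sigma>' \<in> W" "length \<sigma>' = (i - 1) * l" "\<tau> \<in> L l"
    "x \<in> open_cube \<sigma>'" "A \<sigma>' (subtree \<sigma>' \<omega>) \<tau>"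
proof -
  define \<sigma>' \<tau> where "\<sigma>' = take (length \<sigma> - l) \<sigma>" and "\<tau> = drop (length \<sigma> - l) \<sigma>"
  have len: "length \<sigma> = i * l" "\<sigma> \<in> W" using assms(2) by (simp_all add: words_of_length_def)
  have il: "i * l - l = (i - 1) * l" by (simp add: diff_mult_distrib)
  have "l \<le> i * l" using assms(1) by simp
  then have "length \<tau> = l" using len by (simp add: \<tau>_def)
  then have 1: "\<sigma> = \<sigma>' @ \<tau>" "\<sigma>' \<in> W" "length \<sigma>' = (i - 1) * l" "\<tau> \<in> L l"
    using len by (simp_all add: \<sigma>'_def \<tau>_def words_of_length_def il)
  have "x \<in> open_cube \<sigma>'"
    using open_cube_append_subset[of \<tau> \<sigma>'] assms(3) 1 by (auto simp: words_of_length_def)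
  moreover have "A \<sigma>' (subtree \<sigma>' \<omega>) \<tau>"
    using assms(4) by (simp add: occurs_def \<sigma>'_def \<tau>_def)
  ultimately show ?thesis using that 1 by blast
qed

lemma lower_mean_porosity_pos:
  assumes l: "0 < l" and \<alpha>: "0 < \<alpha>" "\<alpha> \<le> 1 - side l" and freq: "frequent_at (corner_block l) l \<omega> x"
  shows "0 < lower_mean_porosity k (K \<omega>) x \<alpha>"
proof -
  obtain \<epsilon> where \<epsilon>: "0 < \<epsilon>" and ev: "eventually (\<lambda>n. \<epsilon> * real n \<le>
      real (card {i\<in>{1..n}. \<exists>\<sigma>\<in>L (i * l). x \<in> open_cube \<sigma> \<and> occurs (corner_block l) l [] \<omega> \<sigma>})) sequentially"
    using freq unfolding frequent_at_def by blast
  have "has_hole k (K \<omega>) x \<alpha> ((i - 1) * l)"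
    if i: "1 \<le> i" and ex: "\<exists>\<sigma>\<in>L (i * l). x \<in> open_cube \<sigma> \<and> occurs (corner_block l) l [] \<omega> \<sigma>" for i
  proof -
    obtain \<sigma> where \<sigma>: "\<sigma> \<in> L (i * l)" "x \<in> open_cube \<sigma>" "occurs (corner_block l) l [] \<omega> \<sigma>" using ex by blast
    obtain \<sigma>' \<tau> where s: "\<sigma>' \<in> W" "length \<sigma>' = (i - 1) * l" "x \<in> open_cube \<sigma>'"
      "corner_block l \<sigma>' (subtree \<sigma>' \<omega>) \<tau>" by (rule occurs_split[OF i \<sigma>])
    have "has_hole k (K \<omega>) x \<alpha> (length \<sigma>')"
      by (rule has_hole_of_corner[OF s(1,3) _ \<alpha>]) (use s(4) in \<open>unfold corner_block_def subtree_apply, blast\<close>)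
    then show ?thesis by (simp add: s(2))
  qed
  from frequency_of_scales[where H="has_hole k (K \<omega>) x \<alpha>", OF \<epsilon> l ev this] obtain c where c: "0 < c"
    "eventually (\<lambda>N. c \<le> real (card {j\<in>{1..N}. has_hole k (K \<omega>) x \<alpha> j}) / real N) sequentially" by blast
  then have "eventually (\<lambda>N. ereal c \<le> ereal (real (num_holes k (K \<omega>) x \<alpha> N) / real N)) sequentially"
    by (simp add: num_holes_def)
  then have "ereal c \<le> lower_mean_porosity k (K \<omega>) x \<alpha>"
    unfolding lower_mean_porosity_def by (rule Liminf_bounded)
  then show ?thesis using c(1) by (meson ereal_less(2) less_le_trans)
qed

lemma upper_mean_porosity_less_1:
  assumes \<omega>: "regular \<omega>" and x: "x \<in> K \<omega>"
    and l: "0 < l" and \<alpha>: "2 * side l < \<alpha>" and freq: "frequent_at (full_block l) l \<omega> x"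
  shows "upper_mean_porosity k (K \<omega>) x \<alpha> < 1"
proof -
  obtain \<epsilon> where \<epsilon>: "0 < \<epsilon>" and ev: "eventually (\<lambda>n. \<epsilon> * real n \<le>
      real (card {i\<in>{1..n}. \<exists>\<sigma>\<in>L (i * l). x \<in> open_cube \<sigma> \<and> occurs (full_block l) l [] \<omega> \<sigma>})) sequentially"
    using freq unfolding frequent_at_def by blast
  have "\<not> has_hole k (K \<omega>) x \<alpha> ((i - 1) * l)"
    if i: "1 \<le> i" and ex: "\<exists>\<sigma>\<in>L (i * l). x \<in> open_cube \<sigma> \<and> occurs (full_block l) l [] \<omega> \<sigma>" for i
  proof -
    obtain \<sigma> where \<sigma>: "\<sigma> \<in> L (i * l)" "x \<in> open_cube \<sigma>" "occurs (full_block l) l [] \<omega> \<sigma>" using ex by blast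
    obtain \<sigma>' \<tau> where s: "\<sigma> = \<sigma>' @ \<tau>" "\<sigma>' \<in> W" "length \<sigma>' = (i - 1) * l" "\<tau> \<in> L l"
      "full_block l \<sigma>' (subtree \<sigma>' \<omega>) \<tau>" by (rule occurs_split[OF i \<sigma>])
    have "\<not> has_hole k (K \<omega>) x \<alpha> (length \<sigma>')"
    proof (rule no_hole_of_full[OF \<omega> s(2,4) _ x _ \<alpha>])
      show "x \<in> open_cube (\<sigma>' @ \<tau>)" using \<sigma>(2) s(1) by simp
      show "survives k CARD('m) (subtree (\<sigma>' @ \<rho>) \<omega>)" if "\<rho> \<in> L l" "\<rho> \<noteq> \<tau>" for \<rho>
        using s(5) that by (simp add: full_block_def)
    qed
    then show ?thesis by (simp add: s(3))
  qed
  from frequency_of_scales[where H="\<lambda>j. \<not> has_hole k (K \<omega>) x \<alpha> j", OF \<epsilon> l ev this] obtain c where c: "0 < c"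
    "eventually (\<lambda>N. c \<le> real (card {j\<in>{1..N}. \<not> has_hole k (K \<omega>) x \<alpha> j}) / real N) sequentially" by blast
  from c(2) eventually_gt_at_top[of 0]
  have "eventually (\<lambda>N. ereal (real (num_holes k (K \<omega>) x \<alpha> N) / real N) \<le> ereal (1 - c)) sequentially"
  proof eventually_elim
    case (elim N)
    have "card {j\<in>{1..N}. has_hole k (K \<omega>) x \<alpha> j} + card {j\<in>{1..N}. \<not> has_hole k (K \<omega>) x \<alpha> j} =
        card ({j\<in>{1..N}. has_hole k (K \<omega>) x \<alpha> j} \<union> {j\<in>{1..N}. \<not> has_hole k (K \<omega>) x \<alpha> j})"
      by (intro card_Un_disjoint[symmetric]) auto
    also have "{j\<in>{1..N}. has_hole k (K \<omega>) x \<alpha> j} \<union> {j\<in>{1..N}. \<not> has_hole k (K \<omega>) x \<alpha> j} = {1..N}" by blast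
    finally have "real (num_holes k (K \<omega>) x \<alpha> N) + real (card {j\<in>{1..N}. \<not> has_hole k (K \<omega>) x \<alpha> j}) = real N"
      unfolding num_holes_def by (simp flip: of_nat_add)
    then have "real (num_holes k (K \<omega>) x \<alpha> N) / real N = 1 - real (card {j\<in>{1..N}. \<not> has_hole k (K \<omega>) x \<alpha> j}) / real N"
      using elim(2) by (simp add: field_simps)
    then show ?case using elim(1) by simp
  qed
  then have "upper_mean_porosity k (K \<omega>) x \<alpha> \<le> ereal (1 - c)"
    unfolding upper_mean_porosity_def by (rule Limsup_bounded)
  also have "\<dots> < 1" using c(1) by (simp add: one_ereal_def)
  finally show ?thesis .
qed

text \<open>One depth that serves both the corner and the full blocks for the given \<open>\<alpha>\<close>.\<close>

lemma exists_fine_level: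
  assumes "0 < \<alpha>" "\<alpha> < 1"
  shows "\<exists>l>0. \<alpha> \<le> 1 - side l \<and> 2 * side l < \<alpha>"
proof -
  have "eventually (\<lambda>l. side l < min (1 - \<alpha>) (\<alpha> / 2)) sequentially"
    using assms by (intro order_tendstoD[OF side_tendsto_0]) simp
  with eventually_gt_at_top[of 0] have "eventually (\<lambda>l. 0 < l \<and> side l < min (1 - \<alpha>) (\<alpha> / 2)) sequentially"
    by eventually_elim simp
  then obtain l where "0 < l" "side l < min (1 - \<alpha>) (\<alpha> / 2)"
    using eventually_happens'[OF sequentially_bot] by blast
  then show ?thesis by (intro exI[of _ l]) simp
qed

text \<open>The exceptional sets are taken for each of the countably many depths \<open>l\<close>. All \<open>\<alpha>\<close> are
then covered at once, because each is served by some depth.\<close>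

lemma AE_mean_porosity:
  assumes P: "percolation_measure k CARD('m) p P"
  shows "AE \<omega> in P. AE x in natural_measure k e p \<omega>.
      (\<forall>\<alpha>. 0 < \<alpha> \<and> \<alpha> < 1 \<longrightarrow>
          (p < 1 \<longrightarrow> 0 < lower_mean_porosity k (K \<omega>) x \<alpha>) \<and>
          lower_mean_porosity k (K \<omega>) x \<alpha> \<le> upper_mean_porosity k (K \<omega>) x \<alpha> \<and>
          upper_mean_porosity k (K \<omega>) x \<alpha> < 1) \<and>
      has_mean_porosity k (K \<omega>) x 0 1 \<and> has_mean_porosity k (K \<omega>) x 1 0"
proof -
  have corner: "AE \<omega> in P. \<forall>l. AE x in natural_measure k e p \<omega>. 0 < l \<and> p < 1 \<longrightarrow> frequent_at (corner_block l) l \<omega> x"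
    unfolding AE_all_countable
  proof
    fix l
    show "AE \<omega> in P. AE x in natural_measure k e p \<omega>. 0 < l \<and> p < 1 \<longrightarrow> frequent_at (corner_block l) l \<omega> x"
    proof (cases "0 < l \<and> p < 1")
      case True
      then show ?thesis using AE_natural_frequent[OF P block_event_corner_block[of l]] by simp
    qed (intro AE_I2, blast)
  qed
  have full: "AE \<omega> in P. \<forall>l. AE x in natural_measure k e p \<omega>. 0 < l \<longrightarrow> frequent_at (full_block l) l \<omega> x"
    unfolding AE_all_countable
  proof
    fix l
    show "AE \<omega> in P. AE x in natural_measure k e p \<omega>. 0 < l \<longrightarrow> frequent_at (full_block l) l \<omega> x"
    proof (cases "0 < l")
      case True
      then show ?thesis using AE_natural_frequent[OF P block_event_full_block[of l]] by simp
    qed (intro AE_I2, blast)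
  qed
  from corner full AE_natural_chosen[OF P] AE_regular[OF P] show ?thesis
  proof eventually_elim
    case (elim \<omega>)
    note \<omega> = \<open>regular \<omega>\<close>
    from elim(1,2)[unfolded AE_all_countable[symmetric]] elim(3) show ?case
    proof eventually_elim
      case (elim x)
      have x: "x \<in> K \<omega>"
        unfolding mem_limit_set using elim(3) open_cube_subset_cube by blast
      have pos: "0 < lower_mean_porosity k (K \<omega>) x \<alpha>" if \<alpha>: "0 < \<alpha>" "\<alpha> < 1" and p1: "p < 1" for \<alpha>
      proof -
        obtain l where l: "0 < l" "\<alpha> \<le> 1 - side l" using exists_fine_level[OF \<alpha>] by blast
        have freq: "frequent_at (corner_block l) l \<omega> x" using elim(1) l(1) p1 by blast
        show ?thesis by (rule lower_mean_porosity_pos[OF l(1) \<alpha>(1) l(2) freq])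
      qed
      have less: "upper_mean_porosity k (K \<omega>) x \<alpha> < 1" if \<alpha>: "0 < \<alpha>" "\<alpha> < 1" for \<alpha>
      proof -
        obtain l where l: "0 < l" "2 * side l < \<alpha>" using exists_fine_level[OF \<alpha>] by blast
        have freq: "frequent_at (full_block l) l \<omega> x" using elim(2) l(1) by blast
        show ?thesis by (rule upper_mean_porosity_less_1[OF \<omega> x l freq])
      qed
      have le: "lower_mean_porosity k (K \<omega>) x \<alpha> \<le> upper_mean_porosity k (K \<omega>) x \<alpha>" for \<alpha>
        unfolding lower_mean_porosity_def upper_mean_porosity_def by (rule Liminf_le_Limsup) simp
      have zero: "has_mean_porosity k (K \<omega>) x 0 1"
      proof -
        have "{j\<in>{1..N}. has_hole k (K \<omega>) x 0 j} = {1..N}" for N using has_hole_0 by blast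
        then have "num_holes k (K \<omega>) x 0 N = N" for N by (simp add: num_holes_def)
        then have "eventually (\<lambda>N. real (num_holes k (K \<omega>) x 0 N) / real N = 1) sequentially"
          by (intro eventually_mono[OF eventually_gt_at_top[of 0]]) simp
        then show ?thesis unfolding has_mean_porosity_def by (rule tendsto_eventually)
      qed
      have one: "has_mean_porosity k (K \<omega>) x 1 0"
      proof -
        have "\<not> has_hole k (K \<omega>) x 1 j" for j
        proof -
          obtain \<sigma> where "\<sigma> \<in> L j" "x \<in> open_cube \<sigma>" using elim(3) by blast
          then show ?thesis using no_hole_1[of \<sigma> x \<omega>] x by (simp add: words_of_length_def)
        qed
        then show ?thesis by (simp add: has_mean_porosity_def num_holes_def)
      qed
      show ?case using pos less le zero one by blast
    qed
  qed
qed

end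


section \<open>Mean porosity of the limit set\<close>

theorem corollary4p8:
  fixes k :: nat and p :: real
    and e :: "nat list \<Rightarrow> nat \<Rightarrow> real ^ 'm"
    and P :: "(nat list \<Rightarrow> bool) measure"
  assumes "k \<ge> 2"
    and "1 / real k ^ CARD('m) < p" and "p \<le> 1"
    and "subcube_enumeration k e"
    and "percolation_measure k CARD('m) p P"
  shows "AE \<omega> in P. AE x in natural_measure k e p \<omega>.
      (\<forall>\<alpha>. 0 < \<alpha> \<and> \<alpha> < 1 \<longrightarrow>
          (p < 1 \<longrightarrow> 0 < lower_mean_porosity k (limit_set k e \<omega>) x \<alpha>) \<and>
          lower_mean_porosity k (limit_set k e \<omega>) x \<alpha>
            \<le> upper_mean_porosity k (limit_set k e \<omega>) x \<alpha> \<and>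
          upper_mean_porosity k (limit_set k e \<omega>) x \<alpha> < 1) \<and>
      has_mean_porosity k (limit_set k e \<omega>) x 0 1 \<and>
      has_mean_porosity k (limit_set k e \<omega>) x 1 0"
proof -
  interpret fractal_percolation k p e
    using assms(1-4) by unfold_locales
  show ?thesis by (rule AE_mean_porosity[OF assms(5)])
qed

end
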